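(* Let $S$ be an intermediate Kato surface with one branch and simple Dloussky sequence $[s_{k_0}s_{k_1}\cdots s_{k_{p-1}}r_m]$, $m\ge 1$. Let $\mathbf t:=a_1\in\mathbb Q$ be the multiplicity of the tip and let $r(p)$ be the multiplicity of the root, which as a linear function of $\mathbf t$ is $r(p)=[\mathcal P(k_0,\dots,k_{p-1})+1]\,\mathbf t-\mathcal P(k_1,\dots,k_{p-1})$. Then $\mathbf t$ is the solution of the linear equation $\mathbf t+m=r(p)$, that is, $$\mathbf t=\frac{m+\mathcal P(k_1,k_2,\dots,k_{p-1})}{\mathcal P(k_0,k_1,\dots,k_{p-1})}.$$ In particular $\mathbf t>0$, and every multiplicity of $-K$ is a positive integer if and only if $\mathbf t$ is a positive integer. Finally, $$\mathrm{index}(S)=\frac{\mathcal P(k_0,k_1,\dots,k_{p-1})}{\gcd\{\,m+\mathcal P(k_1,k_2,\dots,k_{p-1}),\ \mathcal P(k_0,k_1,\dots,k_{p-1})\}}.$$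
   Context: A Kato surface is a minimal compact complex surface $S$ with $b:=b_2(S)>0$ containing a global spherical shell (an open subset $V$ biholomorphic to a neighbourhood of $S^3\subset\mathbb C^2$ with $S\setminus V$ connected). It contains exactly $b$ rational curves. $S$ is intermediate if its maximal curve $D$ (the sum of these $b$ curves) is connected and consists of one cycle of rational curves together with at least one branch. Then the $b$ curves $D_i$ form a basis of $H^2(S,\mathbb Q)$; the first Chern class of $S$ is denoted $-K$, and $-K=\sum d_iD_i$ with unique $d_i\in\mathbb Q$, called the multiplicities of $-K$. The index of $S$ is the least positive integer $n$ such that $-nK$ is represented by an effective divisor, i.e. $nd_i\in\mathbb Z_{\ge 0}$ for all $i$. Dloussky sequence: listing the curves in their order of creation (cyclically) gives a sequence of integers $\ge 2$, the opposite self-intersection numbers of the curves (if a curve is nodal, which happens only when the cycle is irreducible, its entry $e$ is related to the self-intersection by $D_i^2=-e+2$). The dual graph has, for each entry with value $e$, one edge joining that curve to the curve $e-1$ places after it in cyclic order. Put $s_k=(k+2,2,\dots,2)$ (length $k\ge1$) and $r_m=(2,\dots,2)$ (length $m\ge 1$). $S$ has one branch exactly when its Dloussky sequence is simple: $[s_{k_0}s_{k_1}\cdots s_{k_{p-1}}r_m]$ with $p\ge1$, all $k_i\ge1$, $m\ge1$. Labelling of curves: $\alpha=\sum_{0\le 2i<p}k_{2i}$, $\beta=\sum_{1\le 2i+1<p}k_{2i+1}$. The branch components, from the tip to the root (root excluded), are the chain $A_1,\dots,A_\alpha$; $A_{k_0+k_2+\cdots+k_{2j}}$ has self-intersection $-(k_{2j+1}+2)$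 for $2j+1\le p-1$, and the other $A_i$ have self-intersection $-2$. The cycle components in cyclic order are $C_0,\dots,C_{\beta+m-1}$, with $C_{\beta+m}=C_0$; $C_0$ has entry $k_0+2$, $C_{k_1+k_3+\cdots+k_{2j-1}}$ has entry $k_{2j}+2$ for $2\le 2j\le p-1$, and the others have entry $2$. The root is $R=C_{\beta+1}$ (equal to $C_0$ if $m=1$), and $A_\alpha$ meets $R$. Write $-K=\sum_{i=1}^\alpha a_iA_i+\sum_{j=0}^{\beta+m-1}c_jC_j$. Polynomials: $f(X_1)=X_1$, $f(X_1,X_2)=X_1X_2+1$, $f(X_1,\dots,X_n)=X_nf(X_1,\dots,X_{n-1})+f(X_1,\dots,X_{n-2})$; $\mathcal P(X_1)=X_1$, $\mathcal P(X_1,X_2)=X_1X_2+X_1$, $\mathcal P(X_1,\dots,X_n)=X_nf(X_1,\dots,X_{n-1})+\mathcal P(X_1,\dots,X_{n-1})$; by convention $\mathcal P$ of the empty list is $0$. *)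

theory Defs
  imports "HOL-Complex_Analysis.Complex_Analysis" "HOL-Homology.Homology"
begin

section \<open>Compact complex surfaces\<close>

text \<open>Holomorphic functions of two variables: continuously differentiable with complex-linear
  differential; the vector \<open>a z\<close> consists of the two complex partial derivatives.\<close>

definition holo_fun :: "(complex^2 \<Rightarrow> complex) \<Rightarrow> (complex^2) set \<Rightarrow> bool" where
  "holo_fun f W \<longleftrightarrow> open W \<and>
     (\<exists>a :: complex^2 \<Rightarrow> complex^2. continuous_on W a \<and>
        (\<forall>z\<in>W. (f has_derivative (\<lambda>h. \<Sum>i\<in>UNIV. a z $ i * h $ i)) (at z)))"

definition holo_map :: "(complex^2 \<Rightarrow> complex^2) \<Rightarrow> (complex^2) set \<Rightarrow> bool" where
  "holo_map f W \<longleftrightarrow> (\<forall>i. holo_fun (\<lambda>z. f z $ i) W)"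

definition jacobian :: "(complex^2 \<Rightarrow> complex^2) \<Rightarrow> complex^2 \<Rightarrow> complex^2^2" where
  "jacobian f z = matrix (frechet_derivative f (at z))"

type_synonym 'a chart2 = "'a set \<times> ('a \<Rightarrow> complex^2)"

definition is_chart :: "'a topology \<Rightarrow> 'a chart2 \<Rightarrow> bool" where
  "is_chart X c \<longleftrightarrow> openin X (fst c) \<and> open (snd c ` fst c) \<and>
     homeomorphic_map (subtopology X (fst c)) (top_of_set (snd c ` fst c)) (snd c)"

definition coord_change :: "'a chart2 \<Rightarrow> 'a chart2 \<Rightarrow> complex^2 \<Rightarrow> complex^2" where
  "coord_change c c' = snd c \<circ> inv_into (fst c') (snd c')"

definition compatible :: "'a chart2 \<Rightarrow> 'a chart2 \<Rightarrow> bool" where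
  "compatible c c' \<longleftrightarrow>
     holo_map (coord_change c c') (snd c' ` (fst c \<inter> fst c')) \<and>
     holo_map (coord_change c' c) (snd c ` (fst c \<inter> fst c'))"

record 'a surface =
  space_of :: "'a topology"
  charts :: "'a chart2 set"

definition compact_complex_surface :: "'a surface \<Rightarrow> bool" where
  "compact_complex_surface S \<longleftrightarrow>
     topspace (space_of S) \<noteq> {} \<and> compact_space (space_of S) \<and> connected_space (space_of S) \<and>
     Hausdorff_space (space_of S) \<and> second_countable (space_of S) \<and>
     (\<forall>c\<in>charts S. is_chart (space_of S) c) \<and>
     (\<Union>c\<in>charts S. fst c) = topspace (space_of S) \<and>
     (\<forall>c\<in>charts S. \<forall>c'\<in>charts S. compatible c c')"

text \<open>Members of the maximal atlas.\<close>

definition holo_chart :: "'a surface \<Rightarrow> 'a chart2 \<Rightarrow> bool" where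
  "holo_chart S c \<longleftrightarrow> is_chart (space_of S) c \<and> (\<forall>c'\<in>charts S. compatible c c')"

definition holo_on :: "'a surface \<Rightarrow> ('a \<Rightarrow> complex) \<Rightarrow> 'a set \<Rightarrow> bool" where
  "holo_on S f W \<longleftrightarrow> openin (space_of S) W \<and>
     (\<forall>c\<in>charts S. holo_fun (f \<circ> inv_into (fst c) (snd c)) (snd c ` (fst c \<inter> W)))"


section \<open>Rational curves\<close>

text \<open>The projective line is \<open>complex option\<close>, with \<open>None\<close> the point at infinity and the two
  standard affine charts \<open>Some\<close> and \<open>aff_inf\<close>.\<close>

definition aff_inf :: "complex \<Rightarrow> complex option" where
  "aff_inf w = (if w = 0 then None else Some (inverse w))"

definition holo_path :: "'a surface \<Rightarrow> (complex \<Rightarrow> 'a) \<Rightarrow> bool" where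
  "holo_path S u \<longleftrightarrow> continuous_map euclidean (space_of S) u \<and>
     (\<forall>c\<in>charts S. \<forall>i. (\<lambda>z. snd c (u z) $ i) holomorphic_on {z. u z \<in> fst c})"

definition immersed_path :: "'a surface \<Rightarrow> (complex \<Rightarrow> 'a) \<Rightarrow> bool" where
  "immersed_path S u \<longleftrightarrow>
     (\<forall>c\<in>charts S. \<forall>z. u z \<in> fst c \<longrightarrow> (\<exists>i. deriv (\<lambda>z. snd c (u z) $ i) z \<noteq> 0))"

text \<open>A normalization of a rational curve is a holomorphic map from the projective line that is
  injective up to finitely many points. By Lueroth's theorem the images of these maps are exactly
  the images of the nonconstant holomorphic maps.\<close>

definition normalization :: "'a surface \<Rightarrow> (complex option \<Rightarrow> 'a) \<Rightarrow> 'a set \<Rightarrow> bool" where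
  "normalization S F D \<longleftrightarrow> holo_path S (F \<circ> Some) \<and> holo_path S (F \<circ> aff_inf) \<and>
     finite {p. \<exists>q. q \<noteq> p \<and> F q = F p} \<and> D = range F"

definition immersion :: "'a surface \<Rightarrow> (complex option \<Rightarrow> 'a) \<Rightarrow> bool" where
  "immersion S F \<longleftrightarrow> immersed_path S (F \<circ> Some) \<and> immersed_path S (F \<circ> aff_inf)"

definition rational_curves :: "'a surface \<Rightarrow> 'a set set" where
  "rational_curves S = {D. \<exists>F. normalization S F D}"

definition smooth_rational :: "'a surface \<Rightarrow> 'a set \<Rightarrow> bool" where
  "smooth_rational S D \<longleftrightarrow> (\<exists>F. normalization S F D \<and> immersion S F \<and> inj F)"

text \<open>A rational curve whose only singularity is one node, i.e. a point around which the curve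
  is the union of the two axes in suitable holomorphic coordinates.\<close>

definition nodal_rational :: "'a surface \<Rightarrow> 'a set \<Rightarrow> bool" where
  "nodal_rational S D \<longleftrightarrow> (\<exists>F p q. normalization S F D \<and> immersion S F \<and>
     p \<noteq> q \<and> F p = F q \<and> inj_on F (- {q}) \<and>
     (\<exists>W \<zeta>. holo_chart S (W, \<zeta>) \<and> F p \<in> W \<and> \<zeta> (F p) = 0 \<and>
        (\<forall>y\<in>W. y \<in> D \<longleftrightarrow> \<zeta> y $ 1 = 0 \<or> \<zeta> y $ 2 = 0)))"


section \<open>Line bundles and degrees\<close>

text \<open>Complex line bundles given by cocycles. The convention is that a section has local
  coordinates \<open>\<sigma>\<^sub>i\<close> with \<open>\<sigma>\<^sub>i = trans i j * \<sigma>\<^sub>j\<close>.\<close>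

record ('i, 'a) cocycle =
  idx :: "'i set"
  dom :: "'i \<Rightarrow> 'a set"
  trans :: "'i \<Rightarrow> 'i \<Rightarrow> 'a \<Rightarrow> complex"

definition line_bundle :: "'a topology \<Rightarrow> ('i, 'a) cocycle \<Rightarrow> bool" where
  "line_bundle X L \<longleftrightarrow>
     (\<forall>i\<in>idx L. openin X (dom L i)) \<and> (\<Union>i\<in>idx L. dom L i) = topspace X \<and>
     (\<forall>i\<in>idx L. \<forall>j\<in>idx L.
        continuous_map (subtopology X (dom L i \<inter> dom L j)) euclidean (trans L i j) \<and>
        (\<forall>x \<in> dom L i \<inter> dom L j. trans L i j x \<noteq> 0)) \<and>
     (\<forall>i\<in>idx L. \<forall>j\<in>idx L. \<forall>k\<in>idx L. \<forall>x \<in> dom L i \<inter> dom L j \<inter> dom L k.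
        trans L i k x = trans L i j x * trans L j k x)"

definition bundle_iso :: "'a topology \<Rightarrow> ('i, 'a) cocycle \<Rightarrow> ('j, 'a) cocycle \<Rightarrow> bool" where
  "bundle_iso X L M \<longleftrightarrow> line_bundle X L \<and> line_bundle X M \<and>
     (\<exists>h :: 'j \<Rightarrow> 'i \<Rightarrow> 'a \<Rightarrow> complex.
        (\<forall>j\<in>idx M. \<forall>i\<in>idx L.
           continuous_map (subtopology X (dom M j \<inter> dom L i)) euclidean (h j i) \<and>
           (\<forall>x \<in> dom M j \<inter> dom L i. h j i x \<noteq> 0)) \<and>
        (\<forall>j\<in>idx M. \<forall>j'\<in>idx M. \<forall>i\<in>idx L. \<forall>i'\<in>idx L.
           \<forall>x \<in> dom M j \<inter> dom M j' \<inter> dom L i \<inter> dom L i'.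
             h j i x * trans L i i' x = trans M j j' x * h j' i' x))"

definition bundle_power :: "('i, 'a) cocycle \<Rightarrow> nat \<Rightarrow> ('i, 'a) cocycle" where
  "bundle_power L n = \<lparr>idx = idx L, dom = dom L, trans = (\<lambda>i j x. trans L i j x ^ n)\<rparr>"

text \<open>A nowhere vanishing section, over \<open>T\<close>, of the pullback of \<open>L\<close> by \<open>u\<close>.\<close>

definition frame ::
  "('i, 'a) cocycle \<Rightarrow> (complex \<Rightarrow> 'a) \<Rightarrow> complex set \<Rightarrow> ('i \<Rightarrow> complex \<Rightarrow> complex) \<Rightarrow> bool" where
  "frame L u T s \<longleftrightarrow>
     (\<forall>i\<in>idx L. continuous_on {z\<in>T. u z \<in> dom L i} (s i) \<and>
        (\<forall>z\<in>T. u z \<in> dom L i \<longrightarrow> s i z \<noteq> 0)) \<and>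
     (\<forall>i\<in>idx L. \<forall>j\<in>idx L. \<forall>z\<in>T. u z \<in> dom L i \<inter> dom L j \<longrightarrow> s i z = trans L i j (u z) * s j z)"

text \<open>The degree of the pullback of \<open>L\<close> to the projective line: the line is glued from the two
  closed discs around \<open>0\<close> and infinity, over which the bundle is trivial, and the degree is the
  winding number of the frame at infinity relative to the frame at \<open>0\<close> along the unit circle.
  With this sign the bundle of one point has degree 1.\<close>

definition has_degree ::
  "'a topology \<Rightarrow> ('i, 'a) cocycle \<Rightarrow> (complex option \<Rightarrow> 'a) \<Rightarrow> int \<Rightarrow> bool" where
  "has_degree X L F n \<longleftrightarrow> line_bundle X L \<and>
     (\<exists>s0 s1 q. frame L (F \<circ> Some) (cball 0 1) s0 \<and> frame L (F \<circ> aff_inf) (cball 0 1) s1 \<and>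
        continuous_on (sphere 0 1) q \<and>
        (\<forall>z \<in> sphere 0 1. \<forall>i\<in>idx L. F (Some z) \<in> dom L i \<longrightarrow> s1 i (inverse z) = q z * s0 i z) \<and>
        winding_number (q \<circ> circlepath 0 1) 0 = of_int n)"


section \<open>Divisors, intersection numbers and the anticanonical class\<close>

text \<open>The ideal of germs vanishing on \<open>D\<close> is generated by \<open>F\<close> at every point of \<open>V\<close>.\<close>

definition local_equation :: "'a surface \<Rightarrow> 'a set \<Rightarrow> 'a set \<Rightarrow> ('a \<Rightarrow> complex) \<Rightarrow> bool" where
  "local_equation S D V F \<longleftrightarrow> holo_on S F V \<and> (\<forall>x \<in> V \<inter> D. F x = 0) \<and>
     (\<forall>x\<in>V. \<forall>W G. x \<in> W \<and> holo_on S G W \<and> (\<forall>y \<in> W \<inter> D. G y = 0) \<longrightarrow>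
        (\<exists>W' q. x \<in> W' \<and> W' \<subseteq> V \<inter> W \<and> holo_on S q W' \<and> (\<forall>y\<in>W'. G y = q y * F y)))"

text \<open>The value at \<open>x\<close> of the continuous extension of \<open>F / G\<close> across the zeros of \<open>G\<close>.\<close>

definition ratio_at :: "'a topology \<Rightarrow> ('a \<Rightarrow> complex) \<Rightarrow> ('a \<Rightarrow> complex) \<Rightarrow> 'a \<Rightarrow> complex" where
  "ratio_at X F G x = (THE l. \<exists>W q. openin X W \<and> x \<in> W \<and>
     continuous_map (subtopology X W) euclidean q \<and> (\<forall>y\<in>W. F y = q y * G y) \<and> q x = l)"

text \<open>The line bundle of the divisor \<open>\<Sum>E\<in>\<E>. n E * E\<close>. Its trivializations are indexed by an open
  set together with an equation there for each of the curves.\<close>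

definition divisor_bundle ::
  "'a surface \<Rightarrow> 'a set set \<Rightarrow> ('a set \<Rightarrow> int) \<Rightarrow> ('a set \<times> ('a set \<Rightarrow> 'a \<Rightarrow> complex), 'a) cocycle" where
  "divisor_bundle S \<E> n =
     \<lparr>idx = {(V, \<Phi>). openin (space_of S) V \<and> (\<forall>E\<in>\<E>. local_equation S E V (\<Phi> E))},
      dom = fst,
      trans = (\<lambda>(V, \<Phi>) (W, \<Psi>) x. \<Prod>E\<in>\<E>. ratio_at (space_of S) (\<Phi> E) (\<Psi> E) x powi n E)\<rparr>"

text \<open>The intersection number \<open>D \<cdot> E\<close>, for \<open>E\<close> a rational curve, is the degree on \<open>E\<close> (that is,
  on its normalization) of the line bundle of \<open>D\<close>; \<open>D = E\<close> is allowed. All normalizations of \<open>E\<close>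
  yield the same number.\<close>

definition intersection_number :: "'a surface \<Rightarrow> 'a set \<Rightarrow> 'a set \<Rightarrow> int \<Rightarrow> bool" where
  "intersection_number S D E n \<longleftrightarrow>
     (\<forall>F. normalization S F E \<longrightarrow> has_degree (space_of S) (divisor_bundle S {D} (\<lambda>_. 1)) F n)"

text \<open>The determinant of the holomorphic tangent bundle.\<close>

definition anticanonical :: "'a surface \<Rightarrow> ('a chart2, 'a) cocycle" where
  "anticanonical S =
     \<lparr>idx = charts S, dom = fst,
      trans = (\<lambda>c c' x. det (jacobian (coord_change c c') (snd c' x)))\<rparr>"

text \<open>The identity \<open>-K = \<Sum>E. d E * [E]\<close> in \<open>H\<^sup>2(S,\<rat>)\<close>, the sum ranging over the rational curves.
  The first Chern class identifies topological isomorphism classes of complex line bundles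
  with \<open>H\<^sup>2(S,\<int>)\<close>, and \<open>[E]\<close> is the Chern class of the line bundle of \<open>E\<close>. So the identity holds
  in \<open>H\<^sup>2(S,\<rat>)\<close>, which is \<open>H\<^sup>2(S,\<int>) \<otimes> \<rat>\<close>, iff after multiplication by a suitable positive integer
  it becomes an isomorphism of complex line bundles.\<close>

definition anticanonical_multiplicities :: "'a surface \<Rightarrow> ('a set \<Rightarrow> rat) \<Rightarrow> bool" where
  "anticanonical_multiplicities S d \<longleftrightarrow> (\<exists>N>0.
     (\<forall>E\<in>rational_curves S. of_nat N * d E \<in> \<int>) \<and>
     bundle_iso (space_of S) (bundle_power (anticanonical S) N)
       (divisor_bundle S (rational_curves S) (\<lambda>E. \<lfloor>of_nat N * d E\<rfloor>)))"

definition surface_index :: "'a surface \<Rightarrow> nat" where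
  "surface_index S = (LEAST n. n > 0 \<and>
     (\<exists>d. anticanonical_multiplicities S d \<and> (\<forall>E\<in>rational_curves S. of_nat n * d E \<in> \<nat>)))"


section \<open>Intermediate Kato surfaces\<close>

text \<open>The (torsion-free) rank of an abelian group.\<close>

definition has_rank :: "('g, 'b) monoid_scheme \<Rightarrow> nat \<Rightarrow> bool" where
  "has_rank G n \<longleftrightarrow> (\<exists>B \<subseteq> carrier G. finite B \<and> card B = n \<and>
     (\<forall>c :: 'g \<Rightarrow> int. finprod G (\<lambda>b. b [^]\<^bsub>G\<^esub> c b) B = \<one>\<^bsub>G\<^esub> \<longrightarrow> (\<forall>b\<in>B. c b = 0)) \<and>
     (\<forall>x \<in> carrier G. \<exists>k::int. k \<noteq> 0 \<and> x [^]\<^bsub>G\<^esub> k \<in> generate G B))"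

definition second_betti :: "'a topology \<Rightarrow> nat \<Rightarrow> bool" where
  "second_betti X b \<longleftrightarrow> has_rank (homology_group 2 X) b"

definition minimal_surface :: "'a surface \<Rightarrow> bool" where
  "minimal_surface S \<longleftrightarrow> \<not> (\<exists>D. smooth_rational S D \<and> intersection_number S D D (-1))"

text \<open>A neighbourhood of the 3-sphere means a thin spherical shell. A neighbourhood containing the
  whole ball must not be allowed, since coordinate balls exist on every surface.\<close>

definition global_spherical_shell :: "'a surface \<Rightarrow> 'a set \<Rightarrow> bool" where
  "global_spherical_shell S V \<longleftrightarrow>
     (\<exists>\<zeta> \<epsilon>. 0 < \<epsilon> \<and> \<epsilon> < 1 \<and> holo_chart S (V, \<zeta>) \<and> \<zeta> ` V = {z. 1 - \<epsilon> < norm z \<and> norm z < 1 + \<epsilon>}) \<and>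
     connectedin (space_of S) (topspace (space_of S) - V)"

definition kato_surface :: "'a surface \<Rightarrow> bool" where
  "kato_surface S \<longleftrightarrow> compact_complex_surface S \<and> minimal_surface S \<and>
     (\<exists>b>0. second_betti (space_of S) b) \<and> (\<exists>V. global_spherical_shell S V)"

definition cycle_of_curves :: "'a surface \<Rightarrow> 'a set list \<Rightarrow> bool" where
  "cycle_of_curves S Z \<longleftrightarrow> Z \<noteq> [] \<and> distinct Z \<and> set Z \<subseteq> rational_curves S \<and>
     (if length Z = 1 then nodal_rational S (hd Z)
      else (\<forall>E \<in> set Z. smooth_rational S E) \<and>
        (\<forall>i j. i < j \<and> j < length Z \<longrightarrow> intersection_number S (Z ! i) (Z ! j)
           (if length Z = 2 then 2
            else if j = i + 1 \<or> i = 0 \<and> j = length Z - 1 then 1 else 0)))"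

definition intermediate_kato_surface :: "'a surface \<Rightarrow> bool" where
  "intermediate_kato_surface S \<longleftrightarrow> kato_surface S \<and>
     connectedin (space_of S) (\<Union>(rational_curves S)) \<and>
     (\<exists>Z. cycle_of_curves S Z \<and> set Z \<subset> rational_curves S \<and>
        (\<forall>Z'. cycle_of_curves S Z' \<longrightarrow> set Z' = set Z))"


section \<open>Dloussky sequences\<close>

text \<open>The target of the edge of the dual graph that issues from the \<open>i\<close>-th curve.\<close>

definition dl_next :: "nat list \<Rightarrow> nat \<Rightarrow> nat" where
  "dl_next e i = (i + (e ! i - 1)) mod length e"

text \<open>\<open>D 0, D 1, \<dots>\<close> lists the rational curves cyclically so that \<open>e\<close> is the sequence of entries: the
  entries prescribe the self-intersections and, through the dual graph, the other intersection
  numbers. A loop of the graph is a node.\<close>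

definition dloussky_sequence :: "'a surface \<Rightarrow> nat list \<Rightarrow> (nat \<Rightarrow> 'a set) \<Rightarrow> bool" where
  "dloussky_sequence S e D \<longleftrightarrow> (\<forall>x \<in> set e. x \<ge> 2) \<and>
     second_betti (space_of S) (length e) \<and>
     bij_betw D {..<length e} (rational_curves S) \<and>
     (\<forall>i < length e.
        if dl_next e i = i
        then nodal_rational S (D i) \<and> intersection_number S (D i) (D i) (- int (e ! i) + 2)
        else smooth_rational S (D i) \<and> intersection_number S (D i) (D i) (- int (e ! i))) \<and>
     (\<forall>i < length e. \<forall>j < length e. i \<noteq> j \<longrightarrow>
        intersection_number S (D i) (D j) (of_bool (dl_next e i = j) + of_bool (dl_next e j = i)))"

definition s_block :: "nat \<Rightarrow> nat list" where
  "s_block k = (k + 2) # replicate (k - 1) 2"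

definition simple_sequence :: "nat list \<Rightarrow> nat \<Rightarrow> nat list" where
  "simple_sequence ks m = concat (map s_block ks) @ replicate m 2"

text \<open>For a simple sequence the edges \<open>i \<mapsto> dl_next e i\<close> run along the branch from the tip, which is
  the curve at position 1, to the root, and then around the cycle, which contains the curve at
  position 0. This is the labelling \<open>A\<^sub>1, A\<^sub>2, \<dots>\<close> of the branch and \<open>C\<^sub>0, C\<^sub>1, \<dots>\<close> of the cycle.\<close>

definition branch_curve :: "nat list \<Rightarrow> (nat \<Rightarrow> 'a set) \<Rightarrow> nat \<Rightarrow> 'a set" where
  "branch_curve e D i = D ((dl_next e ^^ (i - 1)) 1)"

definition cycle_curve :: "nat list \<Rightarrow> (nat \<Rightarrow> 'a set) \<Rightarrow> nat \<Rightarrow> 'a set" where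
  "cycle_curve e D j = D ((dl_next e ^^ j) 0)"

definition beta :: "nat list \<Rightarrow> nat" where
  "beta ks = (\<Sum>i | i < length ks \<and> odd i. ks ! i)"


section \<open>The polynomials\<close>

text \<open>The recursions remove the last variable, hence the reversed lists.\<close>

fun f_rev :: "'r::comm_semiring_1 list \<Rightarrow> 'r" where
  "f_rev [] = 1"
| "f_rev [x] = x"
| "f_rev (x # y # xs) = x * f_rev (y # xs) + f_rev xs"

fun P_rev :: "'r::comm_semiring_1 list \<Rightarrow> 'r" where
  "P_rev [] = 0"
| "P_rev (x # xs) = x * f_rev xs + P_rev xs"

definition P_poly :: "'r::comm_semiring_1 list \<Rightarrow> 'r" where
  "P_poly xs = P_rev (rev xs)"

end

theory Submission
  imports Defs
begin

text \<open>
  The identity \<open>-K = \<Sum>E. d E * E\<close> is tested on every rational curve by comparing degrees of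
  line bundles pulled back to the projective line. A pulled back bundle has frames over the two
  closed discs that make up the line, and the degree is the winding number of the function that
  compares them (\<open>frame_degree\<close>). It is determined by the bundle (\<open>frame_degree_unique\<close>),
  invariant under isomorphism, multiplied by taking powers and additive in a divisor.

  The degree of \<open>-K\<close> on a curve \<open>D\<close> comes from the adjunction formula
  (\<open>adjunction_smooth\<close>, \<open>adjunction_nodal\<close>), proved as follows. Let \<open>u\<close> parametrize
  \<open>D\<close> and let \<open>f\<close> be a local equation of \<open>D\<close>. Since \<open>df\<close> vanishes on
  \<open>u'\<close>, it is \<open>\<lambda> det(u', _)\<close> for a function \<open>\<lambda>\<close> along the curve. Dividing by
  \<open>\<lambda>\<close> turns frames of the bundle of \<open>D\<close> into frames of the determinant of the tangent
  bundle. The transition to the coordinate at infinity multiplies \<open>u'\<close> by \<open>- z\<^sup>2\<close>, and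
  this has winding number \<open>2\<close>. At smooth points of the curve \<open>\<lambda>\<close> is nonzero, because there
  the curve is the graph of a holomorphic function. At the two preimages of a node \<open>\<lambda>\<close> has
  simple zeros, which compensate the \<open>2\<close>. In either case \<open>-K\<close> has degree \<open>2 - e\<close> on a
  curve with entry \<open>e\<close>, and \<open>dloussky_equation\<close> is the resulting linear equation
  for the multiplicities.

  For a simple sequence let \<open>x\<^sub>l\<close> be the multiplicity of the curve with entry
  \<open>k\<^sub>l + 2\<close>, and let \<open>x\<^sub>l\<close> for \<open>l = p\<close> be that of the first curve of
  \<open>r\<^sub>m\<close>. The equations at the entries \<open>2\<close> of a block say that the multiplicities run in
  an arithmetic progression from the beginning of the preceding block to the beginning of the
  following one. The equations at the remaining entries are a recursion for
  the increments. It implies that the increment in the block \<open>l\<close> is \<open>x\<^sub>l - 1\<close>: the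
  differences between the two (\<open>defect\<close>) satisfy a homogeneous recursion whose solution is
  multiplied by a factor at least \<open>2\<close> around the cycle, hence vanishes (\<open>defect_zero\<close>).
  Now \<open>y\<^sub>l = x\<^sub>l - 1\<close> obeys the recursion of continuants and starts from \<open>-1\<close>
  (before the first block) and \<open>t\<close>. This expresses the multiplicity \<open>r\<close> of the root through
  \<open>t\<close> (\<open>root_multiplicity\<close>), and in \<open>r\<^sub>m\<close> the multiplicities decrease by \<open>1\<close> at each step
  from \<open>r\<close> to that of the first curve, \<open>t + 1\<close>, so that \<open>t + m = r\<close>.

  All multiplicities are positive because the \<open>y\<^sub>l\<close> stay above \<open>-1\<close>
  (\<open>alternating_sequence_bound\<close>). They are integral affine functions of \<open>t\<close>, and \<open>t\<close>
  is one of them; so the index is the denominator of \<open>t\<close>.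
\<close>

no_notation fps_nth (infixl "$" 75)

section \<open>Winding numbers and degrees of line bundles on the projective line\<close>

text \<open>A continuous logarithm of a closed path records the winding number about \<open>0\<close> as its increment.
  Products of paths become sums of logarithms, so the rules for products and powers are immediate.\<close>

definition log_increment :: "(real \<Rightarrow> complex) \<Rightarrow> int \<Rightarrow> bool" where
  "log_increment \<gamma> n \<longleftrightarrow> (\<exists>L. path L \<and> (\<forall>t\<in>{0..1}. \<gamma> t = exp (L t)) \<and>
     pathfinish L - pathstart L = 2 * of_real pi * \<i> * of_int n)"

text \<open>Two logarithms differ by a continuous function with values in the discrete set
  \<open>2\<pi>\<i>\<int>\<close>, hence by a constant.\<close>

lemma log_increment_unique:
  assumes "log_increment \<gamma> m" "log_increment \<gamma> n"
  shows "m = n"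
proof -
  obtain L where L: "path L" "\<And>t. t \<in> {0..1} \<Longrightarrow> \<gamma> t = exp (L t)"
    "pathfinish L - pathstart L = 2 * of_real pi * \<i> * of_int m"
    using assms(1) unfolding log_increment_def by blast
  obtain M where M: "path M" "\<And>t. t \<in> {0..1} \<Longrightarrow> \<gamma> t = exp (M t)"
    "pathfinish M - pathstart M = 2 * of_real pi * \<i> * of_int n"
    using assms(2) unfolding log_increment_def by blast
  have int: "\<exists>k::int. L t - M t = of_int (2 * k) * pi * \<i>" if "t \<in> {0..1}" for t
    using L(2)[OF that] M(2)[OF that] exp_eq[of "L t" "M t"] by auto
  have "(\<lambda>t. L t - M t) constant_on {0..1}"
  proof (rule continuous_discrete_range_constant)
    show "continuous_on {0..1} (\<lambda>t. L t - M t)"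
      using L(1) M(1) unfolding path_def by (intro continuous_intros)
    fix x :: real assume x: "x \<in> {0..1}"
    show "\<exists>e>0. \<forall>y. y \<in> {0..1} \<and> L y - M y \<noteq> L x - M x \<longrightarrow> e \<le> norm (L y - M y - (L x - M x))"
    proof (intro exI[of _ "2 * pi"] conjI allI impI)
      fix y :: real assume y: "y \<in> {0..1} \<and> L y - M y \<noteq> L x - M x"
      obtain k where k: "L x - M x = of_int (2 * k) * pi * \<i>" using int[OF x] by blast
      obtain l where l: "L y - M y = of_int (2 * l) * pi * \<i>" using int y by blast
      have "k \<noteq> l" using y k l by auto
      define d where "d = l - k"
      have "1 \<le> \<bar>real_of_int d\<bar>" using \<open>k \<noteq> l\<close> unfolding d_def by linarith
      have "L y - M y - (L x - M x) = of_real (2 * pi * real_of_int d) * \<i>"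
        by (simp add: k l d_def algebra_simps)
      also have "norm \<dots> = \<bar>2 * pi * real_of_int d\<bar>"
        by (simp only: norm_mult norm_ii norm_of_real mult_1_right)
      also have "\<dots> = 2 * pi * \<bar>real_of_int d\<bar>" by (simp add: abs_mult)
      finally show "2 * pi \<le> norm (L y - M y - (L x - M x))"
        using \<open>1 \<le> \<bar>real_of_int d\<bar>\<close> by simp
    qed simp
  qed simp
  then have "L 1 - M 1 = L 0 - M 0"
    unfolding constant_on_def by (metis atLeastAtMost_iff le_numeral_extra(3,4) zero_le_one)
  then have "pathfinish L - pathstart L = pathfinish M - pathstart M"
    unfolding pathfinish_def pathstart_def by (simp add: algebra_simps)
  then show ?thesis using L(3) M(3) by simp
qed

lemma log_increment_mult:
  assumes "log_increment \<gamma> m" "log_increment \<delta> n"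
  shows "log_increment (\<lambda>t. \<gamma> t * \<delta> t) (m + n)"
proof -
  obtain L where L: "path L" "\<forall>t\<in>{0..1}. \<gamma> t = exp (L t)"
    "pathfinish L - pathstart L = 2 * of_real pi * \<i> * of_int m"
    using assms(1) unfolding log_increment_def by blast
  obtain M where M: "path M" "\<forall>t\<in>{0..1}. \<delta> t = exp (M t)"
    "pathfinish M - pathstart M = 2 * of_real pi * \<i> * of_int n"
    using assms(2) unfolding log_increment_def by blast
  show ?thesis unfolding log_increment_def
  proof (intro exI[of _ "\<lambda>t. L t + M t"] conjI)
    show "path (\<lambda>t. L t + M t)"
      using L(1) M(1) unfolding path_def by (intro continuous_intros)
    show "pathfinish (\<lambda>t. L t + M t) - pathstart (\<lambda>t. L t + M t) = 2 * of_real pi * \<i> * of_int (m + n)"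
      using L(3) M(3) unfolding pathfinish_def pathstart_def by (simp add: algebra_simps)
  qed (use L M in \<open>auto simp: exp_add\<close>)
qed

lemma log_increment_powi:
  assumes "log_increment \<gamma> m"
  shows "log_increment (\<lambda>t. \<gamma> t powi n) (n * m)"
proof -
  obtain L where L: "path L" "\<forall>t\<in>{0..1}. \<gamma> t = exp (L t)"
    "pathfinish L - pathstart L = 2 * of_real pi * \<i> * of_int m"
    using assms(1) unfolding log_increment_def by blast
  show ?thesis unfolding log_increment_def
  proof (intro exI[of _ "\<lambda>t. of_int n * L t"] conjI)
    show "path (\<lambda>t. of_int n * L t)"
      using L(1) unfolding path_def by (intro continuous_intros)
    show "pathfinish (\<lambda>t. of_int n * L t) - pathstart (\<lambda>t. of_int n * L t) = 2 * of_real pi * \<i> * of_int (n * m)"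
      using L(3) unfolding pathfinish_def pathstart_def by (simp add: algebra_simps flip: right_diff_distrib)
  qed (use L in \<open>auto simp: exp_power_int\<close>)
qed

lemma log_increment_one: "log_increment (\<lambda>t. 1) 0"
  unfolding log_increment_def
  by (rule exI[of _ "\<lambda>t. 0"]) (auto simp: path_def pathfinish_def pathstart_def)

lemma log_increment_prod:
  assumes "finite A" "\<And>a. a \<in> A \<Longrightarrow> log_increment (\<gamma> a) (m a)"
  shows "log_increment (\<lambda>t. \<Prod>a\<in>A. \<gamma> a t) (\<Sum>a\<in>A. m a)"
  using assms by (induction A rule: finite_induct) (auto intro: log_increment_one log_increment_mult)

lemma log_increment_cong:
  assumes "log_increment \<gamma> n" "\<And>t. t \<in> {0..1} \<Longrightarrow> \<delta> t = \<gamma> t"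
  shows "log_increment \<delta> n"
  using assms unfolding log_increment_def by metis

lemma log_increment_winding_number:
  assumes "path \<gamma>" "0 \<notin> path_image \<gamma>" "winding_number \<gamma> 0 = of_int n"
  shows "log_increment \<gamma> n"
proof -
  obtain q where "path q" "pathfinish q - pathstart q = 2 * of_real pi * \<i> * winding_number \<gamma> 0"
    "\<And>t. t \<in> {0..1} \<Longrightarrow> \<gamma> t = 0 + exp (q t)"
    using winding_number_as_continuous_log[OF assms(1,2)] by blast
  then show ?thesis using assms(3) unfolding log_increment_def by auto
qed

text \<open>A function without zeros on the closed disc has a logarithm on the whole disc, and the
  logarithm returns to its initial value along a closed path.\<close>

lemma log_increment_extends:
  assumes "continuous_on (cball 0 1) g" "\<And>z. z \<in> cball 0 1 \<Longrightarrow> g z \<noteq> 0"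
    "path p" "path_image p \<subseteq> cball (0::complex) 1" "pathfinish p = pathstart p"
  shows "log_increment (g \<circ> p) 0"
proof -
  obtain l where l: "continuous_on (cball 0 1) l" "\<And>z. z \<in> cball 0 1 \<Longrightarrow> g z = exp (l z)"
    using continuous_logarithm_on_cball[OF assms(1,2)] by blast
  show ?thesis unfolding log_increment_def
  proof (intro exI[of _ "l \<circ> p"] conjI)
    show "path (l \<circ> p)"
      using assms(3,4) l(1) by (metis continuous_on_subset path_continuous_image)
    show "\<forall>t\<in>{0..1}. (g \<circ> p) t = exp ((l \<circ> p) t)"
      using assms(4) l(2) unfolding path_image_def by auto
    show "pathfinish (l \<circ> p) - pathstart (l \<circ> p) = 2 * of_real pi * \<i> * of_int 0"
      using assms(5) by (simp add: pathfinish_def pathstart_def)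
  qed
qed

text \<open>The two affine charts of the projective line, indexed by a truth value so that constructions over
  both discs can be carried out once.\<close>

definition P1_chart :: "bool \<Rightarrow> complex \<Rightarrow> complex option" where
  "P1_chart b = (if b then aff_inf else Some)"

lemma P1_chart_simps [simp]: "P1_chart False = Some" "P1_chart True = aff_inf"
  by (simp_all add: P1_chart_def)

text \<open>The relation between frames over the two discs that defines the degree, with the winding number
  expressed by a logarithm. It refers to the cocycle only through frames; for the determinant of the
  tangent bundle it is established by exhibiting frames.\<close>

definition frame_degree :: "('i, 'a) cocycle \<Rightarrow> (complex option \<Rightarrow> 'a) \<Rightarrow> int \<Rightarrow> bool" where
  "frame_degree L F n \<longleftrightarrow> (\<exists>s q. (\<forall>b. frame L (F \<circ> P1_chart b) (cball 0 1) (s b)) \<and>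
     (\<forall>z \<in> sphere 0 1. \<forall>i\<in>idx L. F (Some z) \<in> dom L i \<longrightarrow> s True i (inverse z) = q z * s False i z) \<and>
     log_increment (q \<circ> circlepath 0 1) n)"

lemma frame_degreeI:
  assumes "\<And>b. frame L (F \<circ> P1_chart b) (cball 0 1) (s b)"
    "\<And>z i. z \<in> sphere 0 1 \<Longrightarrow> i \<in> idx L \<Longrightarrow> F (Some z) \<in> dom L i \<Longrightarrow>
       s True i (inverse z) = q z * s False i z"
    "log_increment (q \<circ> circlepath 0 1) n"
  shows "frame_degree L F n"
  unfolding frame_degree_def by (intro exI[of _ s] exI[of _ q] conjI allI ballI impI assms)

lemma frame_degreeE:
  assumes "frame_degree L F n"
  obtains s q where "\<And>b. frame L (F \<circ> P1_chart b) (cball 0 1) (s b)"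
    "\<And>z i. z \<in> sphere 0 1 \<Longrightarrow> i \<in> idx L \<Longrightarrow> F (Some z) \<in> dom L i \<Longrightarrow>
       s True i (inverse z) = q z * s False i z"
    "log_increment (q \<circ> circlepath 0 1) n"
  using assms unfolding frame_degree_def by blast

lemma frame_zero: "frame L u T s \<Longrightarrow> i \<in> idx L \<Longrightarrow> z \<in> T \<Longrightarrow> u z \<in> dom L i \<Longrightarrow> s i z \<noteq> 0"
  unfolding frame_def by blast

lemma frame_continuous: "frame L u T s \<Longrightarrow> i \<in> idx L \<Longrightarrow> continuous_on {z \<in> T. u z \<in> dom L i} (s i)"
  unfolding frame_def by blast

lemma frame_trans:
  "frame L u T s \<Longrightarrow> i \<in> idx L \<Longrightarrow> j \<in> idx L \<Longrightarrow> z \<in> T \<Longrightarrow> u z \<in> dom L i \<inter> dom L j \<Longrightarrow>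
    s i z = trans L i j (u z) * s j z"
  unfolding frame_def by blast

lemma aff_inf_inverse: "z \<noteq> 0 \<Longrightarrow> aff_inf (inverse z) = Some z"
  by (simp add: aff_inf_def)

lemma has_degree_frame_degree:
  assumes "has_degree X L F n" "\<And>z. F (Some z) \<in> topspace X"
  shows "frame_degree L F n"
proof -
  obtain s0 s1 q where s: "frame L (F \<circ> Some) (cball 0 1) s0" "frame L (F \<circ> aff_inf) (cball 0 1) s1"
    "continuous_on (sphere 0 1) q"
    "\<And>z i. z \<in> sphere 0 1 \<Longrightarrow> i\<in>idx L \<Longrightarrow> F (Some z) \<in> dom L i \<Longrightarrow> s1 i (inverse z) = q z * s0 i z"
    "winding_number (q \<circ> circlepath 0 1) 0 = of_int n" and L: "line_bundle X L"
    using assms(1) unfolding has_degree_def by blast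
  have nz: "q z \<noteq> 0" if z: "z \<in> sphere 0 1" for z
  proof -
    obtain i where i: "i \<in> idx L" "F (Some z) \<in> dom L i"
      using L assms(2) unfolding line_bundle_def by blast
    have z0: "z \<noteq> 0" "norm (inverse z) = 1" using z by (auto simp: norm_inverse)
    have "s1 i (inverse z) \<noteq> 0"
      by (rule frame_zero[OF s(2) i(1)]) (use i z0 in \<open>auto simp: aff_inf_inverse\<close>)
    then show ?thesis using s(4)[OF z i] by auto
  qed
  have "log_increment (q \<circ> circlepath 0 1) n"
  proof (rule log_increment_winding_number)
    show "path (q \<circ> circlepath 0 1)"
      by (rule path_continuous_image) (use s(3) in \<open>auto simp: path_image_circlepath\<close>)
    show "0 \<notin> path_image (q \<circ> circlepath 0 1)"
      using nz by (auto simp: path_image_compose path_image_circlepath)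
  qed (fact s(5))
  moreover have "frame L (F \<circ> P1_chart b) (cball 0 1) (if b then s1 else s0)" for b
    using s(1,2) by simp
  ultimately show ?thesis
    using frame_degreeI[of L F "\<lambda>b. if b then s1 else s0" q n] s(4) by simp
qed

text \<open>The quotient of two frames is the same in all trivializations, because the transition functions
  cancel.\<close>

lemma frame_quotient:
  fixes u :: "complex \<Rightarrow> 'a"
  assumes "frame L u T s" "frame L u T s'"
    and op: "\<And>i. i \<in> idx L \<Longrightarrow> open {z. u z \<in> dom L i}"
    and cov: "\<And>z. z \<in> T \<Longrightarrow> \<exists>i\<in>idx L. u z \<in> dom L i"
  shows "\<exists>g. continuous_on T g \<and> (\<forall>z\<in>T. g z \<noteq> 0) \<and>
    (\<forall>i\<in>idx L. \<forall>z\<in>T. u z \<in> dom L i \<longrightarrow> s' i z = g z * s i z)"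
proof -
  define A where "A = (\<lambda>i. {z\<in>T. u z \<in> dom L i})"
  obtain g where g: "continuous_map (top_of_set T) euclidean g"
    "\<And>z i. i \<in> idx L \<Longrightarrow> z \<in> topspace (top_of_set T) \<inter> A i \<Longrightarrow> g z = s' i z / s i z"
  proof (rule pasting_lemma_exists[of "top_of_set T" A "idx L" euclidean "\<lambda>i z. s' i z / s i z"])
    show "topspace (top_of_set T) \<subseteq> \<Union> (A ` idx L)" using cov unfolding A_def by auto
    show "openin (top_of_set T) (A i)" if "i \<in> idx L" for i
    proof -
      have "A i = T \<inter> {z. u z \<in> dom L i}" unfolding A_def by auto
      then show ?thesis using op[OF that] by (simp add: openin_open_Int)
    qed
    show "continuous_map (subtopology (top_of_set T) (A i)) euclidean (\<lambda>z. s' i z / s i z)" if "i \<in> idx L" for i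
    proof -
      have "continuous_on (A i) (\<lambda>z. s' i z / s i z)"
        unfolding A_def using frame_continuous[OF assms(1) that] frame_continuous[OF assms(2) that]
          frame_zero[OF assms(1) that] by (intro continuous_on_divide) simp_all
      moreover have "T \<inter> A i = A i" unfolding A_def by auto
      ultimately show ?thesis by (simp add: subtopology_subtopology continuous_map_iff_continuous)
    qed
    show "s' i z / s i z = s' j z / s j z"
      if "i \<in> idx L" "j \<in> idx L" "z \<in> topspace (top_of_set T) \<inter> A i \<inter> A j" for i j z
    proof -
      have z: "z \<in> T" "u z \<in> dom L i \<inter> dom L j" using that unfolding A_def by auto
      have 1: "s i z = trans L i j (u z) * s j z" "s' i z = trans L i j (u z) * s' j z"
        by (rule frame_trans[OF assms(1) that(1,2) z] frame_trans[OF assms(2) that(1,2) z])+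
      have "s i z \<noteq> 0" "s j z \<noteq> 0" using frame_zero[OF assms(1)] that z by auto
      then show ?thesis using 1 by (auto simp: field_simps)
    qed
  qed auto
  have key: "s' i z = g z * s i z" if "i \<in> idx L" "z \<in> T" "u z \<in> dom L i" for i z
    using g(2)[of i z] that frame_zero[OF assms(1)] unfolding A_def by auto
  show ?thesis
  proof (intro exI[of _ g] conjI ballI impI)
    show "continuous_on T g" using g(1) by (simp add: continuous_map_iff_continuous)
    show "g z \<noteq> 0" if z: "z \<in> T" for z
    proof -
      obtain i where i: "i \<in> idx L" "u z \<in> dom L i" using cov[OF z] by blast
      show ?thesis using key[OF i(1) z i(2)] frame_zero[OF assms(2) i(1) z i(2)] by auto
    qed
    show "s' i z = g z * s i z" if "i \<in> idx L" "z \<in> T" "u z \<in> dom L i" for i z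
      by (rule key[OF that])
  qed
qed

lemma open_preimage_path:
  assumes "continuous_map euclidean X u" "openin X W"
  shows "open {z. u z \<in> W}"
  using openin_continuous_map_preimage[OF assms] by simp

lemma cover_path:
  assumes "continuous_map euclidean X v" "(\<Union>i\<in>I. A i) = topspace X"
  shows "\<exists>i\<in>I. v z \<in> A i"
proof -
  have "v z \<in> topspace X" using assms(1) by (auto simp: continuous_map_def Pi_iff)
  then show ?thesis using assms(2) by blast
qed

text \<open>Another choice of frames multiplies the clutching function by boundary values of functions
  without zeros on a disc, and these have winding number \<open>0\<close>.\<close>

lemma frame_degree_unique:
  assumes "frame_degree L F m" "frame_degree L F n"
    and u: "\<And>b. continuous_map euclidean X (F \<circ> P1_chart b)"
    and op: "\<And>i. i \<in> idx L \<Longrightarrow> openin X (dom L i)" and cov: "(\<Union>i\<in>idx L. dom L i) = topspace X"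
  shows "m = n"
proof -
  obtain s q where s: "\<And>b. frame L (F \<circ> P1_chart b) (cball 0 1) (s b)"
    "\<And>z i. z \<in> sphere 0 1 \<Longrightarrow> i\<in>idx L \<Longrightarrow> F (Some z) \<in> dom L i \<Longrightarrow> s True i (inverse z) = q z * s False i z"
    "log_increment (q \<circ> circlepath 0 1) m"
    using frame_degreeE[OF assms(1)] by blast
  obtain s' q' where s': "\<And>b. frame L (F \<circ> P1_chart b) (cball 0 1) (s' b)"
    "\<And>z i. z \<in> sphere 0 1 \<Longrightarrow> i\<in>idx L \<Longrightarrow> F (Some z) \<in> dom L i \<Longrightarrow> s' True i (inverse z) = q' z * s' False i z"
    "log_increment (q' \<circ> circlepath 0 1) n"
    using frame_degreeE[OF assms(2)] by blast
  have "\<forall>b. \<exists>g. continuous_on (cball 0 1) g \<and> (\<forall>z\<in>cball 0 1. g z \<noteq> 0) \<and>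
    (\<forall>i\<in>idx L. \<forall>z\<in>cball 0 1. (F \<circ> P1_chart b) z \<in> dom L i \<longrightarrow> s' b i z = g z * s b i z)"
    by (intro allI frame_quotient[OF s(1) s'(1)] open_preimage_path[OF u op] cover_path[OF u cov])
  from choice[OF this] obtain g where g: "\<And>b. continuous_on (cball 0 1) (g b)"
    "\<And>b z. z \<in> cball 0 1 \<Longrightarrow> g b z \<noteq> 0"
    "\<And>b i z. i \<in> idx L \<Longrightarrow> z \<in> cball 0 1 \<Longrightarrow> (F \<circ> P1_chart b) z \<in> dom L i \<Longrightarrow> s' b i z = g b z * s b i z"
    by blast
  have rel: "q' z * g False z = g True (inverse z) * q z" if z: "z \<in> sphere 0 1" for z
  proof -
    obtain i where i: "i \<in> idx L" "F (Some z) \<in> dom L i" using cover_path[OF u cov, of False z] by auto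
    have z0: "z \<noteq> 0" "norm (inverse z) = 1" using z by (auto simp: norm_inverse)
    have "s' True i (inverse z) = g True (inverse z) * s True i (inverse z)"
      by (rule g(3)) (use i z0 in \<open>auto simp: aff_inf_inverse\<close>)
    moreover have "s' False i z = g False z * s False i z" by (rule g(3)) (use i z in auto)
    moreover have "s False i z \<noteq> 0" by (rule frame_zero[OF s(1)]) (use i z in auto)
    ultimately show ?thesis using s(2)[OF z i] s'(2)[OF z i] by auto
  qed
  define p where "p = circlepath (0::complex) 1"
  have p: "path p" "path_image p = sphere 0 1" "pathfinish p = pathstart p"
    unfolding p_def by (auto simp: path_image_circlepath)
  have ps: "p t \<in> sphere 0 1" if "t \<in> {0..1}" for t
    using p(2) that unfolding path_image_def by auto
  have l0: "log_increment (g False \<circ> p) 0"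
    by (rule log_increment_extends) (use g p in auto)
  have l1: "log_increment (g True \<circ> (inverse \<circ> p)) 0"
  proof (rule log_increment_extends)
    show "path (inverse \<circ> p)"
      by (rule path_continuous_image) (use p in \<open>auto intro!: continuous_intros\<close>)
    show "path_image (inverse \<circ> p) \<subseteq> cball 0 1"
      using p(2) by (auto simp: path_image_compose norm_inverse)
    show "pathfinish (inverse \<circ> p) = pathstart (inverse \<circ> p)"
      using p(3) by (simp add: pathfinish_def pathstart_def)
  qed (use g in auto)
  have "log_increment (\<lambda>t. (q' \<circ> p) t * (g False \<circ> p) t) (n + 0)"
    by (rule log_increment_mult[OF s'(3)[folded p_def] l0])
  moreover have "log_increment (\<lambda>t. (q' \<circ> p) t * (g False \<circ> p) t) (0 + m)"
    by (rule log_increment_cong[OF log_increment_mult[OF l1 s(3)[folded p_def]]])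
       (use rel ps in fastforce)
  ultimately have "n + 0 = 0 + m" by (rule log_increment_unique)
  then show ?thesis by simp
qed

text \<open>\<open>H j i\<close> is an isomorphism from the pullback of \<open>L\<close> to the pullback of \<open>M\<close>,
  written in the trivializations \<open>i\<close> and \<open>j\<close>; the last two hypotheses are the
  compatibility with the transition functions of \<open>L\<close> and of \<open>M\<close>.\<close>

lemma frame_transport:
  fixes u :: "complex \<Rightarrow> 'a"
  assumes s: "frame L u T s"
    and op: "\<And>i. i \<in> idx L \<Longrightarrow> open {z. u z \<in> dom L i}"
    and cov: "\<And>z. z \<in> T \<Longrightarrow> \<exists>i\<in>idx L. u z \<in> dom L i"
    and H: "\<And>j i. j \<in> idx M \<Longrightarrow> i \<in> idx L \<Longrightarrow> continuous_on {z\<in>T. u z \<in> dom M j \<inter> dom L i} (H j i)"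
      "\<And>j i z. j \<in> idx M \<Longrightarrow> i \<in> idx L \<Longrightarrow> z \<in> T \<Longrightarrow> u z \<in> dom M j \<inter> dom L i \<Longrightarrow> H j i z \<noteq> 0"
    and HL: "\<And>j i i' z. j \<in> idx M \<Longrightarrow> i \<in> idx L \<Longrightarrow> i' \<in> idx L \<Longrightarrow> z \<in> T \<Longrightarrow>
       u z \<in> dom M j \<inter> dom L i \<inter> dom L i' \<Longrightarrow> H j i z * trans L i i' (u z) = H j i' z"
    and HM: "\<And>j j' i z. j \<in> idx M \<Longrightarrow> j' \<in> idx M \<Longrightarrow> i \<in> idx L \<Longrightarrow> z \<in> T \<Longrightarrow>
       u z \<in> dom M j \<inter> dom M j' \<inter> dom L i \<Longrightarrow> H j i z = trans M j j' (u z) * H j' i z"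
  shows "\<exists>\<sigma>. frame M u T \<sigma> \<and> (\<forall>i\<in>idx L. \<forall>j\<in>idx M. \<forall>z\<in>T. u z \<in> dom L i \<inter> dom M j \<longrightarrow>
    \<sigma> j z = H j i z * s i z)"
proof -
  (* the section is defined through an arbitrary trivialization over each point *)
  define \<iota> where "\<iota> z = (SOME i. i \<in> idx L \<and> u z \<in> dom L i)" for z
  have \<iota>: "\<iota> z \<in> idx L" "u z \<in> dom L (\<iota> z)" if "z \<in> T" for z
    using cov[OF that] someI_ex[of "\<lambda>i. i \<in> idx L \<and> u z \<in> dom L i"] unfolding \<iota>_def by auto
  define \<sigma> where "\<sigma> j z = H j (\<iota> z) z * s (\<iota> z) z" for j z
  have \<sigma>: "\<sigma> j z = H j i z * s i z"
    if "i \<in> idx L" "j \<in> idx M" "z \<in> T" "u z \<in> dom L i \<inter> dom M j" for i j z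
  proof -
    note \<iota>z = \<iota>[OF that(3)]
    have "s i z = trans L i (\<iota> z) (u z) * s (\<iota> z) z"
      by (rule frame_trans[OF s that(1) \<iota>z(1) that(3)]) (use that \<iota>z in auto)
    moreover have "H j i z * trans L i (\<iota> z) (u z) = H j (\<iota> z) z"
      by (rule HL) (use that \<iota>z in auto)
    ultimately show ?thesis unfolding \<sigma>_def by (metis mult.assoc)
  qed
  have "frame M u T \<sigma>"
    unfolding frame_def
  proof (intro conjI ballI impI)
    fix j assume j: "j \<in> idx M"
    show "continuous_on {z\<in>T. u z \<in> dom M j} (\<sigma> j)"
    proof -
      let ?B = "{z\<in>T. u z \<in> dom M j}"
      define A where "A = (\<lambda>i. {z\<in>?B. u z \<in> dom L i})"
      have "continuous_map (top_of_set ?B) euclidean (\<sigma> j)"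
      proof (rule pasting_lemma[of "idx L" "top_of_set ?B" A euclidean "\<lambda>i z. H j i z * s i z"])
        fix i assume i: "i \<in> idx L"
        have "A i = ?B \<inter> {z. u z \<in> dom L i}" unfolding A_def by auto
        then show "openin (top_of_set ?B) (A i)" using op[OF i] by (simp add: openin_open_Int)
        have "continuous_on (A i) (H j i)" 
          by (rule continuous_on_subset[OF H(1)[OF j i]]) (auto simp: A_def)
        moreover have "continuous_on (A i) (s i)"
          by (rule continuous_on_subset[OF frame_continuous[OF s i]]) (auto simp: A_def)
        ultimately have "continuous_on (A i) (\<lambda>z. H j i z * s i z)" by (intro continuous_intros)
        moreover have "?B \<inter> A i = A i" unfolding A_def by auto
        ultimately show "continuous_map (subtopology (top_of_set ?B) (A i)) euclidean (\<lambda>z. H j i z * s i z)"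
          by (simp add: subtopology_subtopology continuous_map_iff_continuous)
      next
        fix i i' z assume "i \<in> idx L" "i' \<in> idx L" "z \<in> topspace (top_of_set ?B) \<inter> A i \<inter> A i'"
        then have "\<sigma> j z = H j i z * s i z" "\<sigma> j z = H j i' z * s i' z"
          using j by (auto intro!: \<sigma> simp: A_def)
        then show "H j i z * s i z = H j i' z * s i' z" by simp
      next
        fix z assume "z \<in> topspace (top_of_set ?B)"
        then show "\<exists>i. i \<in> idx L \<and> z \<in> A i \<and> \<sigma> j z = H j i z * s i z"
          using \<iota>[of z] by (intro exI[of _ "\<iota> z"]) (auto simp: A_def \<sigma>_def)
      qed
      then show ?thesis by (simp add: continuous_map_iff_continuous)
    qed
    show "\<sigma> j z \<noteq> 0" if "z \<in> T" "u z \<in> dom M j" for z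
      unfolding \<sigma>_def using \<iota>[OF that(1)] H(2)[OF j] frame_zero[OF s] that by auto
    show "\<sigma> j z = trans M j j' (u z) * \<sigma> j' z"
      if "j' \<in> idx M" "z \<in> T" "u z \<in> dom M j \<inter> dom M j'" for j' z
      unfolding \<sigma>_def using \<iota>[OF that(2)] HM[of j j' "\<iota> z" z] j that by auto
  qed
  then show ?thesis using \<sigma> by blast
qed

text \<open>Isomorphisms over the two charts need not match over the unit circle. Their discrepancy
  \<open>\<theta>\<close> multiplies the clutching function and thus shifts the degree by its winding number.
  An isomorphism of bundles is the case \<open>\<theta> = 1\<close>; the adjunction formula arises from
  \<open>\<theta> z = - z\<^sup>2\<close>.\<close>

lemma frame_degree_transport:
  fixes F :: "complex option \<Rightarrow> 'a"
  assumes deg: "frame_degree L F n"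
    and u: "\<And>b. continuous_map euclidean X (F \<circ> P1_chart b)"
    and op: "\<And>i. i \<in> idx L \<Longrightarrow> openin X (dom L i)" and cov: "(\<Union>i\<in>idx L. dom L i) = topspace X"
    and H: "\<And>b j i. j \<in> idx M \<Longrightarrow> i \<in> idx L \<Longrightarrow>
        continuous_on {z. F (P1_chart b z) \<in> dom M j \<inter> dom L i} (H b j i)"
      "\<And>b j i z. j \<in> idx M \<Longrightarrow> i \<in> idx L \<Longrightarrow> F (P1_chart b z) \<in> dom M j \<inter> dom L i \<Longrightarrow> H b j i z \<noteq> 0"
    and HL: "\<And>b j i i' z. j \<in> idx M \<Longrightarrow> i \<in> idx L \<Longrightarrow> i' \<in> idx L \<Longrightarrow>
       F (P1_chart b z) \<in> dom M j \<inter> dom L i \<inter> dom L i' \<Longrightarrow>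
       H b j i z * trans L i i' (F (P1_chart b z)) = H b j i' z"
    and HM: "\<And>b j j' i z. j \<in> idx M \<Longrightarrow> j' \<in> idx M \<Longrightarrow> i \<in> idx L \<Longrightarrow>
       F (P1_chart b z) \<in> dom M j \<inter> dom M j' \<inter> dom L i \<Longrightarrow>
       H b j i z = trans M j j' (F (P1_chart b z)) * H b j' i z"
    and \<theta>: "\<And>j i z. j \<in> idx M \<Longrightarrow> i \<in> idx L \<Longrightarrow> z \<in> sphere 0 1 \<Longrightarrow> F (Some z) \<in> dom M j \<inter> dom L i \<Longrightarrow>
       H True j i (inverse z) = \<theta> z * H False j i z"
      "log_increment (\<theta> \<circ> circlepath 0 1) k"
  shows "frame_degree M F (k + n)"
proof -
  obtain s q where s: "\<And>b. frame L (F \<circ> P1_chart b) (cball 0 1) (s b)"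
    "\<And>z i. z \<in> sphere 0 1 \<Longrightarrow> i\<in>idx L \<Longrightarrow> F (Some z) \<in> dom L i \<Longrightarrow> s True i (inverse z) = q z * s False i z"
    "log_increment (q \<circ> circlepath 0 1) n"
    using frame_degreeE[OF deg] by blast
  have "\<exists>\<sigma>. frame M (F \<circ> P1_chart b) (cball 0 1) \<sigma> \<and> (\<forall>i\<in>idx L. \<forall>j\<in>idx M. \<forall>z\<in>cball 0 1.
     (F \<circ> P1_chart b) z \<in> dom L i \<inter> dom M j \<longrightarrow> \<sigma> j z = H b j i z * s b i z)" for b
  proof (rule frame_transport[OF s(1), where M = M and H = "H b"])
    show "continuous_on {z \<in> cball 0 1. (F \<circ> P1_chart b) z \<in> dom M j \<inter> dom L i} (H b j i)"
      if "j \<in> idx M" "i \<in> idx L" for i j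
      by (rule continuous_on_subset[OF H(1)[OF that, of b]]) auto
    show "open {z. (F \<circ> P1_chart b) z \<in> dom L i}" if "i \<in> idx L" for i
      by (rule open_preimage_path[OF u op[OF that]])
    show "\<exists>i\<in>idx L. (F \<circ> P1_chart b) z \<in> dom L i" for z by (rule cover_path[OF u cov])
    show "H b j i z \<noteq> 0" if "j \<in> idx M" "i \<in> idx L" "(F \<circ> P1_chart b) z \<in> dom M j \<inter> dom L i" for j i z
      using H(2)[of j i b z] that by simp
    show "H b j i z * trans L i i' ((F \<circ> P1_chart b) z) = H b j i' z"
      if "j \<in> idx M" "i \<in> idx L" "i' \<in> idx L" "(F \<circ> P1_chart b) z \<in> dom M j \<inter> dom L i \<inter> dom L i'" for j i i' z
      using HL[of j i i' b z] that by simp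
    show "H b j i z = trans M j j' ((F \<circ> P1_chart b) z) * H b j' i z"
      if "j \<in> idx M" "j' \<in> idx M" "i \<in> idx L" "(F \<circ> P1_chart b) z \<in> dom M j \<inter> dom M j' \<inter> dom L i" for j j' i z
      using HM[of j j' i b z] that by simp
  qed
  then have "\<forall>b. \<exists>\<sigma>. frame M (F \<circ> P1_chart b) (cball 0 1) \<sigma> \<and> (\<forall>i\<in>idx L. \<forall>j\<in>idx M. \<forall>z\<in>cball 0 1.
     (F \<circ> P1_chart b) z \<in> dom L i \<inter> dom M j \<longrightarrow> \<sigma> j z = H b j i z * s b i z)" ..
  from choice[OF this] obtain \<sigma> where \<sigma>: "\<And>b. frame M (F \<circ> P1_chart b) (cball 0 1) (\<sigma> b)"
    "\<And>b i j z. i \<in> idx L \<Longrightarrow> j \<in> idx M \<Longrightarrow> z \<in> cball 0 1 \<Longrightarrow> (F \<circ> P1_chart b) z \<in> dom L i \<inter> dom M j \<Longrightarrow>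
       \<sigma> b j z = H b j i z * s b i z"
    by blast
  have rel: "\<sigma> True j (inverse z) = (\<theta> z * q z) * \<sigma> False j z"
    if z: "z \<in> sphere 0 1" and j: "j \<in> idx M" "F (Some z) \<in> dom M j" for z j
  proof -
    obtain i where i: "i \<in> idx L" "F (Some z) \<in> dom L i" using cover_path[OF u cov, of False z] by auto
    have z0: "z \<noteq> 0" "norm (inverse z) = 1" using z by (auto simp: norm_inverse)
    have "\<sigma> True j (inverse z) = H True j i (inverse z) * s True i (inverse z)"
      by (rule \<sigma>(2)) (use i j z0 in \<open>auto simp: aff_inf_inverse\<close>)
    moreover have "\<sigma> False j z = H False j i z * s False i z"
      by (rule \<sigma>(2)) (use i j z in auto)
    ultimately show ?thesis using s(2)[OF z i] \<theta>(1)[OF j(1) i(1) z] i j by auto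
  qed
  have "log_increment ((\<lambda>z. \<theta> z * q z) \<circ> circlepath 0 1) (k + n)"
    using log_increment_mult[OF \<theta>(2) s(3)] by (simp add: o_def)
  with \<sigma>(1) rel show ?thesis by (rule frame_degreeI)
qed

lemma frame_degree_power:
  assumes "frame_degree L F n"
  shows "frame_degree (bundle_power L N) F (int N * n)"
proof -
  obtain s q where s: "\<And>b. frame L (F \<circ> P1_chart b) (cball 0 1) (s b)"
    "\<And>z i. z \<in> sphere 0 1 \<Longrightarrow> i\<in>idx L \<Longrightarrow> F (Some z) \<in> dom L i \<Longrightarrow> s True i (inverse z) = q z * s False i z"
    "log_increment (q \<circ> circlepath 0 1) n"
    using frame_degreeE[OF assms] by blast
  have [simp]: "idx (bundle_power L N) = idx L" "dom (bundle_power L N) = dom L"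
    "trans (bundle_power L N) i j x = trans L i j x ^ N" for i j x
    by (simp_all add: bundle_power_def)
  have fr: "frame (bundle_power L N) u T (\<lambda>i z. s i z ^ N)" if "frame L u T s" for u T s
    unfolding frame_def
  proof (intro conjI ballI impI)
    fix i assume "i \<in> idx (bundle_power L N)"
    then have i: "i \<in> idx L" by simp
    from frame_continuous[OF that i] show "continuous_on {z \<in> T. u z \<in> dom (bundle_power L N) i} (\<lambda>z. s i z ^ N)"
      unfolding \<open>dom (bundle_power L N) = dom L\<close> by (intro continuous_intros)
    show "s i z ^ N \<noteq> 0" if "z \<in> T" "u z \<in> dom (bundle_power L N) i" for z
      using frame_zero[OF \<open>frame L u T s\<close> i] that by simp
    show "s i z ^ N = trans (bundle_power L N) i j (u z) * s j z ^ N"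
      if j: "j \<in> idx (bundle_power L N)" and z: "z \<in> T"
        "u z \<in> dom (bundle_power L N) i \<inter> dom (bundle_power L N) j" for j z
    proof -
      have "j \<in> idx L" "u z \<in> dom L i \<inter> dom L j" using j z by simp_all
      then have "s i z = trans L i j (u z) * s j z"
        using frame_trans[OF \<open>frame L u T s\<close> i _ z(1)] by blast
      then show ?thesis by (simp add: power_mult_distrib)
    qed
  qed
  show ?thesis
  proof (rule frame_degreeI[OF fr[OF s(1)]])
    fix z i assume "z \<in> sphere 0 1" "i \<in> idx (bundle_power L N)" "F (Some z) \<in> dom (bundle_power L N) i"
    then have "s True i (inverse z) = q z * s False i z" by (intro s(2)) simp_all
    then show "s True i (inverse z) ^ N = (q z ^ N) * s False i z ^ N" by (simp add: power_mult_distrib)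
  next
    show "log_increment ((\<lambda>z. q z ^ N) \<circ> circlepath 0 1) (int N * n)"
      using log_increment_powi[OF s(3), of "int N"] by (simp add: o_def)
  qed
qed

text \<open>The transition functions of a divisor are products of powers of those of its components, so
  products of powers of frames are frames.\<close>

lemma frame_degree_divisor:
  assumes fin: "finite \<E>"
    and deg: "\<And>E. E \<in> \<E> \<Longrightarrow> frame_degree (divisor_bundle S {E} (\<lambda>_. 1)) F (k E)"
  shows "frame_degree (divisor_bundle S \<E> n) F (\<Sum>E\<in>\<E>. n E * k E)"
proof -
  let ?L = "\<lambda>E. divisor_bundle S {E} (\<lambda>_. 1)"
  have "\<forall>E\<in>\<E>. \<exists>w. (\<forall>b. frame (?L E) (F \<circ> P1_chart b) (cball 0 1) (fst w b)) \<and>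
     (\<forall>z \<in> sphere 0 1. \<forall>i\<in>idx (?L E). F (Some z) \<in> dom (?L E) i \<longrightarrow>
        fst w True i (inverse z) = snd w z * fst w False i z) \<and>
     log_increment (snd w \<circ> circlepath 0 1) (k E)"
    using deg unfolding frame_degree_def by simp
  from bchoice[OF this] obtain w where w: "\<And>E. E \<in> \<E> \<Longrightarrow>
     (\<forall>b. frame (?L E) (F \<circ> P1_chart b) (cball 0 1) (fst (w E) b)) \<and>
     (\<forall>z \<in> sphere 0 1. \<forall>i\<in>idx (?L E). F (Some z) \<in> dom (?L E) i \<longrightarrow>
        fst (w E) True i (inverse z) = snd (w E) z * fst (w E) False i z) \<and>
     log_increment (snd (w E) \<circ> circlepath 0 1) (k E)" by blast
  define s where "s b E = fst (w E) b" for b E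
  define q where "q E = snd (w E)" for E
  have s: "\<And>b E. E \<in> \<E> \<Longrightarrow> frame (?L E) (F \<circ> P1_chart b) (cball 0 1) (s b E)"
    "\<And>E z i. E \<in> \<E> \<Longrightarrow> z \<in> sphere 0 1 \<Longrightarrow> i\<in>idx (?L E) \<Longrightarrow> F (Some z) \<in> dom (?L E) i \<Longrightarrow>
        s True E i (inverse z) = q E z * s False E i z"
    "\<And>E. E \<in> \<E> \<Longrightarrow> log_increment (q E \<circ> circlepath 0 1) (k E)"
    using w unfolding s_def q_def by blast+
  have idx: "i \<in> idx (?L E)" if "i \<in> idx (divisor_bundle S \<E> n)" "E \<in> \<E>" for i E
    using that unfolding divisor_bundle_def by auto
  have dm [simp]: "dom (divisor_bundle S A m) = fst" for A m
    by (simp add: divisor_bundle_def)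
  have tr: "trans (divisor_bundle S \<E> n) i j x = (\<Prod>E\<in>\<E>. trans (?L E) i j x powi n E)" for i j x
    by (simp add: divisor_bundle_def case_prod_unfold)
  have fr: "frame (divisor_bundle S \<E> n) u T (\<lambda>i z. \<Prod>E\<in>\<E>. s E i z powi n E)"
    if f: "\<And>E. E \<in> \<E> \<Longrightarrow> frame (?L E) u T (s E)" for u T s
    unfolding frame_def
  proof (intro conjI ballI impI)
    fix i assume i: "i \<in> idx (divisor_bundle S \<E> n)"
    show "continuous_on {z \<in> T. u z \<in> dom (divisor_bundle S \<E> n) i} (\<lambda>z. \<Prod>E\<in>\<E>. s E i z powi n E)"
    proof (intro continuous_intros)
      fix E assume E: "E \<in> \<E>"
      show "continuous_on {z \<in> T. u z \<in> dom (divisor_bundle S \<E> n) i} (s E i)"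
        using frame_continuous[OF f[OF E] idx[OF i E]] by simp
      show "0 \<le> n E \<or> (\<forall>x \<in> {z \<in> T. u z \<in> dom (divisor_bundle S \<E> n) i}. s E i x \<noteq> 0)"
        using frame_zero[OF f[OF E] idx[OF i E]] by auto
    qed
    show "(\<Prod>E\<in>\<E>. s E i z powi n E) \<noteq> 0" if "z \<in> T" "u z \<in> dom (divisor_bundle S \<E> n) i" for z
      using frame_zero[OF f idx[OF i]] that fin by auto
    show "(\<Prod>E\<in>\<E>. s E i z powi n E) = trans (divisor_bundle S \<E> n) i j (u z) * (\<Prod>E\<in>\<E>. s E j z powi n E)"
      if j: "j \<in> idx (divisor_bundle S \<E> n)" and z: "z \<in> T"
        "u z \<in> dom (divisor_bundle S \<E> n) i \<inter> dom (divisor_bundle S \<E> n) j" for j z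
      unfolding tr prod.distrib[symmetric]
    proof (rule prod.cong[OF refl])
      fix E assume E: "E \<in> \<E>"
      have "s E i z = trans (?L E) i j (u z) * s E j z"
        by (rule frame_trans[OF f[OF E] idx[OF i E] idx[OF j E] z(1)]) (use z in simp)
      then show "s E i z powi n E = trans (?L E) i j (u z) powi n E * s E j z powi n E"
        by (simp add: power_int_mult_distrib)
    qed
  qed
  show ?thesis
  proof (rule frame_degreeI[OF fr[OF s(1)]])
    fix z i assume z: "z \<in> sphere 0 1" "i \<in> idx (divisor_bundle S \<E> n)"
      "F (Some z) \<in> dom (divisor_bundle S \<E> n) i"
    have "s True E i (inverse z) = q E z * s False E i z" if "E \<in> \<E>" for E
      by (rule s(2)[OF that z(1) idx[OF z(2) that]]) (use z(3) in simp)
    then show "(\<Prod>E\<in>\<E>. s True E i (inverse z) powi n E) = (\<Prod>E\<in>\<E>. q E z powi n E) * (\<Prod>E\<in>\<E>. s False E i z powi n E)"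
      by (simp add: prod.distrib[symmetric] power_int_mult_distrib)
  next
    show "log_increment ((\<lambda>z. \<Prod>E\<in>\<E>. q E z powi n E) \<circ> circlepath 0 1) (\<Sum>E\<in>\<E>. n E * k E)"
      using log_increment_prod[OF fin, of "\<lambda>E t. (q E \<circ> circlepath 0 1) t powi n E"]
        log_increment_powi[OF s(3)] by (simp add: o_def)
  qed
qed

section \<open>Holomorphic functions of two variables, charts and curves\<close>

definition grad :: "(complex^2 \<Rightarrow> complex) \<Rightarrow> complex^2 \<Rightarrow> complex^2" where
  "grad f z = (\<chi> i. frechet_derivative f (at z) (axis i 1))"

lemma grad_eqI:
  assumes "(f has_derivative (\<lambda>h. \<Sum>i\<in>UNIV. a $ i * h $ i)) (at z)"
  shows "grad f z = a"
proof -
  have "frechet_derivative f (at z) = (\<lambda>h. \<Sum>i\<in>UNIV. a $ i * h $ i)"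
    using frechet_derivative_at[OF assms] by simp
  then show ?thesis unfolding grad_def by (simp add: vec_eq_iff sum_2 forall_2 axis_def)
qed

lemma holo_fun_iff:
  "holo_fun f W \<longleftrightarrow> open W \<and> continuous_on W (grad f) \<and>
     (\<forall>z\<in>W. (f has_derivative (\<lambda>h. \<Sum>i\<in>UNIV. grad f z $ i * h $ i)) (at z))"
proof
  assume "holo_fun f W"
  then obtain a :: "complex^2 \<Rightarrow> complex^2" where a: "open W" "continuous_on W a"
    "\<And>z. z\<in>W \<Longrightarrow> (f has_derivative (\<lambda>h. \<Sum>i\<in>UNIV. a z $ i * h $ i)) (at z)"
    unfolding holo_fun_def by blast
  have eq: "grad f z = a z" if "z \<in> W" for z using grad_eqI[OF a(3)[OF that]] .
  have "continuous_on W (grad f)" using a(2) eq by (simp cong: continuous_on_cong)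
  then show "open W \<and> continuous_on W (grad f) \<and>
     (\<forall>z\<in>W. (f has_derivative (\<lambda>h. \<Sum>i\<in>UNIV. grad f z $ i * h $ i)) (at z))"
    using a eq by simp
qed (auto simp: holo_fun_def)

lemma holo_fun_has_derivative:
  "holo_fun f W \<Longrightarrow> z \<in> W \<Longrightarrow> (f has_derivative (\<lambda>h. \<Sum>i\<in>UNIV. grad f z $ i * h $ i)) (at z)"
  unfolding holo_fun_iff by blast

lemma holo_fun_open: "holo_fun f W \<Longrightarrow> open W"
  unfolding holo_fun_iff by blast

lemma holo_fun_continuous_grad: "holo_fun f W \<Longrightarrow> continuous_on W (grad f)"
  unfolding holo_fun_iff by blast

lemma holo_fun_continuous: "holo_fun f W \<Longrightarrow> continuous_on W f"
  by (meson continuous_at_imp_continuous_on has_derivative_continuous holo_fun_has_derivative)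

lemma holo_fun_subset:
  assumes "holo_fun f W" "open W'" "W' \<subseteq> W" shows "holo_fun f W'"
  unfolding holo_fun_iff
  using assms holo_fun_continuous_grad[OF assms(1)] holo_fun_has_derivative[OF assms(1)]
  by (auto intro: continuous_on_subset)

lemma grad_cong:
  assumes "open W" "z \<in> W" "\<And>y. y \<in> W \<Longrightarrow> f y = g y"
  shows "grad f z = grad g z"
proof -
  have "(f has_derivative f') (at z) \<longleftrightarrow> (g has_derivative f') (at z)" for f'
  proof
    show "(g has_derivative f') (at z)" if "(f has_derivative f') (at z)"
      by (rule has_derivative_transform_within_open[OF that assms(1,2)]) (simp add: assms(3))
    show "(f has_derivative f') (at z)" if "(g has_derivative f') (at z)"
      by (rule has_derivative_transform_within_open[OF that assms(1,2)]) (simp add: assms(3))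
  qed
  then have "frechet_derivative f (at z) = frechet_derivative g (at z)"
    unfolding frechet_derivative_def by simp
  then show ?thesis unfolding grad_def by simp
qed

lemma holo_fun_cong:
  assumes "holo_fun f W" "\<And>y. y \<in> W \<Longrightarrow> g y = f y"
  shows "holo_fun g W"
  unfolding holo_fun_iff
proof (intro conjI ballI)
  note op = holo_fun_open[OF assms(1)]
  show "open W" by (rule op)
  have eq: "grad g z = grad f z" if "z \<in> W" for z by (rule grad_cong[OF op that assms(2)])
  then show "continuous_on W (grad g)"
    using holo_fun_continuous_grad[OF assms(1)] by (simp cong: continuous_on_cong)
  show "(g has_derivative (\<lambda>h. \<Sum>i\<in>UNIV. grad g z $ i * h $ i)) (at z)" if "z \<in> W" for z
    unfolding eq[OF that]
    by (rule has_derivative_transform_within_open[OF holo_fun_has_derivative[OF assms(1) that] op that])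
       (simp add: assms(2))
qed

text \<open>The partial derivatives are determined by the function, so those found near the
  individual points fit together to continuous functions.\<close>

lemma holo_fun_local:
  assumes "\<And>z. z \<in> W \<Longrightarrow> \<exists>W'. z \<in> W' \<and> W' \<subseteq> W \<and> holo_fun f W'"
  shows "holo_fun f W"
  unfolding holo_fun_iff
proof (intro conjI ballI)
  show op: "open W" by (subst open_subopen) (meson assms holo_fun_open)
  show "continuous_on W (grad f)"
  proof (rule continuous_at_imp_continuous_on, rule ballI)
    fix z assume "z \<in> W"
    then obtain W' where "z \<in> W'" "holo_fun f W'" using assms by blast
    then show "isCont (grad f) z"
      using holo_fun_continuous_grad holo_fun_open continuous_on_eq_continuous_at by blast
  qed
  show "(f has_derivative (\<lambda>h. \<Sum>i\<in>UNIV. grad f z $ i * h $ i)) (at z)" if "z \<in> W" for z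
    using assms[OF that] holo_fun_has_derivative by blast
qed

lemma bounded_linear_axis: "bounded_linear (axis i :: 'b::real_normed_vector \<Rightarrow> 'b^'n)"
proof (rule bounded_linear_intro[where K = 1])
  show "axis i (x + y) = axis i x + (axis i y :: 'b^'n)" for x y
    by (simp add: axis_def vec_eq_iff)
  show "axis i (r *\<^sub>R x) = r *\<^sub>R (axis i x :: 'b^'n)" for r x
    by (simp add: axis_def vec_eq_iff)
  show "norm (axis i x :: 'b^'n) \<le> norm x * 1" for x
  proof -
    have "norm (axis i x :: 'b^'n) \<le> (\<Sum>j\<in>UNIV. norm ((axis i x :: 'b^'n) $ j))"
      unfolding norm_vec_def by (rule L2_set_le_sum) simp
    also have "\<dots> = norm x" by (simp add: axis_def if_distrib cong: if_cong)
    finally show ?thesis by simp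
  qed
qed

text \<open>A vector is the sum of its components along the axes, and derivatives commute with this finite
  sum.\<close>

lemma has_derivative_vec:
  fixes g :: "'a::real_normed_vector \<Rightarrow> 'b::real_normed_vector^'n"
  assumes "\<And>i. ((\<lambda>x. g x $ i) has_derivative (\<lambda>h. g' h $ i)) F"
  shows "(g has_derivative g') F"
proof -
  have exp: "v = (\<Sum>i\<in>UNIV. axis i (v $ i))" for v :: "'b^'n"
    by (simp add: vec_eq_iff axis_def if_distrib cong: if_cong)
  have "((\<lambda>x. \<Sum>i\<in>UNIV. axis i (g x $ i)) has_derivative (\<lambda>h. \<Sum>i\<in>UNIV. axis i (g' h $ i))) F"
    by (intro has_derivative_sum bounded_linear.has_derivative[OF bounded_linear_axis] assms)
  then show ?thesis using exp by simp
qed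

lemma jacobian_nth: "jacobian g z $ i $ j = frechet_derivative g (at z) (axis j 1) $ i"
  by (simp add: jacobian_def matrix_def)

lemma holo_map_derivative:
  assumes "holo_map g V" "z \<in> V"
  shows "(g has_derivative (\<lambda>h. jacobian g z *v h)) (at z)"
    and "jacobian g z $ i = grad (\<lambda>z. g z $ i) z"
proof -
  let ?D = "\<lambda>h. \<chi> i. \<Sum>j\<in>UNIV. grad (\<lambda>z. g z $ i) z $ j * h $ j"
  have D: "(g has_derivative ?D) (at z)"
    by (rule has_derivative_vec)
       (use assms holo_fun_has_derivative[of _ V z] in \<open>auto simp: holo_map_def\<close>)
  have J: "jacobian g z $ i = grad (\<lambda>z. g z $ i) z" for i
    by (simp add: vec_eq_iff forall_2 jacobian_nth frechet_derivative_at[OF D, symmetric] sum_2 axis_def)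
  then show "jacobian g z $ i = grad (\<lambda>z. g z $ i) z" .
  have "?D = (\<lambda>h. jacobian g z *v h)"
    by (simp add: fun_eq_iff vec_eq_iff matrix_vector_mult_def J)
  then show "(g has_derivative (\<lambda>h. jacobian g z *v h)) (at z)" using D by simp
qed

lemma holo_map_open: "holo_map g V \<Longrightarrow> open V"
  unfolding holo_map_def using holo_fun_open by blast

lemma holo_map_continuous: "holo_map g V \<Longrightarrow> continuous_on V g"
  by (meson continuous_at_imp_continuous_on has_derivative_continuous holo_map_derivative(1))

lemma holo_map_continuous_jacobian: 
  assumes "holo_map g V" shows "continuous_on V (\<lambda>z. jacobian g z $ i $ j)"
proof -
  have "continuous_on V (\<lambda>z. grad (\<lambda>z. g z $ i) z $ j)"
    by (intro continuous_intros holo_fun_continuous_grad) (use assms in \<open>auto simp: holo_map_def\<close>)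
  then show ?thesis by (simp add: holo_map_derivative(2)[OF assms] cong: continuous_on_cong)
qed

lemma holo_fun_compose_deriv:
  assumes "holo_fun f W" "holo_map g V" "z \<in> V" "g z \<in> W"
  shows "(f \<circ> g has_derivative (\<lambda>h. \<Sum>j\<in>UNIV. (\<Sum>i\<in>UNIV. grad f (g z) $ i * jacobian g z $ i $ j) * h $ j)) (at z)"
proof -
  have "(f \<circ> g has_derivative ((\<lambda>h. \<Sum>i\<in>UNIV. grad f (g z) $ i * h $ i) \<circ> (\<lambda>h. jacobian g z *v h))) (at z)"
    by (rule diff_chain_at[OF holo_map_derivative(1)[OF assms(2,3)] holo_fun_has_derivative[OF assms(1,4)]])
  moreover have "((\<lambda>h. \<Sum>i\<in>UNIV. grad f (g z) $ i * h $ i) \<circ> (\<lambda>h. jacobian g z *v h)) =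
     (\<lambda>h. \<Sum>j\<in>UNIV. (\<Sum>i\<in>UNIV. grad f (g z) $ i * jacobian g z $ i $ j) * h $ j)"
    by (simp add: fun_eq_iff sum_2 matrix_vector_mult_def algebra_simps)
  ultimately show ?thesis by simp
qed

lemma grad_compose:
  assumes "holo_fun f W" "holo_map g V" "z \<in> V" "g z \<in> W"
  shows "grad (f \<circ> g) z $ j = (\<Sum>i\<in>UNIV. grad f (g z) $ i * jacobian g z $ i $ j)"
proof -
  have "grad (f \<circ> g) z = (\<chi> j. \<Sum>i\<in>UNIV. grad f (g z) $ i * jacobian g z $ i $ j)"
    by (rule grad_eqI) (use holo_fun_compose_deriv[OF assms] in simp)
  then show ?thesis by simp
qed

lemma holo_fun_compose:
  assumes "holo_fun f W" "holo_map g V" "g ` V \<subseteq> W"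
  shows "holo_fun (f \<circ> g) V"
proof -
  have "continuous_on V (\<lambda>z. \<chi> j. \<Sum>i\<in>UNIV. grad f (g z) $ i * jacobian g z $ i $ j)"
  proof -
    have "continuous_on V (\<lambda>z. grad f (g z) $ i)" for i
      by (intro continuous_on_component
        continuous_on_compose2[OF holo_fun_continuous_grad[OF assms(1)] holo_map_continuous[OF assms(2)] assms(3)])
    then show ?thesis
      by (intro continuous_on_vec_lambda continuous_on_sum continuous_on_mult holo_map_continuous_jacobian[OF assms(2)])
  qed
  then show ?thesis unfolding holo_fun_def
    using holo_map_open[OF assms(2)] holo_fun_compose_deriv[OF assms(1,2)] assms(3)
    by (intro conjI exI[of _ "\<lambda>z. \<chi> j. \<Sum>i\<in>UNIV. grad f (g z) $ i * jacobian g z $ i $ j"]) auto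
qed

lemma holo_fun_mult:
  assumes "holo_fun f W" "holo_fun g W"
  shows "holo_fun (\<lambda>z. f z * g z) W"
    and "z \<in> W \<Longrightarrow> grad (\<lambda>z. f z * g z) z = f z *s grad g z + g z *s grad f z"
proof -
  have D: "((\<lambda>z. f z * g z) has_derivative (\<lambda>h. \<Sum>i\<in>UNIV. (f z *s grad g z + g z *s grad f z) $ i * h $ i)) (at z)"
    if "z \<in> W" for z
  proof -
    have "((\<lambda>z. f z * g z) has_derivative (\<lambda>h. f z * (\<Sum>i\<in>UNIV. grad g z $ i * h $ i) + (\<Sum>i\<in>UNIV. grad f z $ i * h $ i) * g z)) (at z)"
      by (intro has_derivative_mult holo_fun_has_derivative[OF _ that] assms)
    then show ?thesis by (simp add: sum_2 algebra_simps)
  qed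
  have "continuous_on W (\<lambda>z. \<chi> i. f z * grad g z $ i + g z * grad f z $ i)"
    by (intro continuous_on_vec_lambda continuous_intros holo_fun_continuous_grad holo_fun_continuous assms)
  moreover have "(\<lambda>z. \<chi> i. f z * grad g z $ i + g z * grad f z $ i) = (\<lambda>z. f z *s grad g z + g z *s grad f z)"
    by (simp add: fun_eq_iff vec_eq_iff)
  ultimately show "holo_fun (\<lambda>z. f z * g z) W"
    unfolding holo_fun_def using D holo_fun_open[OF assms(1)] by auto
  show "z \<in> W \<Longrightarrow> grad (\<lambda>z. f z * g z) z = f z *s grad g z + g z *s grad f z"
    by (rule grad_eqI[OF D])
qed

lemma holo_fun_nth:
  assumes "open W"
  shows "holo_fun (\<lambda>z. z $ k) W" and "grad (\<lambda>z. z $ k) z = axis k 1"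
proof -
  have D: "((\<lambda>z. z $ k) has_derivative (\<lambda>h. \<Sum>i\<in>UNIV. axis k 1 $ i * h $ i)) (at z)" for z :: "complex^2"
  proof -
    have "(\<Sum>i\<in>UNIV. axis k 1 $ i * h $ i) = (\<Sum>i\<in>UNIV. if i = k then h $ i else 0)" for h :: "complex^2"
      by (rule sum.cong) (auto simp: axis_def)
    then show ?thesis using bounded_linear_imp_has_derivative[OF bounded_linear_vec_nth, of k "at z"] by simp
  qed
  then show "grad (\<lambda>z. z $ k) z = axis k 1" by (rule grad_eqI)
  show "holo_fun (\<lambda>z. z $ k) W"
    unfolding holo_fun_def using assms D by (intro conjI exI[of _ "\<lambda>z. axis k 1"]) auto
qed

text \<open>The chain rule for a function of two variables along a curve, in the form used to express that a
  function which is constant along a curve has differential zero on its velocity.\<close>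

lemma holo_fun_curve:
  assumes "holo_fun f W" "u z \<in> W" "\<And>i. ((\<lambda>z. u z $ i) has_field_derivative v $ i) (at z)"
  shows "((\<lambda>z. f (u z)) has_field_derivative (\<Sum>i\<in>UNIV. grad f (u z) $ i * v $ i)) (at z)"
proof -
  have "(u has_derivative (\<lambda>h. \<chi> i. v $ i * h)) (at z)"
    by (rule has_derivative_vec) (use assms(3) in \<open>simp add: has_field_derivative_def\<close>)
  from diff_chain_at[OF this holo_fun_has_derivative[OF assms(1,2)]]
  have "(f \<circ> u has_derivative (\<lambda>h. (\<Sum>i\<in>UNIV. grad f (u z) $ i * v $ i) * h)) (at z)"
    by (simp add: o_def sum_2 algebra_simps)
  then show ?thesis by (simp add: has_field_derivative_def o_def)
qed

lemma is_chart_inj: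
  assumes "is_chart X c" shows "inj_on (snd c) (fst c)"
proof -
  have "topspace (subtopology X (fst c)) = fst c"
    using assms openin_subset by (fastforce simp: is_chart_def)
  then show ?thesis using assms homeomorphic_imp_injective_map unfolding is_chart_def by metis
qed

lemma is_chart_inv: "is_chart X c \<Longrightarrow> x \<in> fst c \<Longrightarrow> inv_into (fst c) (snd c) (snd c x) = x"
  by (rule inv_into_f_f[OF is_chart_inj])

lemma is_chart_open_image:
  assumes "is_chart X c" "openin X W"
  shows "open (snd c ` (fst c \<inter> W))"
proof -
  have "openin (subtopology X (fst c)) (fst c \<inter> W)" 
    using assms(2) by (simp add: openin_subtopology_Int2)
  then have "openin (top_of_set (snd c ` fst c)) (snd c ` (fst c \<inter> W))"
    using assms(1) homeomorphic_imp_open_map unfolding is_chart_def open_map_def by blast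
  then show ?thesis using assms(1) openin_open_trans unfolding is_chart_def by blast
qed

lemma is_chart_openin_preimage:
  assumes "is_chart X c" "open W"
  shows "openin X {x \<in> fst c. snd c x \<in> W}"
proof -
  have cm: "continuous_map (subtopology X (fst c)) (top_of_set (snd c ` fst c)) (snd c)"
    using assms(1) homeomorphic_imp_continuous_map unfolding is_chart_def by blast
  have "openin (top_of_set (snd c ` fst c)) (snd c ` fst c \<inter> W)" using assms(2) by (simp add: openin_open_Int)
  from openin_continuous_map_preimage[OF cm this]
  have "openin (subtopology X (fst c)) {x \<in> fst c. snd c x \<in> W}"
  proof (rule back_subst[of "openin (subtopology X (fst c))"])
    have "fst c \<subseteq> topspace X" using assms(1) openin_subset unfolding is_chart_def by blast
    then show "{x \<in> topspace (subtopology X (fst c)). snd c x \<in> snd c ` fst c \<inter> W} = {x \<in> fst c. snd c x \<in> W}"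
      by auto
  qed
  then show ?thesis using assms(1) openin_trans_full unfolding is_chart_def by blast
qed

definition chart_grad :: "'a chart2 \<Rightarrow> ('a \<Rightarrow> complex) \<Rightarrow> 'a \<Rightarrow> complex^2" where
  "chart_grad c f x = grad (f \<circ> inv_into (fst c) (snd c)) (snd c x)"

definition chart_jac :: "'a chart2 \<Rightarrow> 'a chart2 \<Rightarrow> 'a \<Rightarrow> complex^2^2" where
  "chart_jac c c' x = jacobian (coord_change c c') (snd c' x)"

lemma charts_holo_chart: "compact_complex_surface S \<Longrightarrow> c \<in> charts S \<Longrightarrow> holo_chart S c"
  unfolding compact_complex_surface_def holo_chart_def by blast

lemma holo_chart_is_chart: "holo_chart S c \<Longrightarrow> is_chart (space_of S) c"
  unfolding holo_chart_def by blast

lemma holo_chart_compatible: "holo_chart S c \<Longrightarrow> c' \<in> charts S \<Longrightarrow> compatible c c'"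
  unfolding holo_chart_def by blast

lemma chart_cover: "compact_complex_surface S \<Longrightarrow> x \<in> topspace (space_of S) \<Longrightarrow> \<exists>c\<in>charts S. x \<in> fst c"
  unfolding compact_complex_surface_def by blast

lemma holo_on_open: "holo_on S f W \<Longrightarrow> openin (space_of S) W"
  unfolding holo_on_def by blast

lemma compatible_change:
  assumes "compatible c c'"
  shows "holo_map (coord_change c c') (snd c' ` (fst c \<inter> fst c'))"
    and "holo_map (coord_change c' c) (snd c ` (fst c \<inter> fst c'))"
  using assms unfolding compatible_def by blast+

lemma coord_change_apply:
  "is_chart X c' \<Longrightarrow> x \<in> fst c' \<Longrightarrow> coord_change c c' (snd c' x) = snd c x"
  by (simp add: coord_change_def is_chart_inv)

text \<open>Charts of the maximal atlas serve as well as those of the given atlas: near each point they differ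
  from an atlas chart by a holomorphic change of coordinates.\<close>

lemma holo_on_holo_chart:
  assumes S: "compact_complex_surface S" and f: "holo_on S f W" and c: "holo_chart S c"
  shows "holo_fun (f \<circ> inv_into (fst c) (snd c)) (snd c ` (fst c \<inter> W))"
proof (rule holo_fun_local)
  fix z assume "z \<in> snd c ` (fst c \<inter> W)"
  then obtain x where x: "x \<in> fst c" "x \<in> W" "z = snd c x" by blast
  note ch = holo_chart_is_chart[OF c]
  have "x \<in> topspace (space_of S)" using x(2) holo_on_open[OF f] openin_subset by blast
  then obtain c' where c': "c' \<in> charts S" "x \<in> fst c'" using chart_cover[OF S] by blast
  note ch' = holo_chart_is_chart[OF charts_holo_chart[OF S c'(1)]]
  have op: "openin (space_of S) (fst c')" "openin (space_of S) (fst c)"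
    using ch ch' unfolding is_chart_def by auto
  let ?V = "snd c ` (fst c \<inter> (fst c' \<inter> W))"
  have V: "open ?V" by (intro is_chart_open_image[OF ch] openin_Int op holo_on_open[OF f])
  have "holo_map (coord_change c' c) ?V"
  proof -
    have "holo_map (coord_change c' c) (snd c ` (fst c \<inter> fst c'))"
      using compatible_change(2)[OF holo_chart_compatible[OF c c'(1)]] .
    then show ?thesis unfolding holo_map_def by (auto intro: holo_fun_subset[OF _ V])
  qed
  moreover have "holo_fun (f \<circ> inv_into (fst c') (snd c')) (snd c' ` (fst c' \<inter> W))"
    using f c'(1) unfolding holo_on_def by blast
  ultimately have "holo_fun ((f \<circ> inv_into (fst c') (snd c')) \<circ> coord_change c' c) ?V"
    by (intro holo_fun_compose) (auto simp: coord_change_apply[OF ch])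
  then have "holo_fun (f \<circ> inv_into (fst c) (snd c)) ?V"
    by (rule holo_fun_cong) (auto simp: coord_change_apply[OF ch] is_chart_inv[OF ch] is_chart_inv[OF ch'])
  moreover have "z \<in> ?V" using x c' by blast
  ultimately show "\<exists>W'. z \<in> W' \<and> W' \<subseteq> snd c ` (fst c \<inter> W) \<and> holo_fun (f \<circ> inv_into (fst c) (snd c)) W'"
    by (intro exI[of _ ?V]) auto
qed

lemma holo_on_subset:
  assumes S: "compact_complex_surface S" and "holo_on S f W" "openin (space_of S) W'" "W' \<subseteq> W"
  shows "holo_on S f W'"
  unfolding holo_on_def
proof (intro conjI ballI)
  fix c assume c: "c \<in> charts S"
  have "holo_fun (f \<circ> inv_into (fst c) (snd c)) (snd c ` (fst c \<inter> W))"
    using assms(2) c unfolding holo_on_def by blast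
  then show "holo_fun (f \<circ> inv_into (fst c) (snd c)) (snd c ` (fst c \<inter> W'))"
    by (rule holo_fun_subset)
       (use assms(4) is_chart_open_image[OF holo_chart_is_chart[OF charts_holo_chart[OF S c]] assms(3)] in auto)
qed (fact assms)

lemma holo_on_pullback:
  assumes S: "compact_complex_surface S" and c: "holo_chart S c" and g: "holo_fun g W"
  shows "holo_on S (\<lambda>x. g (snd c x)) {x \<in> fst c. snd c x \<in> W}"
  unfolding holo_on_def
proof (intro conjI ballI)
  note ch = holo_chart_is_chart[OF c]
  let ?U = "{x \<in> fst c. snd c x \<in> W}"
  show op: "openin (space_of S) ?U" by (rule is_chart_openin_preimage[OF ch holo_fun_open[OF g]])
  fix c' assume c': "c' \<in> charts S"
  note ch' = holo_chart_is_chart[OF charts_holo_chart[OF S c']]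
  have V: "open (snd c' ` (fst c' \<inter> ?U))" by (rule is_chart_open_image[OF ch' op])
  have "holo_map (coord_change c c') (snd c' ` (fst c' \<inter> ?U))"
  proof -
    have "holo_map (coord_change c c') (snd c' ` (fst c \<inter> fst c'))"
      using compatible_change(1)[OF holo_chart_compatible[OF c c']] .
    then show ?thesis unfolding holo_map_def by (auto intro: holo_fun_subset[OF _ V])
  qed
  moreover have "coord_change c c' ` (snd c' ` (fst c' \<inter> ?U)) \<subseteq> W"
    by (auto simp: coord_change_apply[OF ch'])
  ultimately have "holo_fun (g \<circ> coord_change c c') (snd c' ` (fst c' \<inter> ?U))"
    by (rule holo_fun_compose[OF g])
  then show "holo_fun ((\<lambda>x. g (snd c x)) \<circ> inv_into (fst c') (snd c')) (snd c' ` (fst c' \<inter> ?U))"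
    by (rule holo_fun_cong) (auto simp: coord_change_apply[OF ch'] is_chart_inv[OF ch'])
qed

lemma chart_grad_change:
  assumes S: "compact_complex_surface S" and f: "holo_on S f W"
    and c: "holo_chart S c" and c': "holo_chart S c'" and cc: "compatible c c'"
    and x: "x \<in> fst c" "x \<in> fst c'" "x \<in> W"
  shows "chart_grad c' f x $ j = (\<Sum>i\<in>UNIV. chart_grad c f x $ i * chart_jac c c' x $ i $ j)"
proof -
  note ch = holo_chart_is_chart[OF c] and ch' = holo_chart_is_chart[OF c']
  have op: "openin (space_of S) (fst c')" "openin (space_of S) (fst c)"
    using ch ch' unfolding is_chart_def by auto
  let ?V = "snd c' ` (fst c' \<inter> (fst c \<inter> W))"
  have V: "open ?V" by (intro is_chart_open_image[OF ch'] openin_Int op holo_on_open[OF f])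
  have "chart_grad c' f x = grad ((f \<circ> inv_into (fst c) (snd c)) \<circ> coord_change c c') (snd c' x)"
    unfolding chart_grad_def
    by (rule grad_cong[OF V])
       (use x in \<open>auto simp: coord_change_apply[OF ch'] is_chart_inv[OF ch] is_chart_inv[OF ch']\<close>)
  also have "\<dots> $ j = (\<Sum>i\<in>UNIV. grad (f \<circ> inv_into (fst c) (snd c)) (coord_change c c' (snd c' x)) $ i
      * jacobian (coord_change c c') (snd c' x) $ i $ j)"
    by (rule grad_compose[OF holo_on_holo_chart[OF S f c] compatible_change(1)[OF cc]])
       (use x in \<open>auto simp: coord_change_apply[OF ch']\<close>)
  finally show ?thesis unfolding chart_grad_def chart_jac_def coord_change_apply[OF ch' x(2)] .
qed

lemma chart_grad_mult:
  assumes S: "compact_complex_surface S" and q: "holo_on S q W" and g: "holo_on S g W"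
    and c: "holo_chart S c" and x: "x \<in> fst c" "x \<in> W" and f: "\<And>y. y \<in> W \<Longrightarrow> f y = q y * g y"
  shows "chart_grad c f x = q x *s chart_grad c g x + g x *s chart_grad c q x"
proof -
  note ch = holo_chart_is_chart[OF c]
  let ?i = "inv_into (fst c) (snd c)"
  have "chart_grad c f x = grad (\<lambda>z. (q \<circ> ?i) z * (g \<circ> ?i) z) (snd c x)"
    unfolding chart_grad_def
    by (rule grad_cong[OF is_chart_open_image[OF ch holo_on_open[OF q]]])
       (use x f in \<open>auto simp: is_chart_inv[OF ch]\<close>)
  also have "\<dots> = (q \<circ> ?i) (snd c x) *s grad (g \<circ> ?i) (snd c x) + (g \<circ> ?i) (snd c x) *s grad (q \<circ> ?i) (snd c x)"
    by (rule holo_fun_mult(2)[OF holo_on_holo_chart[OF S q c] holo_on_holo_chart[OF S g c]]) (use x in auto)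
  finally show ?thesis by (simp add: chart_grad_def is_chart_inv[OF ch x(1)])
qed

lemma holo_on_mult:
  assumes q: "holo_on S q W" and g: "holo_on S g W"
  shows "holo_on S (\<lambda>x. q x * g x) W"
  unfolding holo_on_def
proof (intro conjI ballI)
  fix c assume c: "c \<in> charts S"
  have "holo_fun (\<lambda>z. (q \<circ> inv_into (fst c) (snd c)) z * (g \<circ> inv_into (fst c) (snd c)) z) (snd c ` (fst c \<inter> W))"
    by (rule holo_fun_mult(1)) (use q g c in \<open>auto simp: holo_on_def o_def\<close>)
  then show "holo_fun ((\<lambda>x. q x * g x) \<circ> inv_into (fst c) (snd c)) (snd c ` (fst c \<inter> W))"
    by (simp add: o_def)
qed (rule holo_on_open[OF q])

definition velocity :: "'a chart2 \<Rightarrow> (complex \<Rightarrow> 'a) \<Rightarrow> complex \<Rightarrow> complex^2" where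
  "velocity c u z = (\<chi> i. deriv (\<lambda>z. snd c (u z) $ i) z)"

lemma holo_path_open: 
  assumes "holo_path S u" "openin (space_of S) W" shows "open {z. u z \<in> W}"
proof -
  have "openin euclidean {z \<in> topspace euclidean. u z \<in> W}"
    by (rule openin_continuous_map_preimage) (use assms in \<open>auto simp: holo_path_def\<close>)
  then show ?thesis by simp
qed

lemma holo_path_topspace: "holo_path S u \<Longrightarrow> u z \<in> topspace (space_of S)"
  unfolding holo_path_def continuous_map_def by auto

lemma chart_path_open:
  "compact_complex_surface S \<Longrightarrow> holo_path S u \<Longrightarrow> c \<in> charts S \<Longrightarrow> open {z. u z \<in> fst c}"
  by (rule holo_path_open) (auto dest!: charts_holo_chart simp: holo_chart_def is_chart_def)

lemma velocity_has_derivative: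
  assumes S: "compact_complex_surface S" and u: "holo_path S u" and c: "c \<in> charts S" and z: "u z \<in> fst c"
  shows "((\<lambda>z. snd c (u z) $ i) has_field_derivative velocity c u z $ i) (at z)"
proof -
  have "(\<lambda>z. snd c (u z) $ i) holomorphic_on {z. u z \<in> fst c}"
    using u c unfolding holo_path_def by blast
  from holomorphic_derivI[OF this chart_path_open[OF S u c]] show ?thesis using z by (simp add: velocity_def)
qed

lemma velocity_continuous:
  assumes S: "compact_complex_surface S" and u: "holo_path S u" and c: "c \<in> charts S"
  shows "continuous_on {z. u z \<in> fst c} (velocity c u)"
proof -
  have "(\<lambda>z. snd c (u z) $ i) holomorphic_on {z. u z \<in> fst c}" for i
    using u c unfolding holo_path_def by blast
  from holomorphic_deriv[OF this chart_path_open[OF S u c]]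
  have "continuous_on {z. u z \<in> fst c} (\<lambda>z. \<chi> i. deriv (\<lambda>z. snd c (u z) $ i) z)"
    by (intro continuous_on_vec_lambda holomorphic_on_imp_continuous_on)
  then show ?thesis by (simp add: velocity_def[abs_def])
qed

lemma chart_path_continuous:
  assumes S: "compact_complex_surface S" and u: "holo_path S u" and c: "c \<in> charts S"
  shows "continuous_on {z. u z \<in> fst c} (\<lambda>z. snd c (u z))"
proof -
  have "(\<lambda>z. snd c (u z) $ i) holomorphic_on {z. u z \<in> fst c}" for i
    using u c unfolding holo_path_def by blast
  then have "continuous_on {z. u z \<in> fst c} (\<lambda>z. \<chi> i. snd c (u z) $ i)"
    by (intro continuous_on_vec_lambda holomorphic_on_imp_continuous_on)
  then show ?thesis by simp
qed

lemma holo_on_path_derivative: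
  assumes S: "compact_complex_surface S" and u: "holo_path S u" and c: "c \<in> charts S"
    and f: "holo_on S f W" and z: "u z \<in> fst c" "u z \<in> W"
  shows "((\<lambda>z. f (u z)) has_field_derivative (\<Sum>i\<in>UNIV. chart_grad c f (u z) $ i * velocity c u z $ i)) (at z)"
proof -
  note ch = holo_chart_is_chart[OF charts_holo_chart[OF S c]]
  let ?i = "inv_into (fst c) (snd c)"
  have "((\<lambda>z. (f \<circ> ?i) (snd c (u z))) has_field_derivative
      (\<Sum>i\<in>UNIV. grad (f \<circ> ?i) (snd c (u z)) $ i * velocity c u z $ i)) (at z)"
  proof (rule holo_fun_curve)
    show "holo_fun (f \<circ> ?i) (snd c ` (fst c \<inter> W))"
      using f c unfolding holo_on_def by blast
  qed (use z velocity_has_derivative[OF S u c z(1)] in auto)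
  then show ?thesis unfolding chart_grad_def
    by (rule has_field_derivative_transform_within_open[OF _ chart_path_open[OF S u c]])
       (use z in \<open>auto simp: is_chart_inv[OF ch]\<close>)
qed

lemma holo_on_path_holomorphic:
  assumes S: "compact_complex_surface S" and u: "holo_path S u" and f: "holo_on S f W"
  shows "(\<lambda>z. f (u z)) holomorphic_on {z. u z \<in> W}"
  unfolding holomorphic_on_def
proof (intro ballI)
  fix z assume z: "z \<in> {z. u z \<in> W}"
  obtain c where c: "c \<in> charts S" "u z \<in> fst c"
    using chart_cover[OF S holo_path_topspace[OF u]] by blast
  show "(\<lambda>z. f (u z)) field_differentiable at z within {z. u z \<in> W}"
    by (rule field_differentiable_at_within, unfold field_differentiable_def)
       (use holo_on_path_derivative[OF S u c(1) f c(2)] z in blast)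
qed

lemma chart_grad_continuous:
  assumes S: "compact_complex_surface S" and u: "holo_path S u" and c: "c \<in> charts S" and f: "holo_on S f W"
  shows "continuous_on {z. u z \<in> fst c \<inter> W} (\<lambda>z. chart_grad c f (u z))"
  unfolding chart_grad_def
proof (rule continuous_on_compose2[OF holo_fun_continuous_grad])
  show "holo_fun (f \<circ> inv_into (fst c) (snd c)) (snd c ` (fst c \<inter> W))"
    using f c unfolding holo_on_def by blast
  show "continuous_on {z. u z \<in> fst c \<inter> W} (\<lambda>z. snd c (u z))"
    by (rule continuous_on_subset[OF chart_path_continuous[OF S u c]]) auto
qed auto

lemma velocity_change:
  assumes S: "compact_complex_surface S" and u: "holo_path S u" and c: "c \<in> charts S" "c' \<in> charts S"
    and z: "u z \<in> fst c" "u z \<in> fst c'"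
  shows "velocity c u z = chart_jac c c' (u z) *v velocity c' u z"
proof -
  note ch = holo_chart_is_chart[OF charts_holo_chart[OF S c(1)]]
  note ch' = holo_chart_is_chart[OF charts_holo_chart[OF S c(2)]]
  have hm: "holo_map (coord_change c c') (snd c' ` (fst c \<inter> fst c'))"
    by (rule compatible_change(1)[OF holo_chart_compatible[OF charts_holo_chart[OF S c(1)] c(2)]])
  show ?thesis
  proof (rule vec_eq_iff[THEN iffD2], rule allI)
    fix i
    have "((\<lambda>z. coord_change c c' (snd c' (u z)) $ i) has_field_derivative
        (\<Sum>j\<in>UNIV. grad (\<lambda>z. coord_change c c' z $ i) (snd c' (u z)) $ j * velocity c' u z $ j)) (at z)"
      by (rule holo_fun_curve[where f = "\<lambda>z. coord_change c c' z $ i"])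
         (use hm z velocity_has_derivative[OF S u c(2) z(2)] in \<open>auto simp: holo_map_def\<close>)
    then have "((\<lambda>z. snd c (u z) $ i) has_field_derivative
        (\<Sum>j\<in>UNIV. grad (\<lambda>z. coord_change c c' z $ i) (snd c' (u z)) $ j * velocity c' u z $ j)) (at z)"
      by (rule has_field_derivative_transform_within_open[OF _ chart_path_open[OF S u c(2)]])
         (use z in \<open>auto simp: coord_change_apply[OF ch']\<close>)
    then have "velocity c u z $ i = (\<Sum>j\<in>UNIV. grad (\<lambda>z. coord_change c c' z $ i) (snd c' (u z)) $ j * velocity c' u z $ j)"
      using DERIV_unique velocity_has_derivative[OF S u c(1) z(1)] by blast
    then show "velocity c u z $ i = (chart_jac c c' (u z) *v velocity c' u z) $ i"
      using z by (simp add: matrix_vector_mult_def chart_jac_def holo_map_derivative(2)[OF hm])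
  qed
qed

lemma chart_jac_continuous:
  assumes S: "compact_complex_surface S" and u: "holo_path S u" and c: "c \<in> charts S" "c' \<in> charts S"
  shows "continuous_on {z. u z \<in> fst c \<inter> fst c'} (\<lambda>z. det (chart_jac c c' (u z)))"
proof -
  have hm: "holo_map (coord_change c c') (snd c' ` (fst c \<inter> fst c'))"
    by (rule compatible_change(1)[OF holo_chart_compatible[OF charts_holo_chart[OF S c(1)] c(2)]])
  have "continuous_on (snd c' ` (fst c \<inter> fst c')) (\<lambda>w. det (jacobian (coord_change c c') w))"
    unfolding det_2 by (intro continuous_intros holo_map_continuous_jacobian[OF hm])
  then show ?thesis unfolding chart_jac_def
  proof (rule continuous_on_compose2)
    show "continuous_on {z. u z \<in> fst c \<inter> fst c'} (\<lambda>z. snd c' (u z))"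
      by (rule continuous_on_subset[OF chart_path_continuous[OF S u c(2)]]) auto
  qed auto
qed

section \<open>The conormal factor of an immersed curve\<close>

text \<open>Continuity is local, and in each chart it is continuity of a differentiable function.\<close>

lemma holo_on_continuous_map:
  assumes S: "compact_complex_surface S" and f: "holo_on S f W"
  shows "continuous_map (subtopology (space_of S) W) euclidean f"
proof (rule pasting_lemma[of "charts S" _ "\<lambda>c. W \<inter> fst c" _ "\<lambda>c. f"])
  fix c assume c: "c \<in> charts S"
  note ch = holo_chart_is_chart[OF charts_holo_chart[OF S c]]
  have U: "openin (space_of S) (fst c)" using ch unfolding is_chart_def by blast
  show "openin (subtopology (space_of S) W) (W \<inter> fst c)"
    by (rule openin_subtopology_Int2[OF U])
  show "continuous_map (subtopology (subtopology (space_of S) W) (W \<inter> fst c)) euclidean f"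
  proof -
    have "continuous_map (subtopology (space_of S) (fst c)) (top_of_set (snd c ` fst c)) (snd c)"
      using ch homeomorphic_imp_continuous_map unfolding is_chart_def by blast
    then have "continuous_map (subtopology (space_of S) (fst c)) euclidean (snd c)"
      using continuous_map_in_subtopology by blast
    then have "continuous_map (subtopology (space_of S) (W \<inter> fst c)) euclidean (snd c)"
      by (rule continuous_map_from_subtopology_mono) blast
    moreover have "snd c ` (W \<inter> fst c) = snd c ` (fst c \<inter> W)" by auto
    ultimately have 1: "continuous_map (subtopology (space_of S) (W \<inter> fst c)) (top_of_set (snd c ` (fst c \<inter> W))) (snd c)"
      by (auto simp: continuous_map_in_subtopology)
    have "continuous_on (snd c ` (fst c \<inter> W)) (f \<circ> inv_into (fst c) (snd c))"
      by (rule holo_fun_continuous) (use f c in \<open>auto simp: holo_on_def\<close>)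
    then have 2: "continuous_map (top_of_set (snd c ` (fst c \<inter> W))) euclidean (f \<circ> inv_into (fst c) (snd c))"
      by (simp add: continuous_map_iff_continuous)
    have "continuous_map (subtopology (space_of S) (W \<inter> fst c)) euclidean ((f \<circ> inv_into (fst c) (snd c)) \<circ> snd c)"
      by (rule continuous_map_compose[OF 1 2])
    then have "continuous_map (subtopology (space_of S) (W \<inter> fst c)) euclidean f"
      by (rule continuous_map_eq) (auto simp: is_chart_inv[OF ch])
    moreover have "W \<inter> (W \<inter> fst c) = W \<inter> fst c" by blast
    ultimately show ?thesis by (simp add: subtopology_subtopology)
  qed
next
  fix x assume "x \<in> topspace (subtopology (space_of S) W)"
  then have "x \<in> topspace (space_of S)" "x \<in> W" by auto
  then show "\<exists>c. c \<in> charts S \<and> x \<in> W \<inter> fst c \<and> f x = f x" using chart_cover[OF S] by blast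
qed simp_all

lemma local_equation_divides:
  assumes "local_equation S D V f" "holo_on S G W" "\<And>y. y \<in> W \<inter> D \<Longrightarrow> G y = 0" "x \<in> V" "x \<in> W"
  obtains W' q where "x \<in> W'" "W' \<subseteq> V \<inter> W" "holo_on S q W'" "\<And>y. y \<in> W' \<Longrightarrow> G y = q y * f y"
proof -
  have "\<forall>x\<in>V. \<forall>W G. x \<in> W \<and> holo_on S G W \<and> (\<forall>y \<in> W \<inter> D. G y = 0) \<longrightarrow>
        (\<exists>W' q. x \<in> W' \<and> W' \<subseteq> V \<inter> W \<and> holo_on S q W' \<and> (\<forall>y\<in>W'. G y = q y * f y))"
    using assms(1) unfolding local_equation_def by blast
  then have "\<exists>W' q. x \<in> W' \<and> W' \<subseteq> V \<inter> W \<and> holo_on S q W' \<and> (\<forall>y\<in>W'. G y = q y * f y)"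
    using assms(2-5) by blast
  then show ?thesis using that by blast
qed

lemma local_equation_holo: "local_equation S D V f \<Longrightarrow> holo_on S f V"
  unfolding local_equation_def by blast

lemma local_equation_vanishes: "local_equation S D V f \<Longrightarrow> x \<in> V \<Longrightarrow> x \<in> D \<Longrightarrow> f x = 0"
  unfolding local_equation_def by blast

text \<open>If a covector \<open>df = (g\<^sub>1, g\<^sub>2)\<close> vanishes on the velocity \<open>v \<noteq> 0\<close> of a curve, then
  it is a multiple of \<open>det(v, _) = (- v\<^sub>2, v\<^sub>1)\<close>. The formula extracts the factor by
  pairing with the conjugate of \<open>v\<close>, so that it is continuous and does not depend on a
  choice of a component \<open>v\<^sub>i \<noteq> 0\<close>.\<close>

definition conormal :: "'a chart2 \<Rightarrow> ('a \<Rightarrow> complex) \<Rightarrow> (complex \<Rightarrow> 'a) \<Rightarrow> complex \<Rightarrow> complex" where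
  "conormal c f u z = (chart_grad c f (u z) $ 2 * cnj (velocity c u z $ 1) - chart_grad c f (u z) $ 1 * cnj (velocity c u z $ 2)) /
     (velocity c u z $ 1 * cnj (velocity c u z $ 1) + velocity c u z $ 2 * cnj (velocity c u z $ 2))"

lemma hermitian_nonzero:
  fixes v :: "complex^2"
  assumes "v \<noteq> 0"
  shows "v $ 1 * cnj (v $ 1) + v $ 2 * cnj (v $ 2) \<noteq> 0"
proof -
  have eq: "v $ 1 * cnj (v $ 1) + v $ 2 * cnj (v $ 2) = of_real ((norm (v $ 1))\<^sup>2 + (norm (v $ 2))\<^sup>2)"
    by (simp only: of_real_add complex_norm_square)
  have "v $ 1 \<noteq> 0 \<or> v $ 2 \<noteq> 0" using assms by (auto simp: vec_eq_iff forall_2)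
  then have "(norm (v $ 1))\<^sup>2 + (norm (v $ 2))\<^sup>2 \<noteq> 0"
    by (simp add: sum_power2_eq_zero_iff)
  then show ?thesis unfolding eq by (metis of_real_eq_0_iff)
qed

locale immersed_curve =
  fixes S :: "'a surface" and u :: "complex \<Rightarrow> 'a" and D :: "'a set"
  assumes S: "compact_complex_surface S" and u: "holo_path S u"
    and imm: "immersed_path S u" and uD: "u z \<in> D"
begin

lemma velocity_nonzero: "c \<in> charts S \<Longrightarrow> u z \<in> fst c \<Longrightarrow> velocity c u z \<noteq> 0"
  using imm unfolding immersed_path_def velocity_def by (fastforce simp: vec_eq_iff)

lemma conormal_eqI:
  assumes "c \<in> charts S" "u z \<in> fst c"
    and "chart_grad c f (u z) $ 1 = - m * velocity c u z $ 2" "chart_grad c f (u z) $ 2 = m * velocity c u z $ 1"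
  shows "conormal c f u z = m"
proof -
  have "conormal c f u z = m * (velocity c u z $ 1 * cnj (velocity c u z $ 1) + velocity c u z $ 2 * cnj (velocity c u z $ 2)) /
     (velocity c u z $ 1 * cnj (velocity c u z $ 1) + velocity c u z $ 2 * cnj (velocity c u z $ 2))"
    unfolding conormal_def assms(3,4) by (simp add: algebra_simps)
  then show ?thesis using hermitian_nonzero[OF velocity_nonzero[OF assms(1,2)]] by simp
qed

lemma conormal_char:
  assumes c: "c \<in> charts S" "u z \<in> fst c"
    and tan: "(\<Sum>i\<in>UNIV. chart_grad c f (u z) $ i * velocity c u z $ i) = 0"
  shows "chart_grad c f (u z) $ 1 = - conormal c f u z * velocity c u z $ 2" "chart_grad c f (u z) $ 2 = conormal c f u z * velocity c u z $ 1"
proof -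
  let ?g = "chart_grad c f (u z)" and ?v = "velocity c u z"
  let ?n = "?v $ 1 * cnj (?v $ 1) + ?v $ 2 * cnj (?v $ 2)"
  have n: "?n \<noteq> 0" by (rule hermitian_nonzero[OF velocity_nonzero[OF c]])
  have t: "?g $ 1 * ?v $ 1 = - ?g $ 2 * ?v $ 2" using tan by (simp add: sum_2 eq_neg_iff_add_eq_0)
  have "?g $ 1 * ?n = (?g $ 1 * ?v $ 1) * cnj (?v $ 1) + ?g $ 1 * ?v $ 2 * cnj (?v $ 2)" by (simp add: algebra_simps)
  also have "\<dots> = - (?g $ 2 * cnj (?v $ 1) - ?g $ 1 * cnj (?v $ 2)) * ?v $ 2"
    unfolding t by (simp add: algebra_simps)
  finally show "?g $ 1 = - conormal c f u z * ?v $ 2"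
    unfolding conormal_def using n by (simp add: field_simps)
  have "?g $ 2 * ?n = - (- ?g $ 2 * ?v $ 2) * cnj (?v $ 2) + ?g $ 2 * ?v $ 1 * cnj (?v $ 1)" by (simp add: algebra_simps)
  also have "\<dots> = (?g $ 2 * cnj (?v $ 1) - ?g $ 1 * cnj (?v $ 2)) * ?v $ 1"
    unfolding t[symmetric] by (simp add: algebra_simps)
  finally show "?g $ 2 = conormal c f u z * ?v $ 1"
    unfolding conormal_def using n by (simp add: field_simps)
qed

lemma conormal_nonzero:
  assumes c: "c \<in> charts S" "u z \<in> fst c"
    and tan: "(\<Sum>i\<in>UNIV. chart_grad c f (u z) $ i * velocity c u z $ i) = 0" and "chart_grad c f (u z) \<noteq> 0"
  shows "conormal c f u z \<noteq> 0"
  using conormal_char[OF assms(1-3)] assms(4) by (auto simp: vec_eq_iff forall_2)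

text \<open>\<open>f\<close> is constant along the curve, so its differential annihilates the velocity.\<close>

lemma tangent:
  assumes c: "c \<in> charts S" "u z \<in> fst c" and f: "holo_on S f W" "u z \<in> W"
    and N: "open N" "z \<in> N" "\<And>y. y \<in> N \<Longrightarrow> f (u y) = 0"
  shows "(\<Sum>i\<in>UNIV. chart_grad c f (u z) $ i * velocity c u z $ i) = 0"
proof -
  have "((\<lambda>z. f (u z)) has_field_derivative (\<Sum>i\<in>UNIV. chart_grad c f (u z) $ i * velocity c u z $ i)) (at z)"
    by (rule holo_on_path_derivative[OF S u c(1) f(1) c(2) f(2)])
  moreover have "((\<lambda>z. f (u z)) has_field_derivative 0) (at z)"
    by (rule has_field_derivative_transform_within_open[OF _ N(1,2)]) (use N(3) in auto)
  ultimately show ?thesis by (rule DERIV_unique)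
qed

lemma tangent_vanishing:
  assumes c: "c \<in> charts S" "u z \<in> fst c" and f: "holo_on S f W" "u z \<in> W" "\<And>y. y \<in> W \<inter> D \<Longrightarrow> f y = 0"
  shows "(\<Sum>i\<in>UNIV. chart_grad c f (u z) $ i * velocity c u z $ i) = 0"
  by (rule tangent[OF c f(1,2) holo_path_open[OF u holo_on_open[OF f(1)]]]) (use f uD in auto)

lemma conormal_continuous:
  assumes c: "c \<in> charts S" and f: "holo_on S f W"
  shows "continuous_on {z. u z \<in> fst c \<inter> W} (conormal c f u)"
proof -
  have v: "continuous_on {z. u z \<in> fst c \<inter> W} (\<lambda>z. velocity c u z $ i)" for i
    by (intro continuous_on_component continuous_on_subset[OF velocity_continuous[OF S u c]]) auto
  have g: "continuous_on {z. u z \<in> fst c \<inter> W} (\<lambda>z. chart_grad c f (u z) $ i)" for i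
    by (intro continuous_on_component chart_grad_continuous[OF S u c f])
  show ?thesis
    unfolding conormal_def[abs_def]
    by (intro continuous_on_divide continuous_on_diff continuous_on_add continuous_on_mult continuous_on_cnj v g)
       (use hermitian_nonzero[OF velocity_nonzero[OF c]] in auto)
qed

text \<open>The differential of \<open>f\<close> is the same functional in both charts, while \<open>det(u', _)\<close>
  acquires the determinant of the change of coordinates. Hence the conormal factor transforms like
  the inverse of a section of the determinant of the tangent bundle.\<close>

lemma conormal_change:
  assumes c: "c \<in> charts S" "u z \<in> fst c" and c': "c' \<in> charts S" "u z \<in> fst c'"
    and f: "holo_on S f W" "u z \<in> W" and tan: "(\<Sum>i\<in>UNIV. chart_grad c f (u z) $ i * velocity c u z $ i) = 0"
  shows "conormal c' f u z = det (chart_jac c c' (u z)) * conormal c f u z"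
proof (rule conormal_eqI[OF c'])
  note ch = charts_holo_chart[OF S c(1)] charts_holo_chart[OF S c'(1)]
  note g = chart_grad_change[OF S f(1) ch holo_chart_compatible[OF ch(1) c'(1)] c(2) c'(2) f(2)]
  have v: "velocity c u z $ i = (\<Sum>j\<in>UNIV. chart_jac c c' (u z) $ i $ j * velocity c' u z $ j)" for i
    using velocity_change[OF S u c(1) c'(1) c(2) c'(2)] by (simp add: matrix_vector_mult_def)
  note l = conormal_char[OF c tan]
  show "chart_grad c' f (u z) $ 1 = - (det (chart_jac c c' (u z)) * conormal c f u z) * velocity c' u z $ 2"
    unfolding g det_2 sum_2 l unfolding v sum_2 by (simp add: algebra_simps)
  show "chart_grad c' f (u z) $ 2 = det (chart_jac c c' (u z)) * conormal c f u z * velocity c' u z $ 1"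
    unfolding g det_2 sum_2 l unfolding v sum_2 by (simp add: algebra_simps)
qed

text \<open>At a zero of \<open>g\<close> the product rule reduces to \<open>d(q g) = q dg\<close>.\<close>

lemma conormal_mult:
  assumes c: "c \<in> charts S" "u z \<in> fst c" and q: "holo_on S q W" and g: "holo_on S g W"
    and z: "u z \<in> W" "g (u z) = 0" and f: "\<And>y. y \<in> W \<Longrightarrow> f y = q y * g y"
  shows "conormal c f u z = q (u z) * conormal c g u z"
proof -
  have "chart_grad c f (u z) = q (u z) *s chart_grad c g (u z) + g (u z) *s chart_grad c q (u z)"
    by (rule chart_grad_mult[OF S q g charts_holo_chart[OF S c(1)] c(2) z(1) f])
  then show ?thesis unfolding conormal_def z(2) by (simp add: algebra_simps)
qed

end

text \<open>Such points are those at which the conormal factor of a local equation of \<open>D\<close> does not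
  vanish: \<open>G\<close> is a multiple of the local equation, whose differential is therefore nonzero as
  well.\<close>

definition smooth_at :: "'a surface \<Rightarrow> 'a set \<Rightarrow> 'a \<Rightarrow> bool" where
  "smooth_at S D x \<longleftrightarrow> (\<exists>G W c. x \<in> W \<and> holo_on S G W \<and> (\<forall>y \<in> W \<inter> D. G y = 0) \<and>
     c \<in> charts S \<and> x \<in> fst c \<and> chart_grad c G x \<noteq> 0)"

lemma chart_grad_zero:
  assumes c: "is_chart X c" and N: "openin X N" "x \<in> fst c" "x \<in> N" "\<And>y. y \<in> N \<Longrightarrow> G y = 0"
  shows "chart_grad c G x = 0"
proof -
  have "chart_grad c G x = grad (\<lambda>z. 0) (snd c x)"
    unfolding chart_grad_def
    by (rule grad_cong[OF is_chart_open_image[OF c N(1)]]) (use N in \<open>auto simp: is_chart_inv[OF c]\<close>)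
  also have "\<dots> = 0" by (rule grad_eqI) simp
  finally show ?thesis .
qed

lemma (in immersed_curve) conormal_regular_nonzero:
  assumes sm: "smooth_at S D (u z)" and f: "local_equation S D V f" "u z \<in> V"
    and c: "c \<in> charts S" "u z \<in> fst c"
  shows "conormal c f u z \<noteq> 0"
proof -
  obtain G W c' where G: "u z \<in> W" "holo_on S G W" "\<And>y. y \<in> W \<inter> D \<Longrightarrow> G y = 0"
    "c' \<in> charts S" "u z \<in> fst c'" "chart_grad c' G (u z) \<noteq> 0"
    using sm unfolding smooth_at_def by blast
  obtain W' q where W': "u z \<in> W'" "W' \<subseteq> V \<inter> W" "holo_on S q W'" "\<And>y. y \<in> W' \<Longrightarrow> G y = q y * f y"
    using local_equation_divides[OF f(1) G(2,3) f(2) G(1)] by blast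
  have f': "holo_on S f W'"
    using holo_on_subset[OF S local_equation_holo[OF f(1)] holo_on_open[OF W'(3)]] W'(2) by blast
  have "conormal c' G u z = q (u z) * conormal c' f u z"
    by (rule conormal_mult[OF G(4,5) W'(3) f' W'(1) local_equation_vanishes[OF f uD] W'(4)])
  moreover have "conormal c' G u z \<noteq> 0"
    by (rule conormal_nonzero[OF G(4,5) tangent_vanishing[OF G(4,5,2,1,3)] G(6)])
  moreover have "conormal c' f u z = det (chart_jac c c' (u z)) * conormal c f u z"
    by (rule conormal_change[OF c G(4,5) local_equation_holo[OF f(1)] f(2)
      tangent_vanishing[OF c local_equation_holo[OF f(1)] f(2)]])
      (use local_equation_vanishes[OF f(1)] in blast)
  ultimately show ?thesis by auto
qed

text \<open>A continuous quotient is determined where the denominator is nonzero. If two quotients differed at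
  \<open>x\<close>, then \<open>g\<close> would vanish on a neighbourhood of \<open>x\<close>, and so would every
  function that vanishes on \<open>D\<close>; but one of them has a nonzero differential at
  \<open>x\<close>.\<close>

lemma ratio_at_eq:
  assumes S: "compact_complex_surface S" and sm: "smooth_at S D x"
    and g: "local_equation S D W g" "x \<in> W"
    and h: "holo_on S h N" "x \<in> N" "\<And>y. y \<in> N \<Longrightarrow> f y = h y * g y"
  shows "ratio_at (space_of S) f g x = h x"
  unfolding ratio_at_def
proof (rule the_equality)
  let ?X = "space_of S"
  show "\<exists>W q. openin ?X W \<and> x \<in> W \<and> continuous_map (subtopology ?X W) euclidean q \<and>
      (\<forall>y\<in>W. f y = q y * g y) \<and> q x = h x"
    using holo_on_open[OF h(1)] holo_on_continuous_map[OF S h(1)] h by blast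
  fix l assume "\<exists>W q. openin ?X W \<and> x \<in> W \<and> continuous_map (subtopology ?X W) euclidean q \<and>
      (\<forall>y\<in>W. f y = q y * g y) \<and> q x = l"
  then obtain V q where q: "openin ?X V" "x \<in> V" "continuous_map (subtopology ?X V) euclidean q"
    "\<And>y. y \<in> V \<Longrightarrow> f y = q y * g y" "q x = l" by blast
  show "l = h x"
  proof (rule ccontr)
    assume ne: "l \<noteq> h x"
    obtain G U c where G: "x \<in> U" "holo_on S G U" "\<And>y. y \<in> U \<inter> D \<Longrightarrow> G y = 0"
      "c \<in> charts S" "x \<in> fst c" "chart_grad c G x \<noteq> 0"
      using sm unfolding smooth_at_def by blast
    obtain W' k where W': "x \<in> W'" "W' \<subseteq> W \<inter> U" "holo_on S k W'" "\<And>y. y \<in> W' \<Longrightarrow> G y = k y * g y"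
      using local_equation_divides[OF g(1) G(2,3) g(2) G(1)] by blast
    let ?V = "V \<inter> N \<inter> W'"
    have op: "openin ?X ?V" by (intro openin_Int q holo_on_open[OF h(1)] holo_on_open[OF W'(3)])
    have "continuous_map (subtopology ?X ?V) euclidean q"
      by (rule continuous_map_from_subtopology_mono[OF q(3)]) blast
    moreover have "continuous_map (subtopology ?X ?V) euclidean h"
      by (rule continuous_map_from_subtopology_mono[OF holo_on_continuous_map[OF S h(1)]]) blast
    ultimately have "continuous_map (subtopology ?X ?V) euclidean (\<lambda>y. q y - h y)"
      by (rule continuous_map_diff)
    from openin_continuous_map_preimage[OF this, of "- {0}"]
    have "openin (subtopology ?X ?V) {y \<in> topspace (subtopology ?X ?V). q y - h y \<in> - {0}}"
      by (simp add: open_Compl)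
    then have opN: "openin ?X {y \<in> topspace (subtopology ?X ?V). q y - h y \<in> - {0}}"
      using op openin_trans_full by blast
    have "chart_grad c G x = 0"
    proof (rule chart_grad_zero[OF holo_chart_is_chart[OF charts_holo_chart[OF S G(4)]] opN G(5)])
      show "x \<in> {y \<in> topspace (subtopology ?X ?V). q y - h y \<in> - {0}}"
        using ne q(1,2,5) h(2) W'(1) openin_subset by auto
      fix y assume "y \<in> {y \<in> topspace (subtopology ?X ?V). q y - h y \<in> - {0}}"
      then have y: "y \<in> V" "y \<in> N" "y \<in> W'" "q y \<noteq> h y" by auto
      then have "g y = 0" using q(4)[of y] h(3)[of y] by simp
      then show "G y = 0" using W'(4) y by simp
    qed
    then show False using G(6) by simp
  qed
qed

lemma (in immersed_curve) conormal_ratio: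
  assumes sm: "smooth_at S D (u z)" and f: "local_equation S D V f" "u z \<in> V"
    and g: "local_equation S D W g" "u z \<in> W" and c: "c \<in> charts S" "u z \<in> fst c"
  shows "conormal c f u z = ratio_at (space_of S) f g (u z) * conormal c g u z"
proof -
  obtain N h where N: "u z \<in> N" "N \<subseteq> W \<inter> V" "holo_on S h N" "\<And>y. y \<in> N \<Longrightarrow> f y = h y * g y"
    using local_equation_divides[OF g(1) local_equation_holo[OF f(1)] _ g(2) f(2)]
      local_equation_vanishes[OF f(1)] by blast
  have "ratio_at (space_of S) f g (u z) = h (u z)"
    by (rule ratio_at_eq[OF S sm g N(3,1,4)])
  moreover have "holo_on S g N"
    using holo_on_subset[OF S local_equation_holo[OF g(1)] holo_on_open[OF N(3)]] N(2) by blast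
  from conormal_mult[OF c N(3) this N(1) local_equation_vanishes[OF g uD] N(4)]
  have "conormal c f u z = h (u z) * conormal c g u z" .
  ultimately show ?thesis by simp
qed

section \<open>Smooth points and nodes of rational curves\<close>

lemma holo_fun_diff:
  assumes "holo_fun f W" "holo_fun g W"
  shows "holo_fun (\<lambda>z. f z - g z) W"
    and "z \<in> W \<Longrightarrow> grad (\<lambda>z. f z - g z) z = grad f z - grad g z"
proof -
  have D: "((\<lambda>z. f z - g z) has_derivative (\<lambda>h. \<Sum>i\<in>UNIV. (grad f z - grad g z) $ i * h $ i)) (at z)"
    if "z \<in> W" for z
  proof -
    have "((\<lambda>z. f z - g z) has_derivative (\<lambda>h. (\<Sum>i\<in>UNIV. grad f z $ i * h $ i) - (\<Sum>i\<in>UNIV. grad g z $ i * h $ i))) (at z)"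
      by (intro has_derivative_diff holo_fun_has_derivative[OF _ that] assms)
    then show ?thesis by (simp add: sum_2 algebra_simps)
  qed
  have "continuous_on W (\<lambda>z. grad f z - grad g z)"
    by (intro continuous_intros holo_fun_continuous_grad assms)
  then show "holo_fun (\<lambda>z. f z - g z) W"
    unfolding holo_fun_def using D holo_fun_open[OF assms(1)] by blast
  show "z \<in> W \<Longrightarrow> grad (\<lambda>z. f z - g z) z = grad f z - grad g z"
    by (rule grad_eqI[OF D])
qed

lemma holo_fun_of_coordinate:
  assumes k: "k holomorphic_on B" and B: "open B"
  shows "holo_fun (\<lambda>w. k (w $ l)) {w. w $ l \<in> B}"
    and "w $ l \<in> B \<Longrightarrow> grad (\<lambda>w. k (w $ l)) w = deriv k (w $ l) *s axis l 1"
proof -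
  have op: "open {w :: complex^2. w $ l \<in> B}"
    using B by (intro open_vimage_vec_nth[unfolded vimage_def])
  have D: "((\<lambda>w. k (w $ l)) has_derivative (\<lambda>h. \<Sum>i\<in>UNIV. (deriv k (w $ l) *s axis l 1) $ i * h $ i)) (at w)"
    if "w $ l \<in> B" for w :: "complex^2"
  proof -
    have "(k has_derivative (*) (deriv k (w $ l))) (at (w $ l))"
      using holomorphic_derivI[OF k B that] by (simp add: has_field_derivative_def)
    from diff_chain_at[OF bounded_linear_imp_has_derivative[OF bounded_linear_vec_nth] this]
    have 1: "((\<lambda>w. k (w $ l)) has_derivative (\<lambda>h. deriv k (w $ l) * h $ l)) (at w)"
      by (simp add: o_def)
    have "(\<Sum>i\<in>UNIV. (deriv k (w $ l) *s axis l 1) $ i * h $ i) = (\<Sum>i\<in>UNIV. if i = l then deriv k (w $ l) * h $ i else 0)"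
      for h :: "complex^2"
      by (rule sum.cong) (auto simp: axis_def)
    then show ?thesis using 1 by simp
  qed
  show "w $ l \<in> B \<Longrightarrow> grad (\<lambda>w. k (w $ l)) w = deriv k (w $ l) *s axis l 1"
    by (rule grad_eqI[OF D])
  have "continuous_on {w :: complex^2. w $ l \<in> B} (\<lambda>w. deriv k (w $ l))"
    by (rule continuous_on_compose2[OF holomorphic_on_imp_continuous_on[OF holomorphic_deriv[OF k B]]])
       (auto intro!: continuous_intros)
  then have "continuous_on {w :: complex^2. w $ l \<in> B} (\<lambda>w. \<chi> i. deriv k (w $ l) * axis l 1 $ i)"
    by (intro continuous_on_vec_lambda continuous_on_mult continuous_on_const)
  moreover have "(\<lambda>w :: complex^2. \<chi> i. deriv k (w $ l) * axis l 1 $ i) = (\<lambda>w. deriv k (w $ l) *s (axis l 1 :: complex^2))"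
    by (simp add: fun_eq_iff vec_eq_iff)
  ultimately show "holo_fun (\<lambda>w. k (w $ l)) {w. w $ l \<in> B}"
    unfolding holo_fun_def using op D by auto
qed

text \<open>The image of the complement of a disc is compact. So a point of the curve that is attained only
  inside the disc has a neighbourhood in which the curve is the image of the disc.\<close>

lemma compact_complement_of_disc:
  assumes S: "compact_complex_surface S" and F: "normalization S F D" and B: "open B"
  shows "openin (space_of S) (topspace (space_of S) - F ` (- Some ` B))"
proof -
  let ?X = "space_of S"
  let ?C = "{w. w \<noteq> 0 \<and> inverse w \<in> B}"
  have c0: "continuous_map euclidean ?X (F \<circ> Some)" and c1: "continuous_map euclidean ?X (F \<circ> aff_inf)"
    using F unfolding normalization_def holo_path_def by auto
  have "open ((- {0::complex}) \<inter> inverse -` B)"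
    by (rule continuous_open_preimage) (use B in \<open>auto intro!: continuous_intros\<close>)
  moreover have "(- {0::complex}) \<inter> inverse -` B = ?C" by auto
  ultimately have C: "open ?C" by simp
  have eq: "F ` (- Some ` B) = (F \<circ> Some) ` (cball 0 1 - B) \<union> (F \<circ> aff_inf) ` (cball 0 1 - ?C)"
  proof (intro equalityI subsetI)
    fix x assume "x \<in> F ` (- Some ` B)"
    then obtain p where p: "x = F p" "p \<notin> Some ` B" by auto
    show "x \<in> (F \<circ> Some) ` (cball 0 1 - B) \<union> (F \<circ> aff_inf) ` (cball 0 1 - ?C)"
    proof (cases p)
      case None
      then have "x = (F \<circ> aff_inf) 0" using p by (simp add: aff_inf_def)
      then show ?thesis by auto
    next
      case (Some z)
      show ?thesis
      proof (cases "norm z \<le> 1")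
        case True
        then show ?thesis using p Some by auto
      next
        case False
        then have z: "z \<noteq> 0" "norm (inverse z) \<le> 1" by (auto simp: norm_inverse inverse_le_1_iff)
        then have "x = (F \<circ> aff_inf) (inverse z)" using p Some by (simp add: aff_inf_inverse)
        moreover have "inverse z \<in> cball 0 1 - ?C" using z p Some by auto
        ultimately show ?thesis by blast
      qed
    qed
  next
    fix x assume "x \<in> (F \<circ> Some) ` (cball 0 1 - B) \<union> (F \<circ> aff_inf) ` (cball 0 1 - ?C)"
    then show "x \<in> F ` (- Some ` B)" by (auto simp: aff_inf_def split: if_splits)
  qed
  have k0: "compactin ?X ((F \<circ> Some) ` (cball 0 1 - B))"
    by (rule image_compactin[OF _ c0]) (use B in \<open>simp add: compact_diff\<close>)
  have k1: "compactin ?X ((F \<circ> aff_inf) ` (cball 0 1 - ?C))"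
    by (rule image_compactin[OF _ c1]) (use C in \<open>simp add: compact_diff\<close>)
  have "Hausdorff_space ?X" using S unfolding compact_complex_surface_def by blast
  from compactin_imp_closedin[OF this compactin_Un[OF k0 k1]]
  have "closedin ?X (F ` (- Some ` B))" unfolding eq .
  then show ?thesis by blast
qed

text \<open>By the inverse function theorem in one variable, the image of a small disc around \<open>z0\<close> is
  the graph of one coordinate as a function of the other. No other part of the curve comes close to
  \<open>F (Some z0)\<close>, so the equation of the graph vanishes on the whole curve nearby.\<close>

lemma smooth_at_injective_point:
  assumes S: "compact_complex_surface S" and F: "normalization S F D" and imm: "immersion S F"
    and z0: "\<And>q. q \<noteq> Some z0 \<Longrightarrow> F q \<noteq> F (Some z0)"
  shows "smooth_at S D (F (Some z0))"
proof -
  define u where "u = F \<circ> Some"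
  have u: "holo_path S u" and im: "immersed_path S u" and D: "D = range F"
    using F imm unfolding normalization_def immersion_def u_def by auto
  obtain c where c: "c \<in> charts S" "u z0 \<in> fst c"
    using chart_cover[OF S holo_path_topspace[OF u]] by blast
  note hc = charts_holo_chart[OF S c(1)]
  note ch = holo_chart_is_chart[OF hc]
  define T where "T = {z. u z \<in> fst c}"
  have T: "open T" "z0 \<in> T" unfolding T_def using chart_path_open[OF S u c(1)] c(2) by auto
  obtain i where i: "deriv (\<lambda>z. snd c (u z) $ i) z0 \<noteq> 0"
    using im c unfolding immersed_path_def by blast
  obtain j :: 2 where j: "j \<noteq> i" by (metis exhaust_2 num1_eq1 one_neq_zero zero_neq_one)
  define a where "a = (\<lambda>z. snd c (u z) $ i)"
  define b where "b = (\<lambda>z. snd c (u z) $ j)"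
  have a: "a holomorphic_on T" and b: "b holomorphic_on T"
    using u c(1) unfolding holo_path_def a_def b_def T_def by blast+
  obtain r where r: "r > 0" "ball z0 r \<subseteq> T" "open (a ` ball z0 r)" "inj_on a (ball z0 r)"
    by (rule has_complex_derivative_locally_invertible[OF a T(2,1) i[folded a_def]])
  define B where "B = ball z0 r"
  have "\<exists>g. g holomorphic_on (a ` ball z0 r) \<and> (\<forall>z\<in>ball z0 r. g (a z) = z)"
    by (rule holomorphic_has_inverse[OF holomorphic_on_subset[OF a r(2)] open_ball r(4)]) blast
  then obtain g where g: "g holomorphic_on (a ` B)" "\<And>z. z \<in> B \<Longrightarrow> g (a z) = z" unfolding B_def by blast
  have gB: "g ` (a ` B) \<subseteq> T" using g(2) r(2) unfolding B_def by auto
  have k: "(b \<circ> g) holomorphic_on (a ` B)"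
    by (rule holomorphic_on_compose_gen[OF g(1) b gB])
  define \<Omega> where "\<Omega> = {w :: complex^2. w $ i \<in> a ` B}"
  have aB: "open (a ` B)" using r(3) unfolding B_def .
  (* the equation of the graph: j-th coordinate minus its value as a function of the i-th *)
  define \<gamma> where "\<gamma> = (\<lambda>w. w $ j - (b \<circ> g) (w $ i))"
  note h1 = holo_fun_of_coordinate[OF k aB, where l = i, folded \<Omega>_def]
  have op\<Omega>: "open \<Omega>" using holo_fun_open[OF h1(1)] .
  note h2 = holo_fun_nth(1)[OF op\<Omega>, where k = j]
  have \<gamma>: "holo_fun \<gamma> \<Omega>" unfolding \<gamma>_def by (rule holo_fun_diff(1)[OF h2 h1(1)])
  have \<gamma>': "grad \<gamma> w $ j = 1" if "w \<in> \<Omega>" for w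
  proof -
    have "w $ i \<in> a ` B" using that unfolding \<Omega>_def by simp
    then show ?thesis
      unfolding \<gamma>_def using holo_fun_diff(2)[OF h2 h1(1) that] h1(2) holo_fun_nth(2)[OF op\<Omega>, where k = j] j
      by (simp add: axis_def)
  qed
  let ?N = "topspace (space_of S) - F ` (- Some ` B)"
  let ?U = "{x \<in> fst c. snd c x \<in> \<Omega>}"
  define W where "W = ?U \<inter> ?N"
  have N: "openin (space_of S) ?N" by (rule compact_complement_of_disc[OF S F]) (simp add: B_def)
  have GU: "holo_on S (\<lambda>x. \<gamma> (snd c x)) ?U" by (rule holo_on_pullback[OF S hc \<gamma>])
  have W: "openin (space_of S) W" unfolding W_def by (intro openin_Int N holo_on_open[OF GU])
  have GW: "holo_on S (\<lambda>x. \<gamma> (snd c x)) W"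
    by (rule holo_on_subset[OF S GU W]) (auto simp: W_def)
  have xW: "u z0 \<in> W"
  proof -
    have "z0 \<in> B" using r(1) unfolding B_def by simp
    then have "snd c (u z0) \<in> \<Omega>" unfolding \<Omega>_def a_def by auto
    moreover have "u z0 \<notin> F ` (- Some ` B)" using z0 \<open>z0 \<in> B\<close> unfolding u_def by force
    ultimately show ?thesis unfolding W_def using c(2) holo_path_topspace[OF u] by simp
  qed
  have van: "\<gamma> (snd c y) = 0" if y: "y \<in> W \<inter> D" for y
  proof -
    obtain p where p: "y = F p" using y D by auto
    then have "p \<in> Some ` B" using y unfolding W_def by auto
    then obtain z where z: "z \<in> B" "y = u z" using p unfolding u_def by auto
    have "g (a z) = z" using g(2) z by blast
    then show ?thesis unfolding \<gamma>_def z(2) by (simp add: a_def b_def)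
  qed
  have "chart_grad c (\<lambda>x. \<gamma> (snd c x)) (u z0) = grad \<gamma> (snd c (u z0))"
    unfolding chart_grad_def
    by (rule grad_cong[OF is_chart_open_image[OF ch W]])
       (use c(2) xW in \<open>auto simp: is_chart_inv[OF ch]\<close>)
  moreover have "snd c (u z0) \<in> \<Omega>" using xW unfolding W_def by simp
  ultimately have "chart_grad c (\<lambda>x. \<gamma> (snd c x)) (u z0) $ j = 1" using \<gamma>' by simp
  then have "chart_grad c (\<lambda>x. \<gamma> (snd c x)) (u z0) \<noteq> 0" by auto
  then have "smooth_at S D (u z0)" unfolding smooth_at_def using xW GW van c by blast
  then show ?thesis unfolding u_def by simp
qed

lemma Schwarz_scaled:
  assumes h: "h holomorphic_on ball 0 r" "h 0 = 0" and r: "r > 0"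
    and M: "\<And>z. norm z < r \<Longrightarrow> norm (h z) < M" and z: "norm z < r"
  shows "norm (h z) \<le> M * norm z / r"
proof -
  have M0: "M > 0" using M[of 0] r h(2) by simp
  let ?k = "\<lambda>w. h (of_real r * w) / of_real M"
  have "norm (?k (z / of_real r)) \<le> norm (z / of_real r)"
  proof (rule Schwarz_Lemma(1))
    have "(h \<circ> (\<lambda>w. of_real r * w)) holomorphic_on ball 0 1"
      by (rule holomorphic_on_compose_gen[OF _ h(1)])
         (use r in \<open>auto intro!: holomorphic_intros simp: norm_mult\<close>)
    then show "?k holomorphic_on ball 0 1"
      using M0 by (auto intro!: holomorphic_intros simp: o_def)
    show "norm (?k w) < 1" if "norm w < 1" for w
      using M[of "of_real r * w"] that r M0 by (simp add: norm_mult norm_divide)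
    show "norm (z / of_real r) < 1" using z r by (simp add: norm_divide)
  qed (use h in simp)
  then show ?thesis using r M0 by (simp add: norm_divide field_simps)
qed

definition vec2 :: "complex \<Rightarrow> complex \<Rightarrow> complex^2" where
  "vec2 s t = (\<chi> i. if i = 1 then s else t)"

lemma vec2_nth [simp]: "vec2 s t $ 1 = s" "vec2 s t $ 2 = t"
  by (simp_all add: vec2_def)

lemma norm_vec2_le: "norm (vec2 s t) \<le> norm s + norm t"
proof -
  have "norm (vec2 s t) \<le> (\<Sum>i\<in>UNIV. norm (vec2 s t $ i))"
    unfolding norm_vec_def by (rule L2_set_le_sum) simp
  then show ?thesis by (simp add: sum_2)
qed

text \<open>Schwarz's lemma, applied first in one variable and then in the other. The estimate stands in for
  the divisibility of \<open>f\<close> by the product of the coordinates.\<close>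

lemma vanishing_on_axes_bound:
  assumes f: "holo_fun f W" and W: "0 \<in> W"
    and ax: "\<And>w. w \<in> W \<Longrightarrow> w $ 1 = 0 \<or> w $ 2 = 0 \<Longrightarrow> f w = 0"
  obtains C r where "r > 0" "C > 0"
    "\<And>s t. norm s < r \<Longrightarrow> norm t < r \<Longrightarrow> vec2 s t \<in> W \<and> norm (f (vec2 s t)) \<le> C * (norm s * norm t)"
proof -
  obtain e where e: "e > 0" "cball 0 e \<subseteq> W"
    using holo_fun_open[OF f] W open_contains_cball by blast
  have "compact (f ` cball 0 e)"
    by (intro compact_continuous_image continuous_on_subset[OF holo_fun_continuous[OF f] e(2)]) simp
  then obtain M0 where M0: "\<And>w. w \<in> cball 0 e \<Longrightarrow> norm (f w) \<le> M0"
    using compact_imp_bounded bounded_iff by (metis imageI)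
  (* enlarged so that the bound is strict, as the Schwarz lemma demands *)
  define M where "M = \<bar>M0\<bar> + 1"
  have M: "norm (f w) < M" if "w \<in> cball 0 e" for w using M0[OF that] unfolding M_def by linarith
  have Mpos: "M > 0" unfolding M_def by simp
  define r where "r = e / 2"
  have r: "r > 0" using e unfolding r_def by simp
  have inb: "vec2 s t \<in> cball 0 e" if "norm s < r" "norm t < r" for s t
    using norm_vec2_le[of s t] that unfolding r_def by simp
  have d1: "((\<lambda>s. f (vec2 s t)) has_field_derivative (\<Sum>i\<in>UNIV. grad f (vec2 s t) $ i * axis 1 1 $ i)) (at s)"
    if "norm s < r" "norm t < r" for s t
  proof (rule holo_fun_curve[OF f])
    show "vec2 s t \<in> W" using inb[OF that] e(2) by blast
    show "((\<lambda>z. vec2 z t $ i) has_field_derivative axis 1 1 $ i) (at s)" for i :: 2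
      using exhaust_2[of i] by (auto simp: axis_def)
  qed
  have d2: "((\<lambda>t. f (vec2 s t)) has_field_derivative (\<Sum>i\<in>UNIV. grad f (vec2 s t) $ i * axis 2 1 $ i)) (at t)"
    if "norm s < r" "norm t < r" for s t
  proof (rule holo_fun_curve[OF f])
    show "vec2 s t \<in> W" using inb[OF that] e(2) by blast
    show "((\<lambda>z. vec2 s z $ i) has_field_derivative axis 2 1 $ i) (at t)" for i :: 2
      using exhaust_2[of i] by (auto simp: axis_def)
  qed
  have b1: "norm (f (vec2 s t)) \<le> M * norm s / r" if "norm s < r" "norm t < r" for s t
  proof (rule Schwarz_scaled[where h = "\<lambda>s. f (vec2 s t)"])
    show "(\<lambda>s. f (vec2 s t)) holomorphic_on ball 0 r"
      unfolding holomorphic_on_open[OF open_ball] using d1[OF _ that(2)] by (metis mem_ball_0)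
    show "f (vec2 0 t) = 0" using ax[of "vec2 0 t"] inb[OF _ that(2), of 0] r e(2) by auto
    show "norm (f (vec2 z t)) < M" if "norm z < r" for z using M inb[OF that \<open>norm t < r\<close>] by blast
  qed (use r that in auto)
  have b2: "norm (f (vec2 s t)) \<le> (2 * M / r\<^sup>2) * (norm s * norm t)" if st: "norm s < r" "norm t < r" for s t
  proof (cases "s = 0")
    case True
    then have "f (vec2 s t) = 0" using ax[of "vec2 s t"] inb[OF that] e(2) by auto
    then show ?thesis using True by simp
  next
    case False
    (* the factor 2 turns the bound from the first variable into a strict one *)
    have "norm (f (vec2 s t)) \<le> (2 * M * norm s / r) * norm t / r"
    proof (rule Schwarz_scaled[where h = "\<lambda>t. f (vec2 s t)"])
      show "(\<lambda>t. f (vec2 s t)) holomorphic_on ball 0 r"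
        unfolding holomorphic_on_open[OF open_ball] using d2[OF st(1)] by (metis mem_ball_0)
      show "f (vec2 s 0) = 0" using ax[of "vec2 s 0"] inb[OF that(1), of 0] r e(2) by auto
      show "norm (f (vec2 s z)) < 2 * M * norm s / r" if "norm z < r" for z
      proof -
        have "norm (f (vec2 s z)) \<le> M * norm s / r" by (rule b1[OF st(1) that])
        also have "\<dots> < 2 * M * norm s / r" using Mpos False r by (simp add: divide_strict_right_mono)
        finally show ?thesis .
      qed
    qed (use r that in auto)
    also have "\<dots> = (2 * M / r\<^sup>2) * (norm s * norm t)" by (simp add: power2_eq_square)
    finally show ?thesis .
  qed
  show ?thesis
    by (rule that[of r "2 * M / r\<^sup>2"]) (use r Mpos b2 inb e(2) in auto)
qed

text \<open>Write \<open>(s, t)\<close> for the coordinates, so that the curve is \<open>s t = 0\<close>. A local equation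
  \<open>f\<close> of the curve is bounded by a multiple of \<open>s t\<close>. If \<open>q\<close> vanished at the
  node, then \<open>q f\<close> would be of smaller order than \<open>t\<^sup>2\<close> at the points \<open>(t, t)\<close>,
  where it is equal to \<open>t\<^sup>2\<close>.\<close>

lemma node_quotient_nonzero:
  assumes S: "compact_complex_surface S" and c: "holo_chart S c" and x: "x \<in> fst c" "snd c x = 0"
    and D: "\<And>y. y \<in> fst c \<Longrightarrow> y \<in> D \<longleftrightarrow> snd c y $ 1 = 0 \<or> snd c y $ 2 = 0"
    and f: "local_equation S D V f" and N: "N \<subseteq> V" "x \<in> N" "holo_on S q N"
    and eq: "\<And>y. y \<in> N \<Longrightarrow> snd c y $ 1 * snd c y $ 2 = q y * f y"
  shows "q x \<noteq> 0"
proof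
  assume q0: "q x = 0"
  note ch = holo_chart_is_chart[OF c]
  let ?i = "inv_into (fst c) (snd c)"
  define W where "W = snd c ` (fst c \<inter> N)"
  have fN: "holo_on S f N" by (rule holo_on_subset[OF S local_equation_holo[OF f] holo_on_open[OF N(3)] N(1)])
  have hf: "holo_fun (f \<circ> ?i) W" and hq: "holo_fun (q \<circ> ?i) W"
    unfolding W_def by (rule holo_on_holo_chart[OF S _ c], fact)+
  have W0: "0 \<in> W" unfolding W_def using x N(2) by force
  obtain C r where C: "r > 0" "C > 0"
    "\<And>s t. norm s < r \<Longrightarrow> norm t < r \<Longrightarrow> vec2 s t \<in> W \<and> norm ((f \<circ> ?i) (vec2 s t)) \<le> C * (norm s * norm t)"
  proof (rule vanishing_on_axes_bound[OF hf W0])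
    fix w assume "w \<in> W" "w $ 1 = 0 \<or> w $ 2 = 0"
    then obtain y where "y \<in> fst c" "y \<in> N" "w = snd c y" "y \<in> D" using D unfolding W_def by blast
    then show "(f \<circ> ?i) w = 0"
      using local_equation_vanishes[OF f] N(1) by (auto simp: is_chart_inv[OF ch])
  qed auto
  have "(q \<circ> ?i) 0 = 0" using q0 is_chart_inv[OF ch x(1)] x(2) by simp
  moreover have "isCont (q \<circ> ?i) 0"
    using holo_fun_continuous[OF hq] holo_fun_open[OF hq] W0 continuous_on_eq_continuous_at by blast
  ultimately obtain \<delta> where \<delta>: "\<delta> > 0" "\<And>w. norm w < \<delta> \<Longrightarrow> norm ((q \<circ> ?i) w) < 1 / C"
    unfolding continuous_at_eps_delta using C(2) by (auto simp: dist_norm dest!: spec[of _ "1 / C"])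
  (* small enough for (t, t) to lie in the domain of the estimate and in the delta-ball *)
  define t where "t = complex_of_real (min r \<delta> / 3)"
  have t: "t \<noteq> 0" "norm t < r" "norm t + norm t < \<delta>" using C(1) \<delta>(1) unfolding t_def by (auto simp: min_def)
  note tW = C(3)[OF t(2,2)]
  then obtain y where y: "y \<in> fst c" "y \<in> N" "vec2 t t = snd c y" unfolding W_def by auto
  have "t * t = q y * f y" using eq[OF y(2)] by (simp flip: y(3))
  then have "norm t * norm t = norm ((q \<circ> ?i) (vec2 t t)) * norm ((f \<circ> ?i) (vec2 t t))"
    by (simp add: y(3) is_chart_inv[OF ch y(1)] flip: norm_mult)
  also have "\<dots> \<le> norm ((q \<circ> ?i) (vec2 t t)) * (C * (norm t * norm t))"
    by (intro mult_left_mono) (use tW in auto)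
  also have "\<dots> < 1 / C * (C * (norm t * norm t))"
  proof (rule mult_strict_right_mono[OF \<delta>(2)])
    show "norm (vec2 t t) < \<delta>" using norm_vec2_le[of t t] t(3) by linarith
  qed (use C(2) t(1) in simp)
  also have "\<dots> = norm t * norm t" using C(2) by simp
  finally show False by simp
qed

definition node_at :: "'a surface \<Rightarrow> 'a set \<Rightarrow> 'a \<Rightarrow> bool" where
  "node_at S D x \<longleftrightarrow> (\<exists>c. holo_chart S c \<and> x \<in> fst c \<and> snd c x = 0 \<and>
     (\<forall>y\<in>fst c. y \<in> D \<longleftrightarrow> snd c y $ 1 = 0 \<or> snd c y $ 2 = 0))"

section \<open>From the bundle of a curve to the anticanonical bundle\<close>

lemma compatible_sym: "compatible c c' \<Longrightarrow> compatible c' c"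
  unfolding compatible_def by (simp add: Int_commute)

context immersed_curve
begin

text \<open>Along the branch on which \<open>g2\<close> vanishes, \<open>d(g1 g2) = g1 dg2\<close>. So the conormal factor of
  \<open>g1 g2\<close>, and with it that of the local equation \<open>f\<close>, has a simple zero like
  \<open>g1\<close> itself.\<close>

lemma branch_simple_zero:
  assumes c: "c \<in> charts S" "u z0 \<in> fst c"
    and g: "holo_on S g1 W" "holo_on S g2 W" "u z0 \<in> W" "g1 (u z0) = 0" "g2 (u z0) = 0"
    and prod: "\<And>y. y \<in> W \<inter> D \<Longrightarrow> g1 y * g2 y = 0"
    and a1: "((\<lambda>z. g1 (u z)) has_field_derivative a) (at z0)" "a \<noteq> 0"
    and g2: "chart_grad c g2 (u z0) \<noteq> 0"
    and f: "local_equation S D V f"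
    and N: "N \<subseteq> V" "u z0 \<in> N" "holo_on S q N" "\<And>y. y \<in> N \<Longrightarrow> g1 y * g2 y = q y * f y"
    and q0: "q (u z0) \<noteq> 0"
  shows "\<exists>l. l \<noteq> 0 \<and> ((\<lambda>z. conormal c f u z / (z - z0)) \<longlongrightarrow> l) (at z0)"
proof -
  have quot: "((\<lambda>z. g1 (u z) / (z - z0)) \<longlongrightarrow> a) (at z0)"
    using a1(1) g(4) unfolding has_field_derivative_iff by simp
  then have "\<forall>\<^sub>F z in at z0. g1 (u z) / (z - z0) \<noteq> 0"
    using a1(2) tendsto_imp_eventually_ne by blast
  then obtain M0 where M0: "open M0" "z0 \<in> M0" "\<And>z. z \<in> M0 \<Longrightarrow> z \<noteq> z0 \<Longrightarrow> g1 (u z) / (z - z0) \<noteq> 0"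
    unfolding eventually_at_topological by blast
  define M where "M = M0 \<inter> {z. u z \<in> fst c} \<inter> {z. u z \<in> W} \<inter> {z. u z \<in> N}"
  have M: "open M" "z0 \<in> M"
    unfolding M_def using M0 c g(3) N(2)
    by (auto intro!: open_Int chart_path_open[OF S u c(1)] holo_path_open[OF u] holo_on_open[OF g(1)] holo_on_open[OF N(3)])
  have Mz: "u z \<in> fst c" "u z \<in> W" "u z \<in> N" if "z \<in> M" for z using that unfolding M_def by auto
  have z2: "g2 (u z) = 0" if "z \<in> M" for z
  proof (cases "z = z0")
    case False
    then have "g1 (u z) \<noteq> 0" using M0(3)[of z] that unfolding M_def by auto
    then show ?thesis using prod[of "u z"] Mz[OF that] uD by auto
  qed (use g in simp)
  have l2: "conormal c g2 u z0 \<noteq> 0"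
    by (rule conormal_nonzero[OF c tangent[OF c g(2,3) M z2] g2])
  have eq: "g1 (u z) * conormal c g2 u z = q (u z) * conormal c f u z" if z: "z \<in> M" for z
  proof -
    have "conormal c (\<lambda>y. g1 y * g2 y) u z = g1 (u z) * conormal c g2 u z"
      by (rule conormal_mult[OF c(1) Mz(1)[OF z] g(1,2) Mz(2)[OF z] z2[OF z]]) simp
    moreover have fN: "holo_on S f N"
      by (rule holo_on_subset[OF S local_equation_holo[OF f] holo_on_open[OF N(3)] N(1)])
    have "f (u z) = 0" using local_equation_vanishes[OF f _ uD] Mz(3)[OF z] N(1) by blast
    from conormal_mult[OF c(1) Mz(1)[OF z] N(3) fN Mz(3)[OF z] this N(4)]
    have "conormal c (\<lambda>y. g1 y * g2 y) u z = q (u z) * conormal c f u z" .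
    ultimately show ?thesis by simp
  qed
  have cl: "isCont (conormal c g2 u) z0"
  proof -
    have "open {z. u z \<in> fst c \<inter> W}"
      using open_Int[OF chart_path_open[OF S u c(1)] holo_path_open[OF u holo_on_open[OF g(1)]]]
      by (simp add: Collect_conj_eq)
    then show ?thesis using conormal_continuous[OF c(1) g(2)] c(2) g(3) continuous_on_eq_continuous_at by blast
  qed
  have cq: "isCont (\<lambda>z. q (u z)) z0"
    using holomorphic_on_imp_continuous_on[OF holo_on_path_holomorphic[OF S u N(3)]]
      holo_path_open[OF u holo_on_open[OF N(3)]] N(2) continuous_on_eq_continuous_at by blast
  have "((\<lambda>z. g1 (u z) / (z - z0) * conormal c g2 u z / q (u z)) \<longlongrightarrow> a * conormal c g2 u z0 / q (u z0)) (at z0)"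
    by (intro tendsto_intros quot q0) (use cl cq in \<open>auto simp: isCont_def\<close>)
  moreover have "\<forall>\<^sub>F z in at z0. g1 (u z) / (z - z0) * conormal c g2 u z / q (u z) = conormal c f u z / (z - z0)"
  proof -
    have "\<forall>\<^sub>F z in at z0. q (u z) \<noteq> 0"
      using cq q0 tendsto_imp_eventually_ne unfolding isCont_def by blast
    moreover have "\<forall>\<^sub>F z in at z0. z \<in> M" using M eventually_at_topological by blast
    ultimately show ?thesis
    proof eventually_elim
      case (elim z)
      then have "conormal c f u z = g1 (u z) * conormal c g2 u z / q (u z)" using eq[OF elim(2)] by simp
      then show ?case by simp
    qed
  qed
  ultimately have "((\<lambda>z. conormal c f u z / (z - z0)) \<longlongrightarrow> a * conormal c g2 u z0 / q (u z0)) (at z0)"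
    by (rule Lim_transform_eventually)
  moreover have "a * conormal c g2 u z0 / q (u z0) \<noteq> 0" using a1(2) l2 q0 by simp
  ultimately show ?thesis by blast
qed

text \<open>In the coordinates at the node the velocity of the branch has a nonzero component, say the
  \<open>k\<close>-th. The branch then lies on the axis where the other coordinate vanishes.\<close>

lemma node_simple_zero:
  assumes nd: "node_at S D (u z0)" and c: "c \<in> charts S" "u z0 \<in> fst c"
    and f: "local_equation S D V f" "u z0 \<in> V"
  shows "\<exists>l. l \<noteq> 0 \<and> ((\<lambda>z. conormal c f u z / (z - z0)) \<longlongrightarrow> l) (at z0)"
proof -
  (* the coordinates at the node are the functions g 1 and g 2 *)
  obtain d where d: "holo_chart S d" "u z0 \<in> fst d" "snd d (u z0) = 0"
    "\<And>y. y \<in> fst d \<Longrightarrow> y \<in> D \<longleftrightarrow> snd d y $ 1 = 0 \<or> snd d y $ 2 = 0"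
    using nd unfolding node_at_def by blast
  note hd = holo_chart_is_chart[OF d(1)]
  have opd: "openin (space_of S) (fst d)" using hd unfolding is_chart_def by blast
  define g where "g k = (\<lambda>y. snd d y $ k)" for k
  have g: "holo_on S (g k) (fst d)" for k
    using holo_on_pullback[OF S d(1) holo_fun_nth(1)[OF open_UNIV, where k = k]] unfolding g_def by simp
  have gd: "chart_grad d (g k) (u z0) = axis k 1" for k
  proof -
    have "open (snd d ` fst d)" using hd unfolding is_chart_def by blast
    then have "chart_grad d (g k) (u z0) = grad (\<lambda>w. w $ k) (snd d (u z0))"
      unfolding chart_grad_def
      by (rule grad_cong) (use d(2) in \<open>auto simp: g_def is_chart_inv[OF hd]\<close>)
    then show ?thesis using holo_fun_nth(2)[OF open_UNIV, where k = k] by simp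
  qed
  have cc: "compatible c d" by (rule compatible_sym[OF holo_chart_compatible[OF d(1) c(1)]])
  define A where "A = (\<chi> k. chart_grad c (g k) (u z0))"
  (* in the chart d the differentials of g 1 and g 2 are the unit covectors *)
  have AJ: "A ** chart_jac c d (u z0) = mat 1"
  proof -
    have "(\<Sum>i\<in>UNIV. A $ k $ i * chart_jac c d (u z0) $ i $ j) = (if k = j then 1 else 0)" for k j
      using chart_grad_change[OF S g charts_holo_chart[OF S c(1)] d(1) cc c(2) d(2) d(2), of k j]
      unfolding gd A_def by (auto simp: axis_def)
    then show ?thesis by (simp only: vec_eq_iff matrix_matrix_mult_def mat_def vec_lambda_beta) simp
  qed
  then have JA: "chart_jac c d (u z0) ** A = mat 1" using matrix_left_right_inverse by blast
  have "A *v velocity c u z0 \<noteq> 0"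
  proof
    assume "A *v velocity c u z0 = 0"
    then have "(chart_jac c d (u z0) ** A) *v velocity c u z0 = 0"
      by (simp flip: matrix_vector_mul_assoc)
    then show False using velocity_nonzero[OF c] by (simp add: JA)
  qed
  then obtain k where k: "(A *v velocity c u z0) $ k \<noteq> 0" by (auto simp: vec_eq_iff)
  have der: "((\<lambda>z. g k (u z)) has_field_derivative (A *v velocity c u z0) $ k) (at z0)"
    using holo_on_path_derivative[OF S u c(1) g c(2) d(2), of k] by (simp add: matrix_vector_mult_def A_def)
  have gne: "chart_grad c (g l) (u z0) \<noteq> 0" for l
  proof
    assume "chart_grad c (g l) (u z0) = 0"
    then have "(A ** chart_jac c d (u z0)) $ l $ l = 0" by (simp add: matrix_matrix_mult_def A_def)
    then show False unfolding AJ by (simp add: mat_def)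
  qed
  have g0: "g l (u z0) = 0" for l using d(3) unfolding g_def by simp
  have prod: "g 1 y * g 2 y = 0" if "y \<in> fst d \<inter> D" for y using d(4) that unfolding g_def by auto
  have gh: "holo_on S (\<lambda>y. g 1 y * g 2 y) (fst d)" by (rule holo_on_mult[OF g g])
  obtain N q where N: "u z0 \<in> N" "N \<subseteq> V \<inter> fst d" "holo_on S q N" "\<And>y. y \<in> N \<Longrightarrow> g 1 y * g 2 y = q y * f y"
    using local_equation_divides[OF f(1) gh prod f(2) d(2)] by blast
  have NV: "N \<subseteq> V" using N(2) by blast
  have q0: "q (u z0) \<noteq> 0"
    by (rule node_quotient_nonzero[OF S d(1-4) f(1) NV N(1,3)]) (use N(4) in \<open>auto simp: g_def\<close>)
  show ?thesis
  proof (cases "k = 1")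
    case True
    show ?thesis
      by (rule branch_simple_zero[OF c g g d(2) g0 g0 prod der[unfolded True] k[unfolded True] gne f(1) NV N(1,3,4) q0])
  next
    case False
    then have k2: "k = 2" using exhaust_2 by blast
    show ?thesis
    proof (rule branch_simple_zero[OF c g g d(2) g0 g0 _ der[unfolded k2] k[unfolded k2] gne f(1) NV N(1,3) _ q0])
      show "g 2 y * g 1 y = 0" if "y \<in> fst d \<inter> D" for y using prod[OF that] by (simp add: mult.commute)
      show "g 2 y * g 1 y = q y * f y" if "y \<in> N" for y using N(4)[OF that] by (simp add: mult.commute)
    qed
  qed
qed

text \<open>The conormal factor of a local equation has simple zeros exactly at the preimages of nodes. So a
  weight \<open>\<rho>\<close> divided by it extends continuously and without zeros.\<close>

definition node_weight :: "(complex \<Rightarrow> complex) \<Rightarrow> bool" where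
  "node_weight \<rho> \<longleftrightarrow> \<rho> holomorphic_on UNIV \<and>
     (\<forall>z. if \<rho> z = 0 then deriv \<rho> z \<noteq> 0 \<and> node_at S D (u z) else smooth_at S D (u z))"

text \<open>The limit is the value of the quotient at smooth points and its continuous extension at preimages
  of nodes. It is the local form of an isomorphism from the bundle of \<open>D\<close> to the determinant of
  the tangent bundle, both pulled back by \<open>u\<close>.\<close>

definition adj_ratio :: "(complex \<Rightarrow> complex) \<Rightarrow> 'a chart2 \<Rightarrow> ('a \<Rightarrow> complex) \<Rightarrow> complex \<Rightarrow> complex" where
  "adj_ratio \<rho> c f z = Lim (at z) (\<lambda>w. \<rho> w / conormal c f u w)"

lemma weight_derivative:
  assumes "node_weight \<rho>" shows "(\<rho> has_field_derivative deriv \<rho> z) (at z)"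
  using assms holomorphic_derivI[of \<rho> UNIV z] unfolding node_weight_def by auto

lemma weight_eventually:
  assumes \<rho>: "node_weight \<rho>" shows "\<forall>\<^sub>F w in at z. \<rho> w \<noteq> 0"
proof (cases "\<rho> z = 0")
  case True
  have "((\<lambda>w. \<rho> w / (w - z)) \<longlongrightarrow> deriv \<rho> z) (at z)"
    using weight_derivative[OF \<rho>, of z] True unfolding has_field_derivative_iff by simp
  moreover have "deriv \<rho> z \<noteq> 0" using \<rho> True unfolding node_weight_def by auto
  ultimately have "\<forall>\<^sub>F w in at z. \<rho> w / (w - z) \<noteq> 0" using tendsto_imp_eventually_ne by blast
  then show ?thesis by (rule eventually_mono) auto
next
  case False
  have "(\<rho> \<longlongrightarrow> \<rho> z) (at z)" using DERIV_isCont[OF weight_derivative[OF \<rho>]] unfolding isCont_def .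
  then show ?thesis using False tendsto_imp_eventually_ne by blast
qed

lemma adj_ratio_limit:
  assumes \<rho>: "node_weight \<rho>" and c: "c \<in> charts S" "u z \<in> fst c"
    and f: "local_equation S D V f" "u z \<in> V"
  shows "((\<lambda>w. \<rho> w / conormal c f u w) \<longlongrightarrow> adj_ratio \<rho> c f z) (at z)" and "adj_ratio \<rho> c f z \<noteq> 0"
proof -
  have "\<exists>l. l \<noteq> 0 \<and> ((\<lambda>w. \<rho> w / conormal c f u w) \<longlongrightarrow> l) (at z)"
  proof (cases "\<rho> z = 0")
    case True
    have nd: "node_at S D (u z)" and dn: "deriv \<rho> z \<noteq> 0" using \<rho> True unfolding node_weight_def by auto
    obtain l where l: "l \<noteq> 0" "((\<lambda>w. conormal c f u w / (w - z)) \<longlongrightarrow> l) (at z)"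
      using node_simple_zero[OF nd c f] by blast
    have "((\<lambda>w. \<rho> w / (w - z)) \<longlongrightarrow> deriv \<rho> z) (at z)"
      using weight_derivative[OF \<rho>, of z] True unfolding has_field_derivative_iff by simp
    from tendsto_divide[OF this l(2,1)]
    have "((\<lambda>w. (\<rho> w / (w - z)) / (conormal c f u w / (w - z))) \<longlongrightarrow> deriv \<rho> z / l) (at z)" .
    moreover have "\<forall>\<^sub>F w in at z. (\<rho> w / (w - z)) / (conormal c f u w / (w - z)) = \<rho> w / conormal c f u w"
      by (rule eventually_at_filter[THEN iffD2]) simp
    ultimately have "((\<lambda>w. \<rho> w / conormal c f u w) \<longlongrightarrow> deriv \<rho> z / l) (at z)"
      by (rule Lim_transform_eventually)
    then show ?thesis using l(1) dn by (intro exI[of _ "deriv \<rho> z / l"]) simp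
  next
    case False
    then have sm: "smooth_at S D (u z)" using \<rho> unfolding node_weight_def by auto
    have l0: "conormal c f u z \<noteq> 0" by (rule conormal_regular_nonzero[OF sm f c])
    have "open {z. u z \<in> fst c \<inter> V}"
      using open_Int[OF chart_path_open[OF S u c(1)] holo_path_open[OF u holo_on_open[OF local_equation_holo[OF f(1)]]]]
      by (simp add: Collect_conj_eq)
    then have "isCont (conormal c f u) z"
      using conormal_continuous[OF c(1) local_equation_holo[OF f(1)]] c(2) f(2) continuous_on_eq_continuous_at by blast
    moreover have "isCont \<rho> z" by (rule DERIV_isCont[OF weight_derivative[OF \<rho>]])
    ultimately have "((\<lambda>w. \<rho> w / conormal c f u w) \<longlongrightarrow> \<rho> z / conormal c f u z) (at z)"
      using l0 unfolding isCont_def by (intro tendsto_divide)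
    then show ?thesis using False l0 by (intro exI[of _ "\<rho> z / conormal c f u z"]) simp
  qed
  then obtain l where l: "l \<noteq> 0" "((\<lambda>w. \<rho> w / conormal c f u w) \<longlongrightarrow> l) (at z)" by blast
  have "adj_ratio \<rho> c f z = l" unfolding adj_ratio_def using l(2) by (intro tendsto_Lim) auto
  then show "((\<lambda>w. \<rho> w / conormal c f u w) \<longlongrightarrow> adj_ratio \<rho> c f z) (at z)" and "adj_ratio \<rho> c f z \<noteq> 0" using l by simp_all
qed

end

text \<open>A function that has a limit at every point becomes continuous when it is replaced by its limits:
  near \<open>z\<close> the limits are limits of values close to the limit at \<open>z\<close>.\<close>

lemma continuous_on_limit_function:
  fixes f g :: "complex \<Rightarrow> complex"
  assumes T: "open T" and lim: "\<And>z. z \<in> T \<Longrightarrow> (f \<longlongrightarrow> g z) (at z)"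
  shows "continuous_on T g"
  unfolding continuous_on_eq_continuous_at[OF T] continuous_at_eps_delta
proof (intro ballI allI impI)
  fix z :: complex and e :: real assume z: "z \<in> T" and e: "e > 0"
  obtain d where d: "d > 0" "ball z d \<subseteq> T" using T z open_contains_ball by blast
  have "\<forall>\<^sub>F w in at z. dist (f w) (g z) < e / 2" using lim[OF z] e by (intro tendstoD) auto
  then obtain d' where d': "d' > 0" "\<And>w. w \<noteq> z \<Longrightarrow> dist w z < d' \<Longrightarrow> dist (f w) (g z) < e / 2"
    unfolding eventually_at by auto
  show "\<exists>\<delta>>0. \<forall>y. dist y z < \<delta> \<longrightarrow> dist (g y) (g z) < e"
  proof (intro exI[of _ "min d d'"] conjI allI impI)
    fix y assume y: "dist y z < min d d'"
    show "dist (g y) (g z) < e"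
    proof (cases "y = z")
      case False
      have "y \<in> T" using y d(2) by (auto simp: dist_commute)
      have "open (ball z d' - {z})" "y \<in> ball z d' - {z}" using y False by (auto simp: dist_commute)
      then have ev: "\<forall>\<^sub>F w in at y. w \<in> ball z d' - {z}" using eventually_at_topological by blast
      have "dist (g y) (g z) \<le> e / 2"
      proof (rule tendsto_upperbound)
        show "((\<lambda>w. dist (f w) (g z)) \<longlongrightarrow> dist (g y) (g z)) (at y)"
          by (intro tendsto_intros lim \<open>y \<in> T\<close>)
        show "\<forall>\<^sub>F w in at y. dist (f w) (g z) \<le> e / 2"
          by (rule eventually_mono[OF ev]) (use d'(2) in \<open>auto simp: dist_commute less_imp_le\<close>)
      qed simp
      then show ?thesis using e by simp
    qed (use e in simp)
  qed (use d(1) d'(1) in simp)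
qed

context immersed_curve
begin

lemma adj_ratio_continuous:
  assumes \<rho>: "node_weight \<rho>" and c: "c \<in> charts S" and f: "local_equation S D V f"
  shows "continuous_on {z. u z \<in> fst c \<inter> V} (adj_ratio \<rho> c f)"
proof (rule continuous_on_limit_function)
  show "open {z. u z \<in> fst c \<inter> V}"
    using open_Int[OF chart_path_open[OF S u c(1)] holo_path_open[OF u holo_on_open[OF local_equation_holo[OF f]]]]
    by (simp add: Collect_conj_eq)
qed (use adj_ratio_limit(1)[OF \<rho> c _ f] in blast)

text \<open>At smooth points this follows from the transformation of conormal factors, and the smooth points
  are dense.\<close>

lemma adj_ratio_change_equation:
  assumes \<rho>: "node_weight \<rho>" and c: "c \<in> charts S" "u z \<in> fst c"
    and f: "local_equation S D V f" "u z \<in> V" and g: "local_equation S D W g" "u z \<in> W"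
    and cont: "continuous_map (subtopology (space_of S) (V \<inter> W)) euclidean (ratio_at (space_of S) f g)"
  shows "adj_ratio \<rho> c f z * ratio_at (space_of S) f g (u z) = adj_ratio \<rho> c g z"
proof -
  let ?X = "space_of S"
  have oV: "openin ?X V" and oW: "openin ?X W" using f g local_equation_holo holo_on_open by blast+
  define T where "T = {w. u w \<in> fst c \<inter> (V \<inter> W)}"
  have T: "open T" "z \<in> T"
    unfolding T_def using open_Int[OF chart_path_open[OF S u c(1)] holo_path_open[OF u openin_Int[OF oV oW]]] c f g
    by (auto simp: Collect_conj_eq)
  have "continuous_map (top_of_set T) (subtopology ?X (V \<inter> W)) u"
    using u unfolding holo_path_def T_def
    by (auto simp: continuous_map_in_subtopology intro: continuous_map_from_subtopology)
  from continuous_map_compose[OF this cont]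
  have "continuous_on T (\<lambda>w. ratio_at ?X f g (u w))"
    by (simp add: continuous_map_iff_continuous o_def)
  then have "isCont (\<lambda>w. ratio_at ?X f g (u w)) z"
    using T continuous_on_eq_continuous_at by blast
  then have "((\<lambda>w. \<rho> w / conormal c f u w * ratio_at ?X f g (u w)) \<longlongrightarrow> adj_ratio \<rho> c f z * ratio_at ?X f g (u z)) (at z)"
    unfolding isCont_def by (intro tendsto_mult adj_ratio_limit(1)[OF \<rho> c f])
  moreover have "\<forall>\<^sub>F w in at z. \<rho> w / conormal c f u w * ratio_at ?X f g (u w) = \<rho> w / conormal c g u w"
  proof -
    have "\<forall>\<^sub>F w in at z. w \<in> T" using T eventually_at_topological by blast
    with weight_eventually[OF \<rho>] show ?thesis
    proof eventually_elim
      case (elim w)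
      have sm: "smooth_at S D (u w)" using \<rho> elim(1) unfolding node_weight_def by auto
      have w: "u w \<in> fst c" "u w \<in> V" "u w \<in> W" using elim(2) unfolding T_def by auto
      have "conormal c f u w = ratio_at ?X f g (u w) * conormal c g u w"
        by (rule conormal_ratio[OF sm f(1) w(2) g(1) w(3) c(1) w(1)])
      moreover have "conormal c f u w \<noteq> 0" by (rule conormal_regular_nonzero[OF sm f(1) w(2) c(1) w(1)])
      ultimately show ?case by auto
    qed
  qed
  ultimately have "((\<lambda>w. \<rho> w / conormal c g u w) \<longlongrightarrow> adj_ratio \<rho> c f z * ratio_at ?X f g (u z)) (at z)"
    by (rule Lim_transform_eventually)
  then show ?thesis using adj_ratio_limit(1)[OF \<rho> c g] tendsto_unique[of "at z"] by auto
qed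

lemma adj_ratio_change_chart:
  assumes \<rho>: "node_weight \<rho>" and c: "c \<in> charts S" "u z \<in> fst c" and c': "c' \<in> charts S" "u z \<in> fst c'"
    and f: "local_equation S D V f" "u z \<in> V"
  shows "adj_ratio \<rho> c f z = det (chart_jac c c' (u z)) * adj_ratio \<rho> c' f z"
proof -
  have oV: "openin (space_of S) V" using f local_equation_holo holo_on_open by blast
  define T where "T = {w. u w \<in> fst c \<inter> fst c'} \<inter> {w. u w \<in> V}"
  have oT: "open {w. u w \<in> fst c \<inter> fst c'}"
    using open_Int[OF chart_path_open[OF S u c(1)] chart_path_open[OF S u c'(1)]] by (simp add: Collect_conj_eq)
  then have T: "open T" "z \<in> T" unfolding T_def using holo_path_open[OF u oV] c c' f by auto
  have "isCont (\<lambda>w. det (chart_jac c c' (u w))) z"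
    using chart_jac_continuous[OF S u c(1) c'(1)] oT c(2) c'(2) continuous_on_eq_continuous_at by blast
  then have "((\<lambda>w. det (chart_jac c c' (u w)) * (\<rho> w / conormal c' f u w)) \<longlongrightarrow> det (chart_jac c c' (u z)) * adj_ratio \<rho> c' f z) (at z)"
    unfolding isCont_def by (intro tendsto_mult adj_ratio_limit(1)[OF \<rho> c' f])
  moreover have "\<forall>\<^sub>F w in at z. det (chart_jac c c' (u w)) * (\<rho> w / conormal c' f u w) = \<rho> w / conormal c f u w"
  proof -
    have "\<forall>\<^sub>F w in at z. w \<in> T" using T eventually_at_topological by blast
    with weight_eventually[OF \<rho>] show ?thesis
    proof eventually_elim
      case (elim w)
      have sm: "smooth_at S D (u w)" using \<rho> elim(1) unfolding node_weight_def by auto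
      have w: "u w \<in> fst c" "u w \<in> fst c'" "u w \<in> V" using elim(2) unfolding T_def by auto
      have "conormal c' f u w = det (chart_jac c c' (u w)) * conormal c f u w"
        by (rule conormal_change[OF c(1) w(1) c'(1) w(2) local_equation_holo[OF f(1)] w(3)
          tangent_vanishing[OF c(1) w(1) local_equation_holo[OF f(1)] w(3)]])
          (use local_equation_vanishes[OF f(1)] in blast)
      moreover have "conormal c' f u w \<noteq> 0" by (rule conormal_regular_nonzero[OF sm f(1) w(3) c'(1) w(2)])
      ultimately show ?case by auto
    qed
  qed
  ultimately have "((\<lambda>w. \<rho> w / conormal c f u w) \<longlongrightarrow> det (chart_jac c c' (u z)) * adj_ratio \<rho> c' f z) (at z)"
    by (rule Lim_transform_eventually)
  then show ?thesis using adj_ratio_limit(1)[OF \<rho> c f] tendsto_unique[of "at z"] by auto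
qed

end

section \<open>The adjunction formula\<close>

lemma log_increment_circle: "log_increment (circlepath 0 1) 1"
  unfolding log_increment_def
  by (rule exI[of _ "\<lambda>t. 2 * of_real pi * \<i> * of_real t"])
     (auto simp: circlepath path_def pathfinish_def pathstart_def intro!: continuous_intros)

lemma log_increment_const: "c \<noteq> 0 \<Longrightarrow> log_increment (\<lambda>t. c) 0"
  unfolding log_increment_def
  by (rule exI[of _ "\<lambda>t. Ln c"]) (auto simp: path_def pathfinish_def pathstart_def)

text \<open>The derivative of \<open>w \<mapsto> inverse w\<close> at \<open>inverse z\<close> is \<open>- z\<^sup>2\<close>.\<close>

lemma velocity_inverse:
  assumes S: "compact_complex_surface S"
    and u: "holo_path S (F \<circ> Some)" "holo_path S (F \<circ> aff_inf)"
    and c: "c \<in> charts S" "F (Some z) \<in> fst c" and z: "z \<noteq> 0"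
  shows "velocity c (F \<circ> aff_inf) (inverse z) $ i = - z\<^sup>2 * velocity c (F \<circ> Some) z $ i"
proof -
  have iz: "(F \<circ> aff_inf) (inverse z) \<in> fst c" using c(2) z by (simp add: aff_inf_inverse)
  have "((\<lambda>w. snd c ((F \<circ> Some) w) $ i) has_field_derivative velocity c (F \<circ> Some) z $ i) (at (inverse (inverse z)))"
    using velocity_has_derivative[OF S u(1) c(1), of z i] c(2) by simp
  moreover have "(inverse has_field_derivative - (inverse (inverse z) ^ Suc (Suc 0))) (at (inverse z))"
    by (rule DERIV_inverse) (use z in simp)
  ultimately have "((\<lambda>w. snd c ((F \<circ> Some) (inverse w)) $ i) has_field_derivative
      velocity c (F \<circ> Some) z $ i * - (inverse (inverse z) ^ Suc (Suc 0))) (at (inverse z))"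
    by (rule DERIV_chain2)
  then have "((\<lambda>w. snd c ((F \<circ> aff_inf) w) $ i) has_field_derivative
      velocity c (F \<circ> Some) z $ i * - (inverse (inverse z) ^ Suc (Suc 0))) (at (inverse z))"
    by (rule has_field_derivative_transform_within_open[where S = "- {0}"])
       (use z in \<open>auto simp: aff_inf_def\<close>)
  from DERIV_unique[OF velocity_has_derivative[OF S u(2) c(1) iz] this]
  show ?thesis by (simp add: power2_eq_square o_def mult.commute)
qed

lemma conormal_inverse:
  assumes S: "compact_complex_surface S"
    and u: "holo_path S (F \<circ> Some)" "holo_path S (F \<circ> aff_inf)"
    and c: "c \<in> charts S" "F (Some z) \<in> fst c" and z: "z \<noteq> 0"
  shows "conormal c f (F \<circ> aff_inf) (inverse z) = conormal c f (F \<circ> Some) z / (- z\<^sup>2)"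
proof -
  let ?k = "- z\<^sup>2" and ?v = "velocity c (F \<circ> Some) z" and ?g = "chart_grad c f (F (Some z))"
  have "(F \<circ> aff_inf) (inverse z) = F (Some z)" using z by (simp add: aff_inf_inverse)
  then have "conormal c f (F \<circ> aff_inf) (inverse z) =
      (cnj ?k * (?g $ 2 * cnj (?v $ 1) - ?g $ 1 * cnj (?v $ 2))) /
      (cnj ?k * (?k * (?v $ 1 * cnj (?v $ 1) + ?v $ 2 * cnj (?v $ 2))))"
    unfolding conormal_def velocity_inverse[OF assms] by (simp add: algebra_simps)
  also have "\<dots> = conormal c f (F \<circ> Some) z / ?k"
    using z unfolding conormal_def by (simp add: mult.commute)
  finally show ?thesis .
qed

lemma normalization_holo_path: "normalization S F D \<Longrightarrow> holo_path S (F \<circ> P1_chart b)"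
  by (cases b) (simp_all add: normalization_def)

lemma normalization_immersed_curve:
  assumes "compact_complex_surface S" "normalization S F D" "immersion S F"
  shows "immersed_curve S (F \<circ> P1_chart b) D"
proof
  show "immersed_path S (F \<circ> P1_chart b)" using assms(3) by (cases b) (simp_all add: immersion_def)
  show "(F \<circ> P1_chart b) z \<in> D" for z using assms(2) by (auto simp: normalization_def)
qed (use assms normalization_holo_path in auto)

lemma adj_ratio_inverse:
  assumes S: "compact_complex_surface S" and F: "normalization S F D" and imm: "immersion S F"
    and \<rho>: "\<And>b. immersed_curve.node_weight S (F \<circ> P1_chart b) D (\<rho> b)"
    and \<theta>: "\<And>z. z \<noteq> 0 \<Longrightarrow> \<rho> True (inverse z) * (- z\<^sup>2) = \<theta> z * \<rho> False z" "\<And>z. z \<noteq> 0 \<Longrightarrow> isCont \<theta> z"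
    and c: "c \<in> charts S" "F (Some z) \<in> fst c" and f: "local_equation S D V f" "F (Some z) \<in> V" and z: "z \<noteq> 0"
  shows "immersed_curve.adj_ratio (F \<circ> aff_inf) (\<rho> True) c f (inverse z) =
    \<theta> z * immersed_curve.adj_ratio (F \<circ> Some) (\<rho> False) c f z"
proof -
  note ic = normalization_immersed_curve[OF S F imm]
  note ic0 = ic[of False, simplified] and ic1 = ic[of True, simplified]
  note \<rho>0 = \<rho>[of False, simplified] and \<rho>1 = \<rho>[of True, simplified]
  have u: "holo_path S (F \<circ> Some)" "holo_path S (F \<circ> aff_inf)"
    using normalization_holo_path[OF F, of False] normalization_holo_path[OF F, of True] by simp_all
  have iz: "(F \<circ> aff_inf) (inverse z) = F (Some z)" using z by (simp add: aff_inf_inverse)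
  let ?a0 = "immersed_curve.adj_ratio (F \<circ> Some) (\<rho> False) c f z"
  let ?a1 = "immersed_curve.adj_ratio (F \<circ> aff_inf) (\<rho> True) c f (inverse z)"
  have l1: "((\<lambda>w. \<rho> True w / conormal c f (F \<circ> aff_inf) w) \<longlongrightarrow> ?a1) (at (inverse z))"
    by (rule immersed_curve.adj_ratio_limit(1)[OF ic1 \<rho>1 c(1) _ f(1)]) (use c f iz in auto)
  have l0: "((\<lambda>w. \<rho> False w / conormal c f (F \<circ> Some) w) \<longlongrightarrow> ?a0) (at z)"
    by (rule immersed_curve.adj_ratio_limit(1)[OF ic0 \<rho>0 c(1) _ f(1)]) (use c f in auto)
  have inv: "filterlim inverse (at (inverse z)) (at z)"
    unfolding filterlim_at
  proof
    show "\<forall>\<^sub>F x in at z. inverse x \<in> UNIV \<and> inverse x \<noteq> inverse z"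
      by (rule eventually_at_filter[THEN iffD2]) simp
    show "(inverse \<longlongrightarrow> inverse z) (at z)" using z by (intro tendsto_intros)
  qed
  have "((\<lambda>w. \<rho> True (inverse w) / conormal c f (F \<circ> aff_inf) (inverse w)) \<longlongrightarrow> ?a1) (at z)"
    by (rule filterlim_compose[OF l1 inv])
  moreover have "\<forall>\<^sub>F w in at z. \<rho> True (inverse w) / conormal c f (F \<circ> aff_inf) (inverse w) =
      \<theta> w * (\<rho> False w / conormal c f (F \<circ> Some) w)"
  proof -
    have "open ({w. (F \<circ> Some) w \<in> fst c} - {0})"
      by (intro open_Diff chart_path_open[OF S u(1) c(1)]) simp
    moreover have "z \<in> {w. (F \<circ> Some) w \<in> fst c} - {0}" using c z by simp
    ultimately have "\<forall>\<^sub>F w in at z. w \<in> {w. (F \<circ> Some) w \<in> fst c} - {0}"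
      using eventually_at_topological by blast
    then show ?thesis
    proof eventually_elim
      case (elim w)
      then have w: "F (Some w) \<in> fst c" "w \<noteq> 0" by auto
      have "\<rho> True (inverse w) / conormal c f (F \<circ> aff_inf) (inverse w) =
          (\<rho> True (inverse w) * (- w\<^sup>2)) / conormal c f (F \<circ> Some) w"
        unfolding conormal_inverse[OF S u c(1) w] by simp
      then show ?case unfolding \<theta>(1)[OF w(2)] by simp
    qed
  qed
  ultimately have "((\<lambda>w. \<theta> w * (\<rho> False w / conormal c f (F \<circ> Some) w)) \<longlongrightarrow> ?a1) (at z)"
    by (rule Lim_transform_eventually)
  moreover have "((\<lambda>w. \<theta> w * (\<rho> False w / conormal c f (F \<circ> Some) w)) \<longlongrightarrow> \<theta> z * ?a0) (at z)"
    by (intro tendsto_mult l0) (use \<theta>(2)[OF z] in \<open>simp add: isCont_def\<close>)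
  ultimately show ?thesis using tendsto_unique[of "at z"] by auto
qed

text \<open>Over each affine chart, \<open>\<rho>\<close> divided by the conormal factor identifies the bundle of
  \<open>D\<close> with the determinant of the tangent bundle. Between the charts the velocity changes by
  \<open>- z\<^sup>2\<close>, which together with the change of \<open>\<rho>\<close> makes up \<open>\<theta>\<close>.\<close>

lemma adjunction_degree:
  assumes S: "compact_complex_surface S" and F: "normalization S F D" and imm: "immersion S F"
    and LB: "line_bundle (space_of S) (divisor_bundle S {D} (\<lambda>_. 1))"
    and deg: "frame_degree (divisor_bundle S {D} (\<lambda>_. 1)) F n"
    and \<rho>: "\<And>b. immersed_curve.node_weight S (F \<circ> P1_chart b) D (\<rho> b)"
    and \<theta>: "\<And>z. z \<noteq> 0 \<Longrightarrow> \<rho> True (inverse z) * (- z\<^sup>2) = \<theta> z * \<rho> False z" "\<And>z. z \<noteq> 0 \<Longrightarrow> isCont \<theta> z"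
    and k: "log_increment (\<theta> \<circ> circlepath 0 1) k"
  shows "frame_degree (anticanonical S) F (k + n)"
proof -
  let ?L = "divisor_bundle S {D} (\<lambda>_. 1)" and ?X = "space_of S"
  note ic = normalization_immersed_curve[OF S F imm]
  have idx: "local_equation S D (fst i) (snd i D)" "openin ?X (fst i)" if "i \<in> idx ?L" for i
    using that by (auto simp: divisor_bundle_def)
  have tr: "trans ?L i j = ratio_at ?X (snd i D) (snd j D)" for i j
    by (simp add: divisor_bundle_def case_prod_unfold fun_eq_iff)
  have dm [simp]: "dom ?L = fst" "dom (anticanonical S) = fst" "idx (anticanonical S) = charts S"
    by (simp_all add: divisor_bundle_def anticanonical_def)
  define H where "H b c i = immersed_curve.adj_ratio (F \<circ> P1_chart b) (\<rho> b) c (snd i D)" for b c and i :: "'a set \<times> ('a set \<Rightarrow> 'a \<Rightarrow> complex)"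
  show ?thesis
  proof (rule frame_degree_transport[OF deg, where X = ?X and H = H and \<theta> = \<theta>])
    show "continuous_map euclidean ?X (F \<circ> P1_chart b)" for b
      using normalization_holo_path[OF F, of b] unfolding holo_path_def by blast
    show "openin ?X (dom ?L i)" if "i \<in> idx ?L" for i using idx(2)[OF that] by simp
    show "(\<Union>i\<in>idx ?L. dom ?L i) = topspace ?X" using LB unfolding line_bundle_def by blast
    show "continuous_on {z. F (P1_chart b z) \<in> dom (anticanonical S) c \<inter> dom ?L i} (H b c i)"
      if "c \<in> idx (anticanonical S)" "i \<in> idx ?L" for b c i
      using immersed_curve.adj_ratio_continuous[OF ic \<rho>, of c "fst i" "snd i D" b] that idx(1)[OF that(2)]
      unfolding H_def by simp
    show "H b c i z \<noteq> 0"
      if "c \<in> idx (anticanonical S)" "i \<in> idx ?L" "F (P1_chart b z) \<in> dom (anticanonical S) c \<inter> dom ?L i" for b c i z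
      using immersed_curve.adj_ratio_limit(2)[OF ic \<rho>, of c b z "fst i" "snd i D"] that idx(1)[OF that(2)]
      unfolding H_def by simp
    show "H b c i z * trans ?L i i' (F (P1_chart b z)) = H b c i' z"
      if "c \<in> idx (anticanonical S)" "i \<in> idx ?L" "i' \<in> idx ?L"
        "F (P1_chart b z) \<in> dom (anticanonical S) c \<inter> dom ?L i \<inter> dom ?L i'" for b c i i' z
    proof -
      have "continuous_map (subtopology ?X (dom ?L i \<inter> dom ?L i')) euclidean (trans ?L i i')"
        using LB that(2,3) unfolding line_bundle_def by blast
      then show ?thesis
        using immersed_curve.adj_ratio_change_equation[OF ic \<rho>, of c b z "fst i" "snd i D" "fst i'" "snd i' D"] that
          idx(1)[OF that(2)] idx(1)[OF that(3)]
        unfolding H_def tr by simp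
    qed
    show "H b c i z = trans (anticanonical S) c c' (F (P1_chart b z)) * H b c' i z"
      if "c \<in> idx (anticanonical S)" "c' \<in> idx (anticanonical S)" "i \<in> idx ?L"
        "F (P1_chart b z) \<in> dom (anticanonical S) c \<inter> dom (anticanonical S) c' \<inter> dom ?L i" for b c c' i z
      using immersed_curve.adj_ratio_change_chart[OF ic \<rho>, of c b z c' "fst i" "snd i D"] that idx(1)[OF that(3)]
      unfolding H_def by (simp add: anticanonical_def chart_jac_def)
    show "H True c i (inverse z) = \<theta> z * H False c i z"
      if "c \<in> idx (anticanonical S)" "i \<in> idx ?L" "z \<in> sphere 0 1" "F (Some z) \<in> dom (anticanonical S) c \<inter> dom ?L i" for c i z
    proof -
      have "z \<noteq> 0" using that(3) by auto
      then show ?thesis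
        using adj_ratio_inverse[OF S F imm \<rho> \<theta>, of c z "fst i" "snd i D"] that idx(1)[OF that(2)]
        unfolding H_def by simp
    qed
  qed (fact k)
qed

text \<open>The point at infinity is moved to \<open>0\<close> by the involution \<open>z \<mapsto> inverse z\<close> of the
  projective line.\<close>

lemma smooth_at_injective_point_P1:
  assumes S: "compact_complex_surface S" and F: "normalization S F D" and imm: "immersion S F"
    and p: "\<And>q. q \<noteq> p \<Longrightarrow> F q \<noteq> F p"
  shows "smooth_at S D (F p)"
proof (cases p)
  case (Some z)
  then show ?thesis using smooth_at_injective_point[OF S F imm, of z] p by simp
next
  case None
  define \<sigma> where "\<sigma> q = (case q of None \<Rightarrow> Some 0 | Some z \<Rightarrow> aff_inf z)" for q
  have \<sigma>\<sigma>: "\<sigma> (\<sigma> q) = q" for q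
    unfolding \<sigma>_def aff_inf_def by (cases q) auto
  then have inj: "inj \<sigma>" and surj: "range \<sigma> = UNIV" by (metis injI, metis surj_def)
  have 1: "F \<circ> \<sigma> \<circ> Some = F \<circ> aff_inf" "F \<circ> \<sigma> \<circ> aff_inf = F \<circ> Some"
    by (auto simp: fun_eq_iff \<sigma>_def aff_inf_def)
  have "normalization S (F \<circ> \<sigma>) D"
    unfolding normalization_def 1
  proof (intro conjI)
    have "finite (\<sigma> ` {p. \<exists>q. q \<noteq> p \<and> F q = F p})" using F by (simp add: normalization_def)
    moreover have "{p. \<exists>q. q \<noteq> p \<and> (F \<circ> \<sigma>) q = (F \<circ> \<sigma>) p} \<subseteq> \<sigma> ` {p. \<exists>q. q \<noteq> p \<and> F q = F p}"
    proof
      fix p assume "p \<in> {p. \<exists>q. q \<noteq> p \<and> (F \<circ> \<sigma>) q = (F \<circ> \<sigma>) p}"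
      then obtain q where q: "q \<noteq> p" "F (\<sigma> q) = F (\<sigma> p)" by auto
      have "\<sigma> q \<noteq> \<sigma> p" using q(1) inj by (simp add: inj_eq)
      then have "\<sigma> p \<in> {p. \<exists>q. q \<noteq> p \<and> F q = F p}" using q(2) by blast
      then show "p \<in> \<sigma> ` {p. \<exists>q. q \<noteq> p \<and> F q = F p}" by (rule image_eqI[rotated]) (simp add: \<sigma>\<sigma>)
    qed
    ultimately show "finite {p. \<exists>q. q \<noteq> p \<and> (F \<circ> \<sigma>) q = (F \<circ> \<sigma>) p}" by (rule rev_finite_subset)
    show "D = range (F \<circ> \<sigma>)" using F surj by (metis normalization_def image_comp)
  qed (use F in \<open>auto simp: normalization_def\<close>)
  moreover have "immersion S (F \<circ> \<sigma>)" using imm unfolding immersion_def 1 by simp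
  moreover have "(F \<circ> \<sigma>) q \<noteq> (F \<circ> \<sigma>) (Some 0)" if "q \<noteq> Some 0" for q
  proof -
    have "\<sigma> q \<noteq> None" using that inj unfolding \<sigma>_def by (auto simp: aff_inf_def split: option.splits)
    then show ?thesis using p None by (simp add: \<sigma>_def aff_inf_def)
  qed
  ultimately have "smooth_at S D ((F \<circ> \<sigma>) (Some 0))" by (rule smooth_at_injective_point[OF S])
  then show ?thesis using None by (simp add: \<sigma>_def aff_inf_def)
qed

text \<open>Without nodes \<open>\<rho> = 1\<close>, and \<open>\<theta> z = - z\<^sup>2\<close> contributes the Euler number
  \<open>2\<close> of the projective line.\<close>

lemma adjunction_smooth:
  assumes S: "compact_complex_surface S" and F: "normalization S F D" "immersion S F" "inj F"
    and LB: "line_bundle (space_of S) (divisor_bundle S {D} (\<lambda>_. 1))"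
    and deg: "frame_degree (divisor_bundle S {D} (\<lambda>_. 1)) F n"
  shows "frame_degree (anticanonical S) F (n + 2)"
proof -
  have sm: "smooth_at S D (F p)" for p
    by (rule smooth_at_injective_point_P1[OF S F(1,2)]) (use F(3) in \<open>auto simp: inj_eq\<close>)
  have "frame_degree (anticanonical S) F (2 + n)"
  proof (rule adjunction_degree[OF S F(1,2) LB deg, where \<rho> = "\<lambda>b z. 1" and \<theta> = "\<lambda>z. - z\<^sup>2"])
    show "immersed_curve.node_weight S (F \<circ> P1_chart b) D (\<lambda>z. 1)" for b
      unfolding immersed_curve.node_weight_def[OF normalization_immersed_curve[OF S F(1,2)]]
      using sm by simp
    show "isCont (\<lambda>z. - z\<^sup>2) z" for z :: complex by (intro continuous_intros)
    have "log_increment (\<lambda>t. -1 * (circlepath 0 1 t powi 2)) (0 + 2 * 1)"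
      by (intro log_increment_mult log_increment_const log_increment_powi log_increment_circle) simp
    then show "log_increment ((\<lambda>z. - z\<^sup>2) \<circ> circlepath 0 1) 2" by (simp add: o_def)
  qed simp
  then show ?thesis by (simp add: add.commute)
qed

text \<open>In homogeneous coordinates \<open>p = [p\<^sub>0 : p\<^sub>1]\<close>, this is the linear form
  \<open>p\<^sub>1 z\<^sub>0 - p\<^sub>0 z\<^sub>1\<close>, whose only zero is \<open>p\<close>, in the two affine
  charts \<open>[z : 1]\<close> and \<open>[1 : z]\<close>.\<close>

definition point_form :: "complex option \<Rightarrow> bool \<Rightarrow> complex \<Rightarrow> complex" where
  "point_form p b z = (case p of
     None \<Rightarrow> if b then - z else - 1
   | Some a \<Rightarrow> if b then 1 - a * z else z - a)"

lemma point_form_zero: "point_form p b z = 0 \<longleftrightarrow> P1_chart b z = p"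
  by (cases p) (auto simp: point_form_def P1_chart_def aff_inf_def field_simps)

lemma point_form_deriv:
  obtains d where "\<And>z. (point_form p b has_field_derivative d) (at z)" "\<And>z. point_form p b z = 0 \<Longrightarrow> d \<noteq> 0"
proof (rule that[of "case p of None \<Rightarrow> if b then - 1 else 0 | Some a \<Rightarrow> if b then - a else 1"])
  show "(point_form p b has_field_derivative (case p of None \<Rightarrow> if b then - 1 else 0 | Some a \<Rightarrow> if b then - a else 1)) (at z)" for z
    unfolding point_form_def[abs_def]
    by (cases p; cases b) (auto intro!: derivative_eq_intros)
  show "(case p of None \<Rightarrow> if b then - 1 else 0 | Some a \<Rightarrow> if b then - a else 1) \<noteq> (0::complex)"
    if "point_form p b z = 0" for z
    using that unfolding point_form_def by (cases p; cases b) auto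
qed

lemma point_form_inverse: "z \<noteq> 0 \<Longrightarrow> point_form p True (inverse z) * z = point_form p False z"
  by (cases p) (auto simp: point_form_def algebra_simps)

text \<open>The weight is the product of the linear forms that vanish at the two preimages of the node. As a
  form of degree \<open>2\<close> it changes by \<open>z\<^sup>2\<close> between the charts and cancels the Euler
  number.\<close>

lemma adjunction_nodal:
  assumes S: "compact_complex_surface S" and F: "normalization S F D" "immersion S F"
    and pq: "p \<noteq> q" "F p = F q" "inj_on F (- {q})" and nd: "node_at S D (F p)"
    and LB: "line_bundle (space_of S) (divisor_bundle S {D} (\<lambda>_. 1))"
    and deg: "frame_degree (divisor_bundle S {D} (\<lambda>_. 1)) F n"
  shows "frame_degree (anticanonical S) F n"
proof -
  have sm: "smooth_at S D (F r)" if r: "r \<noteq> p" "r \<noteq> q" for r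
  proof (rule smooth_at_injective_point_P1[OF S F])
    fix s assume s: "s \<noteq> r"
    show "F s \<noteq> F r"
    proof (cases "s = q")
      case True
      then show ?thesis using pq r by (metis ComplI inj_onD singletonD)
    next
      case False
      then show ?thesis using pq(3) r s by (metis ComplI inj_onD singletonD)
    qed
  qed
  let ?\<rho> = "\<lambda>b z. point_form p b z * point_form q b z"
  have "frame_degree (anticanonical S) F (0 + n)"
  proof (rule adjunction_degree[OF S F LB deg, where \<rho> = ?\<rho> and \<theta> = "\<lambda>z. - 1"])
    fix b
    obtain d where d: "\<And>z. (point_form p b has_field_derivative d) (at z)" "\<And>z. point_form p b z = 0 \<Longrightarrow> d \<noteq> 0"
      using point_form_deriv by blast
    obtain e where e: "\<And>z. (point_form q b has_field_derivative e) (at z)" "\<And>z. point_form q b z = 0 \<Longrightarrow> e \<noteq> 0"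
      using point_form_deriv by blast
    have D: "(?\<rho> b has_field_derivative point_form p b z * e + d * point_form q b z) (at z)" for z
      by (rule DERIV_mult'[OF d(1) e(1)])
    show "immersed_curve.node_weight S (F \<circ> P1_chart b) D (?\<rho> b)"
      unfolding immersed_curve.node_weight_def[OF normalization_immersed_curve[OF S F]]
    proof (intro conjI allI)
      show "?\<rho> b holomorphic_on UNIV" using D by (auto simp: holomorphic_on_open)
      fix z
      show "if ?\<rho> b z = 0 then deriv (?\<rho> b) z \<noteq> 0 \<and> node_at S D ((F \<circ> P1_chart b) z)
        else smooth_at S D ((F \<circ> P1_chart b) z)"
      proof (cases "?\<rho> b z = 0")
        case True
        have "F (P1_chart b z) = F p" using True pq(2) by (auto simp: point_form_zero)
        moreover have "point_form p b z * e + d * point_form q b z \<noteq> 0"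
        proof (cases "point_form p b z = 0")
          case True
          then have "point_form q b z \<noteq> 0" using pq(1) by (auto simp: point_form_zero)
          then show ?thesis using True d(2) by auto
        next
          case False
          then have "point_form q b z = 0" using True by simp
          then show ?thesis using False e(2) by auto
        qed
        ultimately show ?thesis using True nd DERIV_imp_deriv[OF D] by simp
      next
        case False
        then show ?thesis using sm by (auto simp: point_form_zero)
      qed
    qed
  next
    fix z :: complex assume z: "z \<noteq> 0"
    have "?\<rho> True (inverse z) * - z\<^sup>2 =
        - ((point_form p True (inverse z) * z) * (point_form q True (inverse z) * z))"
      by (simp add: power2_eq_square algebra_simps)
    then show "?\<rho> True (inverse z) * - z\<^sup>2 = - 1 * ?\<rho> False z"
      unfolding point_form_inverse[OF z] by simp
  next
    show "log_increment ((\<lambda>z. - 1) \<circ> circlepath 0 1) 0"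
      using log_increment_const[of "-1"] by (simp add: o_def)
  qed simp
  then show ?thesis by simp
qed

section \<open>The equations for the multiplicities\<close>

lemma line_bundle_trans_self:
  assumes "line_bundle X L" "i \<in> idx L" "x \<in> dom L i"
  shows "trans L i i x = 1"
proof -
  have "trans L i i x = trans L i i x * trans L i i x" "trans L i i x \<noteq> 0"
    using assms unfolding line_bundle_def by blast+
  then show ?thesis by simp
qed

lemma bundle_iso_frame_degree:
  fixes F :: "complex option \<Rightarrow> 'a" and L :: "('b, 'a) cocycle" and M :: "('c, 'a) cocycle"
  assumes iso: "bundle_iso X L M" and deg: "frame_degree L F n"
    and u: "\<And>b. continuous_map euclidean X (F \<circ> P1_chart b)"
  shows "frame_degree M F n"
proof -
  have L: "line_bundle X L" and M: "line_bundle X M" using iso unfolding bundle_iso_def by blast+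
  have "\<exists>h :: 'c \<Rightarrow> 'b \<Rightarrow> 'a \<Rightarrow> complex.
        (\<forall>j\<in>idx M. \<forall>i\<in>idx L.
           continuous_map (subtopology X (dom M j \<inter> dom L i)) euclidean (h j i) \<and>
           (\<forall>x \<in> dom M j \<inter> dom L i. h j i x \<noteq> 0)) \<and>
        (\<forall>j\<in>idx M. \<forall>j'\<in>idx M. \<forall>i\<in>idx L. \<forall>i'\<in>idx L.
           \<forall>x \<in> dom M j \<inter> dom M j' \<inter> dom L i \<inter> dom L i'.
             h j i x * trans L i i' x = trans M j j' x * h j' i' x)"
    using iso unfolding bundle_iso_def by (elim conjE)
  then obtain h :: "'c \<Rightarrow> 'b \<Rightarrow> 'a \<Rightarrow> complex" where h0:
    "\<forall>j\<in>idx M. \<forall>i\<in>idx L.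
           continuous_map (subtopology X (dom M j \<inter> dom L i)) euclidean (h j i) \<and>
           (\<forall>x \<in> dom M j \<inter> dom L i. h j i x \<noteq> 0)"
    "\<forall>j\<in>idx M. \<forall>j'\<in>idx M. \<forall>i\<in>idx L. \<forall>i'\<in>idx L.
           \<forall>x \<in> dom M j \<inter> dom M j' \<inter> dom L i \<inter> dom L i'.
             h j i x * trans L i i' x = trans M j j' x * h j' i' x"
    by (elim exE conjE)
  have h: "\<And>j i. j \<in> idx M \<Longrightarrow> i \<in> idx L \<Longrightarrow>
        continuous_map (subtopology X (dom M j \<inter> dom L i)) euclidean (h j i)"
    "\<And>j i x. j \<in> idx M \<Longrightarrow> i \<in> idx L \<Longrightarrow> x \<in> dom M j \<inter> dom L i \<Longrightarrow> h j i x \<noteq> 0"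
    "\<And>j j' i i' x. j \<in> idx M \<Longrightarrow> j' \<in> idx M \<Longrightarrow> i \<in> idx L \<Longrightarrow> i' \<in> idx L \<Longrightarrow>
       x \<in> dom M j \<inter> dom M j' \<inter> dom L i \<inter> dom L i' \<Longrightarrow> h j i x * trans L i i' x = trans M j j' x * h j' i' x"
    using h0 by blast+
  have "frame_degree M F (0 + n)"
  proof (rule frame_degree_transport[OF deg u, where H = "\<lambda>b j i z. h j i (F (P1_chart b z))" and \<theta> = "\<lambda>z. 1"])
    show "openin X (dom L i)" if "i \<in> idx L" for i using L that unfolding line_bundle_def by blast
    show "(\<Union>i\<in>idx L. dom L i) = topspace X" using L unfolding line_bundle_def by blast
    show "continuous_on {z. F (P1_chart b z) \<in> dom M j \<inter> dom L i} (\<lambda>z. h j i (F (P1_chart b z)))"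
      if "j \<in> idx M" "i \<in> idx L" for b j i
    proof -
      let ?T = "{z. F (P1_chart b z) \<in> dom M j \<inter> dom L i}"
      have "continuous_map (top_of_set ?T) (subtopology X (dom M j \<inter> dom L i)) (F \<circ> P1_chart b)"
        using u[of b] by (auto simp: continuous_map_in_subtopology intro: continuous_map_from_subtopology)
      from continuous_map_compose[OF this h(1)[OF that]]
      show ?thesis by (simp add: continuous_map_iff_continuous o_def)
    qed
    show "h j i (F (P1_chart b z)) \<noteq> 0"
      if "j \<in> idx M" "i \<in> idx L" "F (P1_chart b z) \<in> dom M j \<inter> dom L i" for b j i z
      by (rule h(2)[OF that])
    show "h j i (F (P1_chart b z)) * trans L i i' (F (P1_chart b z)) = h j i' (F (P1_chart b z))"
      if "j \<in> idx M" "i \<in> idx L" "i' \<in> idx L" "F (P1_chart b z) \<in> dom M j \<inter> dom L i \<inter> dom L i'" for b j i i' z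
      using h(3)[OF that(1,1,2,3), of "F (P1_chart b z)"] line_bundle_trans_self[OF M that(1)] that(4) by auto
    show "h j i (F (P1_chart b z)) = trans M j j' (F (P1_chart b z)) * h j' i (F (P1_chart b z))"
      if "j \<in> idx M" "j' \<in> idx M" "i \<in> idx L" "F (P1_chart b z) \<in> dom M j \<inter> dom M j' \<inter> dom L i" for b j j' i z
      using h(3)[OF that(1,2,3,3), of "F (P1_chart b z)"] line_bundle_trans_self[OF L that(3)] that(4) by auto
    show "log_increment ((\<lambda>z. 1) \<circ> circlepath 0 1) 0" using log_increment_one by (simp add: o_def)
    show "h j i (F (P1_chart True (inverse z))) = 1 * h j i (F (P1_chart False z))"
      if "z \<in> sphere 0 1" for j i z
    proof -
      have "z \<noteq> 0" using that by auto
      then show ?thesis by (simp add: aff_inf_inverse)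
    qed
  qed
  then show ?thesis by simp
qed

lemma intersection_number_frame_degree:
  assumes "intersection_number S E D n" "normalization S F D"
  shows "frame_degree (divisor_bundle S {E} (\<lambda>_. 1)) F n"
    and "line_bundle (space_of S) (divisor_bundle S {E} (\<lambda>_. 1))"
proof -
  have hd: "has_degree (space_of S) (divisor_bundle S {E} (\<lambda>_. 1)) F n"
    using assms unfolding intersection_number_def by blast
  then show "line_bundle (space_of S) (divisor_bundle S {E} (\<lambda>_. 1))"
    unfolding has_degree_def by blast
  have "holo_path S (F \<circ> Some)" using assms(2) unfolding normalization_def by blast
  from holo_path_topspace[OF this] have "F (Some z) \<in> topspace (space_of S)" for z by simp
  then show "frame_degree (divisor_bundle S {E} (\<lambda>_. 1)) F n"
    by (rule has_degree_frame_degree[OF hd])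
qed

lemma anticanonical_degree_smooth:
  assumes "compact_complex_surface S" "smooth_rational S D" "intersection_number S D D n"
  shows "\<exists>F. normalization S F D \<and> frame_degree (anticanonical S) F (n + 2)"
proof -
  obtain F where F: "normalization S F D" "immersion S F" "inj F"
    using assms(2) unfolding smooth_rational_def by blast
  show ?thesis
    using adjunction_smooth[OF assms(1) F intersection_number_frame_degree(2,1)[OF assms(3) F(1)]] F(1) by blast
qed

lemma anticanonical_degree_nodal:
  assumes "compact_complex_surface S" "nodal_rational S D" "intersection_number S D D n"
  shows "\<exists>F. normalization S F D \<and> frame_degree (anticanonical S) F n"
proof -
  obtain F p q W \<zeta> where F: "normalization S F D" "immersion S F" "p \<noteq> q" "F p = F q" "inj_on F (- {q})"
    and W: "holo_chart S (W, \<zeta>)" "F p \<in> W" "\<zeta> (F p) = 0" "\<forall>y\<in>W. y \<in> D \<longleftrightarrow> \<zeta> y $ 1 = 0 \<or> \<zeta> y $ 2 = 0"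
    using assms(2) unfolding nodal_rational_def by blast
  have "node_at S D (F p)" unfolding node_at_def
    by (rule exI[of _ "(W, \<zeta>)"]) (use W in simp)
  then show ?thesis
    using adjunction_nodal[OF assms(1) F _ intersection_number_frame_degree(2,1)[OF assms(3) F(1)]] F(1) by blast
qed

text \<open>Both sides of \<open>-N K = \<Sum>E. N d E * E\<close> are evaluated on \<open>D\<close> by degrees, and
  \<open>N\<close> is cancelled.\<close>

lemma multiplicities_degree:
  assumes d: "anticanonical_multiplicities S d" and fin: "finite (rational_curves S)"
    and F: "normalization S F D" and K: "frame_degree (anticanonical S) F k"
    and n: "\<And>E. E \<in> rational_curves S \<Longrightarrow> intersection_number S E D (n E)"
  shows "(\<Sum>E\<in>rational_curves S. d E * of_int (n E)) = of_int k"
proof -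
  obtain N where N: "N > 0" "\<And>E. E \<in> rational_curves S \<Longrightarrow> of_nat N * d E \<in> \<int>"
    "bundle_iso (space_of S) (bundle_power (anticanonical S) N)
       (divisor_bundle S (rational_curves S) (\<lambda>E. \<lfloor>of_nat N * d E\<rfloor>))" (is "bundle_iso ?X ?L ?M")
    using d unfolding anticanonical_multiplicities_def by blast
  have u: "continuous_map euclidean ?X (F \<circ> P1_chart b)" for b
    using normalization_holo_path[OF F, of b] unfolding holo_path_def by blast
  have M: "line_bundle ?X ?M" using N(3) unfolding bundle_iso_def by blast
  have "frame_degree ?M F (int N * k)"
    by (rule bundle_iso_frame_degree[OF N(3) frame_degree_power[OF K] u])
  moreover have "frame_degree ?M F (\<Sum>E\<in>rational_curves S. \<lfloor>of_nat N * d E\<rfloor> * n E)"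
    by (rule frame_degree_divisor[OF fin intersection_number_frame_degree(1)[OF n F]])
  ultimately have "int N * k = (\<Sum>E\<in>rational_curves S. \<lfloor>of_nat N * d E\<rfloor> * n E)"
  proof (rule frame_degree_unique)
    show "continuous_map euclidean ?X (F \<circ> P1_chart b)" for b by (rule u)
    show "openin ?X (dom ?M i)" if "i \<in> idx ?M" for i using M that unfolding line_bundle_def by blast
    show "(\<Union>i\<in>idx ?M. dom ?M i) = topspace ?X" using M unfolding line_bundle_def by blast
  qed
  then have "of_int (int N * k) = (of_int (\<Sum>E\<in>rational_curves S. \<lfloor>of_nat N * d E\<rfloor> * n E) :: rat)"
    by (simp only:)
  also have "\<dots> = (\<Sum>E\<in>rational_curves S. of_int \<lfloor>of_nat N * d E\<rfloor> * of_int (n E))"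
    by simp
  also have "\<dots> = (\<Sum>E\<in>rational_curves S. (of_nat N * d E) * of_int (n E))"
  proof (rule sum.cong[OF refl])
    fix E assume "E \<in> rational_curves S"
    from N(2)[OF this] show "of_int \<lfloor>of_nat N * d E\<rfloor> * of_int (n E) = (of_nat N * d E) * of_int (n E)"
      by (auto elim!: Ints_cases)
  qed
  also have "\<dots> = of_nat N * (\<Sum>E\<in>rational_curves S. d E * of_int (n E))"
    by (simp add: sum_distrib_left mult.assoc)
  finally show ?thesis using N(1) by simp
qed

text \<open>By adjunction the anticanonical degree of the \<open>i\<close>-th curve is \<open>2 - e ! i\<close>, for smooth
  and for nodal curves alike. The intersection numbers also have one form in both cases: a loop of
  the dual graph contributes \<open>2\<close> to \<open>- e ! i\<close>.\<close>

lemma dloussky_equation: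
  assumes S: "compact_complex_surface S" and dl: "dloussky_sequence S e D"
    and d: "anticanonical_multiplicities S d" and i: "i < length e"
  shows "of_nat (e ! i) * d (D i) = of_nat (e ! i) - 2 + d (D (dl_next e i))
    + (\<Sum>j | j < length e \<and> dl_next e j = i. d (D j))"
proof -
  let ?b = "length e"
  have bij: "bij_betw D {..<?b} (rational_curves S)" using dl unfolding dloussky_sequence_def by blast
  have fin: "finite (rational_curves S)" using bij_betw_finite[OF bij] by simp
  (* for j = i and a loop the two summands give the 2 of the nodal case *)
  define n where "n j = of_bool (dl_next e j = i) + of_bool (dl_next e i = j) - int (e ! i) * of_bool (j = i)" for j
  have nxt: "dl_next e i < ?b" using i unfolding dl_next_def by (intro mod_less_divisor) auto
  have self: "intersection_number S (D i) (D i) (n i)" and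
    deg: "\<exists>F. normalization S F (D i) \<and> frame_degree (anticanonical S) F (2 - int (e ! i))"
  proof -
    have *: "if dl_next e i = i
        then nodal_rational S (D i) \<and> intersection_number S (D i) (D i) (- int (e ! i) + 2)
        else smooth_rational S (D i) \<and> intersection_number S (D i) (D i) (- int (e ! i))"
      using dl i unfolding dloussky_sequence_def by blast
    then show "intersection_number S (D i) (D i) (n i)"
      unfolding n_def by (simp add: add.commute split: if_splits)
    show "\<exists>F. normalization S F (D i) \<and> frame_degree (anticanonical S) F (2 - int (e ! i))"
      using * anticanonical_degree_smooth[OF S, of "D i" "- int (e ! i)"]
        anticanonical_degree_nodal[OF S, of "D i" "- int (e ! i) + 2"]
      by (simp split: if_splits)
  qed
  obtain F where F: "normalization S F (D i)" "frame_degree (anticanonical S) F (2 - int (e ! i))"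
    using deg by blast
  have int: "intersection_number S (D j) (D i) (n j)" if "j < ?b" for j
  proof (cases "j = i")
    case False
    then have "intersection_number S (D j) (D i) (of_bool (dl_next e j = i) + of_bool (dl_next e i = j))"
      using dl i that unfolding dloussky_sequence_def by blast
    then show ?thesis using False unfolding n_def by simp
  qed (use self in simp)
  define m where "m E = n (the_inv_into {..<?b} D E)" for E
  have mD: "m (D j) = n j" if "j < ?b" for j
    unfolding m_def using the_inv_into_f_f[OF bij_betw_imp_inj_on[OF bij]] that by simp
  have "(\<Sum>E\<in>rational_curves S. d E * of_int (m E)) = of_int (2 - int (e ! i))"
  proof (rule multiplicities_degree[OF d fin F])
    fix E assume "E \<in> rational_curves S"
    then obtain j where "j < ?b" "E = D j" using bij unfolding bij_betw_def by auto
    then show "intersection_number S E (D i) (m E)" using int mD by simp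
  qed
  also have "(\<Sum>E\<in>rational_curves S. d E * of_int (m E)) = (\<Sum>j<?b. d (D j) * of_int (m (D j)))"
    by (rule sum.reindex_bij_betw[OF bij, symmetric])
  also have "\<dots> = (\<Sum>j<?b. d (D j) * of_int (n j))" by (rule sum.cong) (auto simp: mD)
  also have "\<dots> = (\<Sum>j<?b. (if dl_next e j = i then d (D j) else 0) + (if j = dl_next e i then d (D j) else 0)
      - (if j = i then of_nat (e ! i) * d (D j) else 0))"
    by (rule sum.cong) (auto simp: n_def algebra_simps)
  also have "\<dots> = (\<Sum>j<?b. if dl_next e j = i then d (D j) else 0) + d (D (dl_next e i)) - of_nat (e ! i) * d (D i)"
    using i nxt by (simp add: sum.distrib sum_subtractf)
  also have "(\<Sum>j<?b. if dl_next e j = i then d (D j) else 0) = (\<Sum>j | j < ?b \<and> dl_next e j = i. d (D j))"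
    by (subst sum.inter_filter[symmetric]) (auto intro: sum.cong)
  finally show ?thesis by (simp add: algebra_simps)
qed

section \<open>Positions in a simple sequence\<close>

text \<open>This relates the polynomials \<open>P\<close> to continuants, which satisfy a second order
  recursion.\<close>

lemma f_rev_P_rev: "xs \<noteq> [] \<Longrightarrow> f_rev xs + f_rev (tl xs) = P_rev xs + (1::nat)"
  by (induction xs rule: f_rev.induct) (auto simp: algebra_simps)

text \<open>As long as the signs alternate, the absolute values of every other term decrease, so negative terms
  stay above the initial value \<open>-1\<close>. The alternation can stop only with two consecutive
  terms of the same sign, and then the sign is kept from there on; a sign \<open>\<le> 0\<close> is excluded by
  the last two terms.\<close>

lemma alternating_sequence_bound:
  fixes y :: "nat \<Rightarrow> rat" and k :: "nat \<Rightarrow> nat"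
  assumes y0: "y 0 = -1" and y1: "y 1 > 0"
    and rec: "\<And>l. l < p \<Longrightarrow> y (l + 2) = y l + of_nat (k l) * y (l + 1)"
    and k: "\<And>l. l < p \<Longrightarrow> k l \<ge> 1" and pos: "y (p + 1) + y p > 0" and l: "l \<le> p"
  shows "y l \<ge> -1" and "y (l + 1) > -1"
proof -
  have kk: "of_nat (k l) \<ge> (1::rat)" if "l < p" for l
    using k[OF that] by simp
  have bad: "y l' \<le> 0 \<and> y (l' + 1) \<le> 0" if "y l \<le> 0" "y (l + 1) \<le> 0" "l \<le> l'" "l' \<le> p" for l l'
    using that(3,4)
  proof (induction l' rule: dec_induct)
    case base
    then show ?case using that by simp
  next
    case (step n)
    have "of_nat (k n) * y (n + 1) \<le> 0" using step kk[of n] by (intro mult_nonneg_nonpos) auto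
    then show ?case using step rec[of n] by simp
  qed
  have nbad: "\<not> (y l \<le> 0 \<and> y (l + 1) \<le> 0)" if "l \<le> p" for l
  proof
    assume "y l \<le> 0 \<and> y (l + 1) \<le> 0"
    then have "y p \<le> 0 \<and> y (p + 1) \<le> 0" using bad[OF _ _ that order_refl] by blast
    then show False using pos by linarith
  qed
  have "(y l \<ge> 0 \<and> y (l + 1) \<ge> 0) \<or> (-1 \<le> y l \<and> y l < 0 \<and> 0 < y (l + 1))
      \<or> (y l > 0 \<and> -1 < y (l + 1) \<and> y (l + 1) < 0)"
    using l
  proof (induction l)
    case 0
    then show ?case using y0 y1 by simp
  next
    case (Suc l)
    then have lp: "l < p" by simp
    note r = rec[OF lp]
    from Suc consider "y l \<ge> 0" "y (l + 1) \<ge> 0" | "-1 \<le> y l" "y l < 0" "0 < y (l + 1)"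
      | "y l > 0" "-1 < y (l + 1)" "y (l + 1) < 0" by auto
    then show ?case
    proof cases
      case 1
      have "of_nat (k l) * y (l + 1) \<ge> 0" using 1 by simp
      then show ?thesis using r 1 by simp
    next
      case 2
      have "of_nat (k l) * y (l + 1) > 0" using 2 kk[OF lp] by (intro mult_pos_pos) auto
      then show ?thesis using r 2 by auto
    next
      case 3
      then show ?thesis using nbad[of "Suc l"] Suc by auto
    qed
  qed
  then show "y l \<ge> -1" and "y (l + 1) > -1" by auto
qed

locale simple_dloussky =
  fixes ks :: "nat list" and m :: nat
  assumes ne: "ks \<noteq> []" and kpos: "\<forall>k\<in>set ks. k \<ge> 1" and m: "m \<ge> 1"
begin

abbreviation "p \<equiv> length ks"
abbreviation "e \<equiv> simple_sequence ks m"
abbreviation "b \<equiv> length e"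

text \<open>The position at which the block of \<open>ks ! l\<close> begins; \<open>pos (length ks)\<close> is the beginning
  of the final entries \<open>2\<close>.\<close>

definition pos :: "nat \<Rightarrow> nat" where "pos l = sum_list (take l ks)"

lemma k1: "l < p \<Longrightarrow> ks ! l \<ge> 1" using kpos by simp

lemma pos_0 [simp]: "pos 0 = 0" by (simp add: pos_def)

lemma pos_Suc: "l < p \<Longrightarrow> pos (Suc l) = pos l + ks ! l"
  by (simp add: pos_def take_Suc_conv_app_nth)

lemma length_concat_blocks: "\<forall>k\<in>set xs. k \<ge> 1 \<Longrightarrow> length (concat (map s_block xs)) = sum_list xs"
  by (induction xs) (auto simp: s_block_def)

lemma b_eq: "b = pos p + m"
  using length_concat_blocks[OF kpos] by (simp add: simple_sequence_def pos_def)

lemma pos_less: "l < l' \<Longrightarrow> l' \<le> p \<Longrightarrow> pos l < pos l'"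
proof (induction l' rule: nat_induct)
  case (Suc n)
  then have "pos n < pos (Suc n)" using pos_Suc[of n] k1[of n] by simp
  then show ?case using Suc by (cases "l = n") auto
qed simp

lemma pos_inj: "l \<le> p \<Longrightarrow> l' \<le> p \<Longrightarrow> pos l = pos l' \<longleftrightarrow> l = l'"
  using pos_less[of l l'] pos_less[of l' l] by (cases l l' rule: linorder_cases) auto

lemma pos_le: "l \<le> l' \<Longrightarrow> l' \<le> p \<Longrightarrow> pos l \<le> pos l'"
  using pos_less[of l l'] by (cases "l = l'") auto

lemma concat_blocks_nth:
  "\<forall>k\<in>set xs. k \<ge> 1 \<Longrightarrow> l < length xs \<Longrightarrow> j < xs ! l \<Longrightarrow>
    concat (map s_block xs) ! (sum_list (take l xs) + j) = (if j = 0 then xs ! l + 2 else 2)"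
proof (induction xs arbitrary: l)
  case (Cons a xs)
  have la: "length (s_block a) = a" using Cons.prems(1) by (simp add: s_block_def)
  show ?case
  proof (cases l)
    case 0
    then show ?thesis using Cons.prems la by (auto simp: nth_append s_block_def nth_Cons')
  next
    case (Suc n)
    then show ?thesis using Cons la by (simp add: nth_append add.assoc)
  qed
qed simp

lemma e_block: "l < p \<Longrightarrow> j < ks ! l \<Longrightarrow> e ! (pos l + j) = (if j = 0 then ks ! l + 2 else 2)"
proof -
  assume l: "l < p" and j: "j < ks ! l"
  have "pos l + j < pos (Suc l)" using pos_Suc[OF l] j by simp
  also have "\<dots> \<le> pos p" using pos_le[of "Suc l" p] l by simp
  finally have "pos l + j < length (concat (map s_block ks))"
    using length_concat_blocks[OF kpos] by (simp add: pos_def)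
  then show ?thesis using concat_blocks_nth[OF kpos l j]
    unfolding simple_sequence_def pos_def by (simp add: nth_append)
qed

lemma e_start: "l < p \<Longrightarrow> e ! (pos l) = ks ! l + 2"
  using e_block[of l 0] k1[of l] by simp

lemma e_tail: "pos p \<le> i \<Longrightarrow> i < b \<Longrightarrow> e ! i = 2"
  using length_concat_blocks[OF kpos] b_eq unfolding simple_sequence_def pos_def by (simp add: nth_append)

lemma block_cases: "i < pos l' \<Longrightarrow> l' \<le> p \<Longrightarrow> \<exists>l j. l < l' \<and> j < ks ! l \<and> i = pos l + j"
proof (induction l')
  case (Suc n)
  show ?case
  proof (cases "i < pos n")
    case True
    then show ?thesis using Suc by (meson Suc_leD less_SucI)
  next
    case False
    then show ?thesis using Suc.prems pos_Suc[of n] by (intro exI[of _ n] exI[of _ "i - pos n"]) auto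
  qed
qed simp

text \<open>The target of an edge before it is reduced modulo the length. It lies between \<open>1\<close> and the
  length, so positions in this range represent the curves, with the length itself in place of
  \<open>0\<close>.\<close>

definition nx :: "nat \<Rightarrow> nat" where "nx i = i + (e ! i - 1)"

lemma nx_start: "l < p \<Longrightarrow> nx (pos l) = pos (Suc l) + 1"
  by (simp add: nx_def e_start pos_Suc)

lemma pos_lt_b: "l \<le> p \<Longrightarrow> pos l < b"
  using pos_le[of l p] b_eq m by simp

lemma nx_other: 
  assumes "i < b" "\<And>l. l < p \<Longrightarrow> i \<noteq> pos l" shows "nx i = i + 1"
proof (cases "i < pos p")
  case True
  then obtain l j where "l < p" "j < ks ! l" "i = pos l + j" using block_cases[of i p] by auto
  then show ?thesis using assms(2)[of l] e_block[of l j] by (auto simp: nx_def)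
qed (use assms e_tail in \<open>simp add: nx_def\<close>)

lemma nx_bound: assumes "i < b" shows "1 \<le> nx i" "nx i \<le> b"
proof -
  consider l where "l < p" "i = pos l" | "nx i = i + 1" using nx_other[OF assms] by blast
  then have "1 \<le> nx i \<and> nx i \<le> b"
  proof cases
    case 1
    then show ?thesis using nx_start pos_lt_b[of "Suc l"] by auto
  qed (use assms in auto)
  then show "1 \<le> nx i" "nx i \<le> b" by auto
qed

lemma dl_next_nx: "dl_next e i = nx i mod b" by (simp add: dl_next_def nx_def)

lemma mod_b_eq: "1 \<le> i \<Longrightarrow> i \<le> b \<Longrightarrow> 1 \<le> j \<Longrightarrow> j \<le> b \<Longrightarrow> i mod b = j mod b \<longleftrightarrow> i = j"
  by (cases "i = b"; cases "j = b") auto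

lemma pred_dl_next: "1 \<le> i \<Longrightarrow> i \<le> b \<Longrightarrow> {j. j < b \<and> dl_next e j = i mod b} = {j. j < b \<and> nx j = i}"
  using nx_bound mod_b_eq unfolding dl_next_nx by blast

text \<open>The edge from the beginning of a block ends one position after the beginning of the next block;
  all other edges lead to the next position. So only the positions \<open>pos l + 1\<close> deviate
  from having the preceding position as their unique preimage in the dual graph.\<close>

lemma pred_start: "0 < l \<Longrightarrow> l < p \<Longrightarrow> {j. j < b \<and> nx j = pos l + 1} = {pos (l - 1)}"
proof (intro equalityI subsetI)
  fix j assume l: "0 < l" "l < p" and j: "j \<in> {j. j < b \<and> nx j = pos l + 1}"
  show "j \<in> {pos (l - 1)}"
  proof (cases "\<exists>l'<p. j = pos l'")
    case True
    then obtain l' where l': "l' < p" "j = pos l'" by blast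
    then have "pos (Suc l') = pos l" using j nx_start by simp
    then have "Suc l' = l" using pos_inj l l' by simp
    then show ?thesis using l' by auto
  next
    case False
    then have "j = pos l" using j nx_other[of j] by auto
    then show ?thesis using False l by blast
  qed
next
  fix j assume l: "0 < l" "l < p" and "j \<in> {pos (l - 1)}"
  then show "j \<in> {j. j < b \<and> nx j = pos l + 1}"
    using nx_start[of "l - 1"] pos_lt_b[of "l - 1"] by simp
qed

lemma pred_tip: "{j. j < b \<and> nx j = 1} = {}"
proof -
  have False if "j < b" "nx j = 1" for j
  proof (cases "\<exists>l'<p. j = pos l'")
    case True
    then obtain l' where l': "l' < p" "j = pos l'" by blast
    then have "pos (Suc l') = 0" using that nx_start by simp
    then show False using pos_less[of 0 "Suc l'"] l' by simp
  next
    case False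
    then have "j = 0" using that nx_other[of j] by auto
    then show False using False ne by auto
  qed
  then show ?thesis by blast
qed

lemma p_pos: "0 < p" using ne by simp

lemma pred_root: "{j. j < b \<and> nx j = pos p + 1} = {pos p, pos (p - 1)}"
proof (intro equalityI subsetI)
  fix j assume j: "j \<in> {j. j < b \<and> nx j = pos p + 1}"
  show "j \<in> {pos p, pos (p - 1)}"
  proof (cases "\<exists>l'<p. j = pos l'")
    case True
    then obtain l' where l': "l' < p" "j = pos l'" by blast
    then have "pos (Suc l') = pos p" using j nx_start by simp
    then have "l' = p - 1" using pos_inj[of "Suc l'" p] l' by simp
    then show ?thesis using l' by auto
  next
    case False
    then show ?thesis using j nx_other[of j] by auto
  qed
next
  fix j assume j: "j \<in> {pos p, pos (p - 1)}"
  have "nx (pos p) = pos p + 1" using e_tail[of "pos p"] pos_lt_b[of p] by (simp add: nx_def)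
  then show "j \<in> {j. j < b \<and> nx j = pos p + 1}"
    using j nx_start[of "p - 1"] pos_lt_b[of "p - 1"] pos_lt_b[of p] p_pos by auto
qed

lemma pred_other:
  assumes i: "1 \<le> i" "i \<le> b" "\<And>l. l \<le> p \<Longrightarrow> i \<noteq> pos l + 1"
  shows "{j. j < b \<and> nx j = i} = {i - 1}"
proof (intro equalityI subsetI)
  fix j assume j: "j \<in> {j. j < b \<and> nx j = i}"
  show "j \<in> {i - 1}"
  proof (cases "\<exists>l'<p. j = pos l'")
    case True
    then obtain l' where l': "l' < p" "j = pos l'" by blast
    then show ?thesis using j nx_start[of l'] i(3)[of "Suc l'"] by simp
  next
    case False
    then show ?thesis using j nx_other[of j] by auto
  qed
next
  fix j assume "j \<in> {i - 1}"
  moreover have "i - 1 \<noteq> pos l" if "l < p" for l using i(3)[of l] i(1) that by auto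
  ultimately show "j \<in> {j. j < b \<and> nx j = i}" using nx_other[of "i - 1"] i by auto
qed

lemma dl_next_step: "l < p \<Longrightarrow> 0 < j \<Longrightarrow> j < ks ! l \<Longrightarrow> dl_next e (pos l + j) = pos l + j + 1"
proof -
  assume a: "l < p" "0 < j" "j < ks ! l"
  have "nx (pos l + j) = pos l + j + 1" using e_block[OF a(1,3)] a(2) by (simp add: nx_def)
  moreover have "pos l + j + 1 < b"
    using a pos_Suc[OF a(1)] pos_lt_b[of "Suc l"] by simp
  ultimately show ?thesis by (simp add: dl_next_nx)
qed

lemma dl_next_block: "l < p \<Longrightarrow> j < ks ! l \<Longrightarrow> (dl_next e ^^ j) (pos l + 1) = pos l + 1 + j"
proof (induction j)
  case (Suc j)
  then show ?case using dl_next_step[of l "Suc j"] by simp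
qed simp

text \<open>\<open>odd_sum (length ks)\<close> is \<open>\<beta>\<close>; the partial sums describe the way from the first curve
  to the root.\<close>

definition odd_sum :: "nat \<Rightarrow> nat" where "odd_sum l = (\<Sum>i | i < l \<and> odd i. ks ! i)"

lemma odd_sum_Suc: "odd_sum (Suc l) = odd_sum l + (if odd l then ks ! l else 0)"
proof -
  have "{i. i < Suc l \<and> odd i} = {i. i < l \<and> odd i} \<union> (if odd l then {l} else {})" by (auto simp: less_Suc_eq)
  then show ?thesis unfolding odd_sum_def by (auto simp: sum.union_disjoint)
qed

text \<open>From the beginning of an even block, one edge leads just past the beginning of the following odd
  block, and the remaining positions of that block are then run through one by one.\<close>

lemma cycle_position: "2 * l \<le> p \<Longrightarrow> (dl_next e ^^ odd_sum (2 * l)) 0 = pos (2 * l)"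
proof (induction l)
  case 0
  then show ?case by (simp add: odd_sum_def)
next
  case (Suc l)
  let ?a = "2 * l"
  have a: "?a < p" "Suc ?a < p" using Suc.prems by auto
  have s: "odd_sum (2 * Suc l) = (ks ! Suc ?a - 1) + Suc (odd_sum ?a)"
    using k1[OF a(2)] by (simp add: odd_sum_Suc)
  have "dl_next e (pos ?a) = pos (Suc ?a) + 1"
    using nx_start[OF a(1)] pos_Suc[OF a(2)] k1[OF a(2)] pos_lt_b[of "Suc (Suc ?a)"] a
    by (cases "ks ! Suc ?a") (auto simp: dl_next_nx)
  then have "(dl_next e ^^ odd_sum (2 * Suc l)) 0 = (dl_next e ^^ (ks ! Suc ?a - 1)) (pos (Suc ?a) + 1)"
    unfolding s funpow_add using Suc by simp
  also have "\<dots> = pos (Suc ?a) + 1 + (ks ! Suc ?a - 1)"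
    by (rule dl_next_block[OF a(2)]) (use k1[OF a(2)] in simp)
  also have "\<dots> = pos (2 * Suc l)" using pos_Suc[OF a(2)] k1[OF a(2)] by simp
  finally show ?case .
qed

lemma root_position: "(dl_next e ^^ (beta ks + 1)) 0 = (pos p + 1) mod b"
proof -
  have beta: "beta ks = odd_sum p" by (simp add: beta_def odd_sum_def)
  have "dl_next e ((dl_next e ^^ odd_sum p) 0) = (pos p + 1) mod b"
  proof (cases "even p")
    case True
    then have "(dl_next e ^^ odd_sum p) 0 = pos p" using cycle_position[of "p div 2"] by simp
    moreover have "nx (pos p) = pos p + 1" using e_tail[of "pos p"] pos_lt_b[of p] by (simp add: nx_def)
    ultimately show ?thesis by (simp add: dl_next_nx)
  next
    case False
    then obtain n where n: "p = Suc (2 * n)" by (metis oddE Suc_eq_plus1)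
    have "odd_sum p = odd_sum (2 * n)" unfolding n odd_sum_Suc by simp
    then have "(dl_next e ^^ odd_sum p) 0 = pos (2 * n)" using cycle_position[of n] n by simp
    then show ?thesis using nx_start[of "2 * n"] n by (simp add: dl_next_nx)
  qed
  then show ?thesis by (simp add: beta)
qed

end

section \<open>Solution of the linear system\<close>

locale simple_multiplicities = simple_dloussky +
  fixes x :: "nat \<Rightarrow> rat"
  assumes eq: "\<And>i. i < length (simple_sequence ks m) \<Longrightarrow>
    of_nat (simple_sequence ks m ! i) * x i = of_nat (simple_sequence ks m ! i) - 2
      + x (dl_next (simple_sequence ks m) i)
      + (\<Sum>j | j < length (simple_sequence ks m) \<and> dl_next (simple_sequence ks m) j = i. x j)"
begin

text \<open>The multiplicities continued to all positions, in particular to \<open>b\<close>, which stands for \<open>0\<close>.\<close>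

definition val :: "nat \<Rightarrow> rat" where "val i = x (i mod b)"

definition pred_sum :: "nat \<Rightarrow> rat" where "pred_sum i = (\<Sum>j | j < b \<and> nx j = i. x j)"

lemma val_less: "i < b \<Longrightarrow> val i = x i" by (simp add: val_def)

lemma val_b: "val b = val 0" by (simp add: val_def)

lemma val_equation:
  assumes "1 \<le> i" "i \<le> b"
  shows "of_nat (e ! (i mod b)) * val i = of_nat (e ! (i mod b)) - 2 + val (nx (i mod b)) + pred_sum i"
proof -
  have "i mod b < b" using assms by (intro mod_less_divisor) auto
  from eq[OF this] show ?thesis
    unfolding val_def pred_sum_def pred_dl_next[OF assms, symmetric] by (simp add: dl_next_nx)
qed

text \<open>The multiplicity at the beginning of the block \<open>l - 1\<close>. The shift of the index makes room
  for the value \<open>0\<close> at an imaginary block \<open>-1\<close>, which accounts for the missing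
  neighbour of the tip.\<close>

definition start_val :: "nat \<Rightarrow> rat" where "start_val l = (case l of 0 \<Rightarrow> 0 | Suc l \<Rightarrow> val (pos l))"

definition root_mult :: rat where "root_mult = val (pos p + 1)"

text \<open>The increment of the multiplicities in the block \<open>l - 1\<close>. For \<open>l = 0\<close> it is the
  increment in the final entries \<open>2\<close>, which precede the first block cyclically. For
  \<open>l = length ks + 1\<close> it compares the root with the beginning of the last block.\<close>

definition incr :: "nat \<Rightarrow> rat" where
  "incr l = (case l of 0 \<Rightarrow> root_mult - start_val (p + 1) - start_val p | Suc l \<Rightarrow> val (pos l + 1) - start_val l)"

lemma start_val_simps [simp]: "start_val 0 = 0" "start_val (Suc l) = val (pos l)" by (simp_all add: start_val_def)

lemma pred_sum_first: "l < p \<Longrightarrow> pred_sum (pos l + 1) = start_val l"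
proof (cases l)
  case 0
  have "pred_sum 1 = 0" unfolding pred_sum_def pred_tip by simp
  then show ?thesis using 0 by simp
next
  case (Suc n)
  assume "l < p"
  then show ?thesis using pred_start[of l] Suc pos_lt_b[of n] by (simp add: pred_sum_def val_less)
qed

lemma pred_sum_other: "1 \<le> i \<Longrightarrow> i \<le> b \<Longrightarrow> (\<And>l. l \<le> p \<Longrightarrow> i \<noteq> pos l + 1) \<Longrightarrow> pred_sum i = val (i - 1)"
  using pred_other[of i] by (simp add: pred_sum_def val_less)

lemma pred_sum_root: "pred_sum (pos p + 1) = start_val (p + 1) + start_val p"
proof -
  have "p \<noteq> p - 1" using p_pos by linarith
  then have "pos p \<noteq> pos (p - 1)" using pos_inj[of p "p - 1"] by simp
  moreover have "start_val p = val (pos (p - 1))" using p_pos by (cases p) auto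
  ultimately show ?thesis using pred_root pos_lt_b[of p] pos_lt_b[of "p - 1"] by (simp add: pred_sum_def val_less)
qed

lemma not_first:
  assumes "l < p" "2 \<le> j" "j \<le> ks ! l" "l' \<le> p" shows "pos l + j \<noteq> pos l' + 1"
proof
  assume a: "pos l + j = pos l' + 1"
  then have "pos l < pos l'" "pos l' < pos (Suc l)" using assms pos_Suc[of l] by auto
  then have "l < l'" "l' < Suc l"
    using pos_le[of l' l] pos_le[of "Suc l" l'] assms by (force intro: leI)+
  then show False by simp
qed

lemma not_first_tail:
  assumes "2 \<le> j" "l' \<le> p" shows "pos p + j \<noteq> pos l' + 1"
  using pos_le[of l' p] assms by simp

text \<open>An entry \<open>2\<close> expresses that the multiplicity is the mean of its two neighbours. So along a block
  the multiplicities form an arithmetic progression; it starts with the curve at the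
  beginning of the preceding block.\<close>

lemma block_progression:
  assumes l: "l < p" shows "1 \<le> j \<Longrightarrow> j \<le> ks ! l \<Longrightarrow>
    val (pos l + j) = start_val l + of_nat j * incr (Suc l) \<and> pred_sum (pos l + j) = start_val l + (of_nat j - 1) * incr (Suc l)"
proof (induction j rule: nat_induct_at_least)
  case base
  then show ?case using pred_sum_first[OF l] by (simp add: incr_def)
next
  case (Suc j)
  then have j: "1 \<le> j" "j < ks ! l" by auto
  have ib: "pos l + Suc j < b" using j pos_Suc[OF l] pos_lt_b[of "Suc l"] l by simp
  have IH: "val (pos l + j) = start_val l + of_nat j * incr (Suc l)" "pred_sum (pos l + j) = start_val l + (of_nat j - 1) * incr (Suc l)"
    using Suc.IH j by auto
  have e2: "e ! (pos l + j) = 2" using e_block[OF l j(2)] j by simp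
  have "2 * val (pos l + j) = val (pos l + j + 1) + pred_sum (pos l + j)"
    using val_equation[of "pos l + j"] e2 ib j by (simp add: nx_def)
  then have "val (pos l + Suc j) = start_val l + of_nat (Suc j) * incr (Suc l)"
    unfolding IH by (simp add: algebra_simps)
  moreover have "pred_sum (pos l + Suc j) = val (pos l + Suc j - 1)"
    by (rule pred_sum_other) (use not_first[OF l, of "Suc j"] j ib in auto)
  then have "pred_sum (pos l + Suc j) = start_val l + (of_nat (Suc j) - 1) * incr (Suc l)"
    using IH by simp
  ultimately show ?case by simp
qed

lemma start_val_rec: "l < p \<Longrightarrow> start_val (l + 2) = start_val l + of_nat (ks ! l) * incr (Suc l)"
  using block_progression[of l "ks ! l"] k1[of l] pos_Suc[of l] by simp

lemma pred_sum_start: "l < p \<Longrightarrow> pred_sum (pos (Suc l)) = start_val (l + 2) - incr (Suc l)"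
  using block_progression[of l "ks ! l"] k1[of l] pos_Suc[of l] start_val_rec[of l] by (simp add: algebra_simps)

lemma root_mult_eq: "root_mult = start_val (p + 1) + incr p"
proof -
  obtain n where n: "p = Suc n" using p_pos by (cases p) auto
  have "1 \<le> pos p" using pos_less[of 0 p] p_pos by simp
  then have "2 * val (pos p) = val (pos p + 1) + pred_sum (pos p)"
    using val_equation[of "pos p"] e_tail[of "pos p"] pos_lt_b[of p] by (simp add: nx_def)
  moreover have "pred_sum (pos p) = start_val (p + 1) - incr p" using pred_sum_start[of n] n by simp
  ultimately show ?thesis by (simp add: root_mult_def)
qed

text \<open>The same for the final entries \<open>2\<close>. The first of these equations belongs to the root, and
  \<open>incr 0\<close> takes the multiplicities of its two other neighbours into account.\<close>

lemma tail_progression: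
  "j < m \<Longrightarrow> val (pos p + 1 + j) = root_mult + of_nat j * incr 0 \<and> pred_sum (pos p + 1 + j) = root_mult + (of_nat j - 1) * incr 0"
proof (induction j)
  case 0
  then show ?case using pred_sum_root by (simp add: root_mult_def incr_def)
next
  case (Suc j)
  then have IH: "val (pos p + 1 + j) = root_mult + of_nat j * incr 0" "pred_sum (pos p + 1 + j) = root_mult + (of_nat j - 1) * incr 0"
    by auto
  have ib: "pos p + 1 + j < b" using Suc.prems b_eq by simp
  have "2 * val (pos p + 1 + j) = val (pos p + 1 + j + 1) + pred_sum (pos p + 1 + j)"
    using val_equation[of "pos p + 1 + j"] e_tail[of "pos p + 1 + j"] ib by (simp add: nx_def)
  then have "val (pos p + 1 + Suc j) = root_mult + of_nat (Suc j) * incr 0"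
    unfolding IH by (simp add: algebra_simps)
  moreover have "pred_sum (pos p + 1 + Suc j) = val (pos p + 1 + Suc j - 1)"
    by (rule pred_sum_other) (use not_first_tail[of "Suc (Suc j)"] ib in auto)
  then have "pred_sum (pos p + 1 + Suc j) = root_mult + (of_nat (Suc j) - 1) * incr 0"
    using IH by simp
  ultimately show ?case by simp
qed

lemma closing: "start_val 1 = root_mult + (of_nat m - 1) * incr 0" "pred_sum b = start_val 1 - incr 0"
proof -
  have b: "b = pos p + 1 + (m - 1)" using b_eq m by simp
  have mm: "of_nat (m - 1) = (of_nat m - 1 :: rat)" using m by (simp add: of_nat_diff)
  have "val b = root_mult + of_nat (m - 1) * incr 0 \<and> pred_sum b = root_mult + (of_nat (m - 1) - 1) * incr 0"
    using tail_progression[of "m - 1"] m unfolding b[symmetric] by simp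
  then show "start_val 1 = root_mult + (of_nat m - 1) * incr 0" "pred_sum b = start_val 1 - incr 0"
    unfolding mm using val_b by (simp_all add: algebra_simps)
qed

text \<open>The equation at the beginning of a block relates the increments of the two adjacent blocks.\<close>

lemma incr_rec: assumes l: "l < p" shows "incr (l + 2) = incr l + of_nat (ks ! l) * (start_val (l + 1) - 1)"
proof -
  have ps: "pred_sum (if l = 0 then b else pos l) = start_val (Suc l) - incr l"
  proof (cases l)
    case 0
    then show ?thesis using closing by simp
  next
    case (Suc n)
    then show ?thesis using pred_sum_start[of n] l by simp
  qed
  have "of_nat (ks ! l + 2) * val (pos l) = of_nat (ks ! l) + val (pos (Suc l) + 1) + pred_sum (if l = 0 then b else pos l)"
  proof (cases "l = 0")
    case True
    have "b mod b = pos l" using True by simp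
    moreover have "1 \<le> b" using b_eq m by simp
    ultimately show ?thesis using val_equation[of b] True e_start[OF l] nx_start[OF l] val_b by simp
  next
    case False
    have "1 \<le> pos l" using pos_less[of 0 l] False l by simp
    then show ?thesis using val_equation[of "pos l"] pos_lt_b[of l] l e_start[OF l] nx_start[OF l] False by simp
  qed
  moreover have "val (pos (Suc l) + 1) = incr (l + 2) + start_val (Suc l)" by (simp add: incr_def)
  ultimately show ?thesis unfolding ps by (simp add: algebra_simps)
qed

text \<open>In the basis \<open>E\<^sub>i\<close> of \<open>H\<^sup>2\<close> with \<open>K = \<Sum>i. E\<^sub>i\<close> in which the curve
  at position \<open>i\<close> with entry \<open>e\<close> is \<open>E\<^sub>i\<close> minus the \<open>e - 1\<close> elements that follow
  cyclically, the defects are coefficients of \<open>K + \<Sum>E. d E * E\<close>. They satisfy a homogeneous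
  recursion.\<close>

definition defect :: "nat \<Rightarrow> rat" where "defect l = incr l - start_val l + 1"

lemma defect_rec: "l < p \<Longrightarrow> defect l = of_nat (ks ! l) * defect (l + 1) + defect (l + 2)"
  using start_val_rec[of l] incr_rec[of l] by (simp add: defect_def algebra_simps del: start_val_simps)

lemma defect_boundary: "defect p = defect 0" "defect (p + 1) = defect 0"
  using root_mult_eq by (simp_all add: defect_def incr_def root_mult_def algebra_simps)

text \<open>Going backwards from the end, the recursion has positive coefficients and so the factor in front of
  \<open>defect 0\<close> grows beyond \<open>1\<close>.\<close>

lemma defect_multiple: "l \<le> p \<Longrightarrow> \<exists>c. c \<ge> 1 \<and> (l < p \<longrightarrow> c \<ge> 2) \<and> defect l = c * defect 0 \<and> (\<exists>c'\<ge>1. defect (l + 1) = c' * defect 0)"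
proof (induction "p - l" arbitrary: l)
  case 0
  then show ?case using defect_boundary by (intro exI[of _ 1]) auto
next
  case (Suc n)
  then have l: "l < p" by simp
  obtain c c' where c: "c \<ge> 1" "defect (l + 1) = c * defect 0" "c' \<ge> 1" "defect (l + 2) = c' * defect 0"
  proof -
    have "n = p - (l + 1)" "l + 1 \<le> p" using Suc.hyps(2) l by simp_all
    from Suc.hyps(1)[OF this] show ?thesis using that by auto
  qed
  have k: "of_nat (ks ! l) \<ge> (1::rat)" using k1[OF l] by simp
  have "of_nat (ks ! l) * c \<ge> 1 * 1" by (rule mult_mono) (use k c in auto)
  then have "of_nat (ks ! l) * c + c' \<ge> 2" using c by simp
  moreover have "defect l = (of_nat (ks ! l) * c + c') * defect 0"
    using defect_rec[OF l] c by (simp add: algebra_simps)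
  ultimately show ?case using c by (intro exI[of _ "of_nat (ks ! l) * c + c'"]) auto
qed

text \<open>Having gone round the cycle, \<open>defect 0\<close> is a multiple of itself by a factor at least
  \<open>2\<close>.\<close>

lemma defect_zero: "l \<le> p + 1 \<Longrightarrow> defect l = 0"
proof -
  obtain c where "c \<ge> 2" "defect 0 = c * defect 0" using defect_multiple[of 0] p_pos by auto
  then have "(c - 1) * defect 0 = 0" by (simp add: algebra_simps)
  then have z: "defect 0 = 0" using \<open>c \<ge> 2\<close> by simp
  assume "l \<le> p + 1"
  then show ?thesis using defect_multiple[of l] defect_boundary z by (cases "l = p + 1") auto
qed

lemma incr_eq: "l \<le> p + 1 \<Longrightarrow> incr l = start_val l - 1"
  using defect_zero[of l] by (simp add: defect_def)

definition t :: rat where "t = val 1"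

lemma start_val_1: "start_val 1 = t + 1"
  using incr_eq[of 1] p_pos by (simp add: incr_def t_def)

lemma t_plus_m: "t + of_nat m = root_mult"
  using closing(1) incr_eq[of 0] start_val_1 by simp

definition y :: "nat \<Rightarrow> rat" where "y l = start_val l - 1"

lemma y_0: "y 0 = -1" and y_1: "y 1 = t"
  using start_val_1 by (simp_all add: y_def)

lemma y_rec: "l < p \<Longrightarrow> y (l + 2) = y l + of_nat (ks ! l) * y (l + 1)"
  using start_val_rec[of l] incr_eq[of "l + 1"] by (simp add: y_def)

lemma root_mult_y: "root_mult = y (p + 1) + y p + 1"
  using root_mult_eq incr_eq[of p] by (simp add: y_def)

definition tail_f :: "nat \<Rightarrow> nat" where
  "tail_f l = (if l = 0 then 0 else f_rev (rev (take (l - 1) (tl ks))))"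

lemma tail_f_simps: "tail_f 0 = 0" "tail_f (Suc l) = f_rev (rev (take l (tl ks)))"
  by (simp_all add: tail_f_def)

lemma f_rev_take: "Suc l < length xs \<Longrightarrow>
  f_rev (rev (take (Suc (Suc l)) xs)) = xs ! Suc l * f_rev (rev (take (Suc l) xs)) + f_rev (rev (take l xs))"
  by (simp add: take_Suc_conv_app_nth)

text \<open>The sequence \<open>y\<close> starts with \<open>-1\<close> and \<open>t\<close> and satisfies the recursion of
  continuants, of which two solutions are combined here.\<close>

lemma y_formula: "l \<le> p \<Longrightarrow> y (l + 1) = t * of_nat (f_rev (rev (take l ks))) - of_nat (tail_f l)"
proof (induction l rule: less_induct)
  case (less l)
  consider "l = 0" | "l = 1" | l' where "l = l' + 2" 
    by (metis One_nat_def add_2_eq_Suc' not0_implies_Suc)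
  then show ?case
  proof cases
    case 1
    then show ?thesis using y_1 by (simp add: tail_f_def)
  next
    case 2
    have "take 1 ks = [ks ! 0]" using take_Suc_conv_app_nth[of 0 ks] p_pos by simp
    moreover have "y (0 + 2) = - 1 + of_nat (ks ! 0) * t" using y_rec[of 0] y_0 y_1 p_pos by simp
    ultimately show ?thesis using 2 tail_f_simps(2)[of 0] by (simp add: numeral_2_eq_2)
  next
    case 3
    have IH: "y (l' + 1) = t * of_nat (f_rev (rev (take l' ks))) - of_nat (tail_f l')"
      "y (l' + 2) = t * of_nat (f_rev (rev (take (Suc l') ks))) - of_nat (tail_f (l' + 1))"
      using less.IH[of l'] less.IH[of "l' + 1"] 3 less.prems by simp_all
    have "y (l + 1) = y (l' + 1) + of_nat (ks ! Suc l') * y (l' + 2)"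
      using y_rec[of "l' + 1"] 3 less.prems by simp
    moreover have "f_rev (rev (take l ks)) = ks ! Suc l' * f_rev (rev (take (Suc l') ks)) + f_rev (rev (take l' ks))"
      using f_rev_take[of l' ks] 3 less.prems by simp
    moreover have "tail_f l = ks ! Suc l' * tail_f (l' + 1) + tail_f l'"
    proof (cases l')
      case 0
      have "take 1 (tl ks) = [ks ! 1]"
        using take_Suc_conv_app_nth[of 0 "tl ks"] 0 3 less.prems by (simp add: nth_tl)
      then show ?thesis using tail_f_simps(2)[of 1] tail_f_simps(2)[of 0] 0 3 by (simp add: tail_f_simps(1) numeral_2_eq_2)
    next
      case (Suc n)
      then show ?thesis using f_rev_take[of n "tl ks"] 3 less.prems by (simp add: tail_f_def nth_tl)
    qed
    ultimately show ?thesis unfolding IH by (simp add: algebra_simps)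
  qed
qed

lemma root_multiplicity: "root_mult = (of_nat (P_poly ks) + 1) * t - of_nat (P_poly (tl ks))"
proof -
  obtain n where n: "p = Suc n" using p_pos by (cases p) auto
  have tl_rev: "tl (rev xs) = rev (take (length xs - 1) xs)" if "xs \<noteq> []" for xs :: "nat list"
    by (metis butlast_conv_take butlast_rev rev_rev_ident)
  have fP: "f_rev (rev ks) + f_rev (rev (take n ks)) = P_poly ks + 1"
    using f_rev_P_rev[of "rev ks"] ne tl_rev[of ks] n by (simp add: P_poly_def)
  have gP: "tail_f p + tail_f n = P_poly (tl ks) + 1"
  proof (cases n)
    case 0
    then have "tl ks = []" using n by (metis length_0_conv length_tl diff_Suc_1)
    then show ?thesis using n 0 by (simp add: tail_f_simps P_poly_def)
  next
    case (Suc k)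
    then have "tl ks \<noteq> []" "length (tl ks) = Suc k" using n by (cases ks; auto)+
    then show ?thesis using f_rev_P_rev[of "rev (tl ks)"] tl_rev[of "tl ks"] Suc n
      by (simp add: P_poly_def tail_f_def)
  qed
  have "root_mult = t * of_nat (f_rev (rev ks) + f_rev (rev (take n ks))) - of_nat (tail_f p + tail_f n) + 1"
    unfolding root_mult_y using y_formula[of p] y_formula[of n] n by (simp add: algebra_simps)
  then show ?thesis unfolding fP gP by (simp add: algebra_simps)
qed

lemma P_poly_pos: "P_poly ks > 0"
proof -
  have pos: "(\<forall>k\<in>set xs. k \<ge> 1) \<Longrightarrow> f_rev xs \<ge> (1::nat)" for xs
    by (induction xs rule: f_rev.induct) auto
  obtain a zs where "rev ks = a # zs" using ne by (cases "rev ks") auto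
  moreover have "\<forall>k\<in>set (rev ks). k \<ge> 1" using kpos by simp
  ultimately show ?thesis using pos[of zs] by (simp add: P_poly_def)
qed

lemma t_formula: "t = (of_nat m + of_nat (P_poly (tl ks))) / of_nat (P_poly ks)"
proof -
  have "t * of_nat (P_poly ks) = of_nat m + of_nat (P_poly (tl ks))"
    using t_plus_m root_multiplicity by (simp add: algebra_simps)
  then show ?thesis using P_poly_pos by (simp add: field_simps)
qed

lemma t_pos: "t > 0"
  unfolding t_formula using P_poly_pos m by (intro divide_pos_pos) (auto simp: add_pos_nonneg)

lemma y_bound: "l \<le> p \<Longrightarrow> y l \<ge> -1" "l \<le> p \<Longrightarrow> y (l + 1) > -1"
proof -
  have "y (p + 1) + y p = t + of_nat m - 1" using t_plus_m root_mult_y by simp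
  then have "y (p + 1) + y p > 0" using t_pos m by simp
  from alternating_sequence_bound[of y p "(!) ks", OF y_0 _ y_rec k1 this]
  show "l \<le> p \<Longrightarrow> y l \<ge> -1" "l \<le> p \<Longrightarrow> y (l + 1) > -1" using t_pos y_1 by auto
qed

lemma value_cases:
  assumes "i < b"
  obtains l j where "l < p" "1 \<le> j" "j \<le> ks ! l" "x i = start_val l + of_nat j * y (l + 1)"
  | j where "j < m" "x i = root_mult - of_nat j"
proof (cases "i = 0 \<or> pos p < i")
  case True
  have b: "b = pos p + 1 + (m - 1)" using b_eq m by simp
  define j where "j = (if i = 0 then m - 1 else i - pos p - 1)"
  have j: "j < m" "val (pos p + 1 + j) = x i"
  proof -
    show "j < m" using True assms m b_eq unfolding j_def by auto
    show "val (pos p + 1 + j) = x i"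
      using True assms val_b val_less[of i] b unfolding j_def by (auto simp del: One_nat_def)
  qed
  have "x i = root_mult - of_nat j" using tail_progression[OF j(1)] j(2) incr_eq[of 0] by simp
  then show ?thesis using that(2) j(1) by blast
next
  case False
  then have "i - 1 < pos p" by auto
  then obtain l j where lj: "l < p" "j < ks ! l" "i - 1 = pos l + j" using block_cases[of "i - 1" p] by auto
  have "i \<ge> 1" using False by simp
  then have i: "i = pos l + Suc j" using lj(3) by linarith
  have "x i = start_val l + of_nat (Suc j) * incr (Suc l)"
    using block_progression[OF lj(1), of "Suc j"] lj i val_less[OF assms] by simp
  also have "incr (Suc l) = y (l + 1)" using incr_eq[of "Suc l"] lj(1) by (simp add: y_def)
  finally show ?thesis using that(1)[of l "Suc j"] lj by auto
qed

text \<open>An arithmetic progression takes its least value at an end. The ends are \<open>y l + 1\<close> with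
  \<open>y l \<ge> -1\<close>, and only \<open>y 0 + 1\<close> can be \<open>0\<close>; or \<open>t + m\<close> and
  \<open>t + 1\<close> for the final entries.\<close>

lemma multiplicity_pos: assumes "i < b" shows "x i > 0"
  using assms
proof (cases rule: value_cases)
  case (1 l j)
  define k where "k = rat_of_nat (ks ! l)"
  have k: "k > 0" "of_nat j \<le> k" "of_nat j \<ge> (1::rat)" using 1 unfolding k_def by simp_all
  have a: "start_val l \<ge> 0" "start_val l + k * y (l + 1) > 0"
    using y_bound(1)[of l] y_bound(2)[of "l + 1"] y_bound(2)[of l] 1(1) start_val_rec[OF 1(1)] incr_eq[of "Suc l"] y_rec[OF 1(1)]
  proof -
    show "start_val l \<ge> 0" using y_bound(1)[of l] 1(1) by (simp add: y_def)
    have "y (l + 2) > -1" using y_bound(2)[of "l + 1"] 1(1) by simp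
    then show "start_val l + k * y (l + 1) > 0" using y_rec[OF 1(1)] unfolding k_def by (simp add: y_def)
  qed
  show ?thesis
  proof (cases "y (l + 1) \<ge> 0")
    case True
    show ?thesis
    proof (cases "y (l + 1) = 0")
      case True
      then show ?thesis using a 1(4) by simp
    next
      case False
      then have "of_nat j * y (l + 1) > 0" using True k(3) by (intro mult_pos_pos) auto
      then show ?thesis using a(1) 1(4) by simp
    qed
  next
    case False
    then have "of_nat j * y (l + 1) \<ge> k * y (l + 1)" using k by (intro mult_right_mono_neg) auto
    then show ?thesis using a(2) 1(4) by simp
  qed
next
  case (2 j)
  have "of_nat j < (of_nat m :: rat)" using 2(1) by simp
  then show ?thesis using t_plus_m t_pos 2(2) by linarith
qed

lemma multiplicity_integral:
  assumes nt: "of_nat n * t \<in> \<int>" and i: "i < b" shows "of_nat n * x i \<in> \<int>"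
proof -
  have ny: "of_nat n * y l \<in> \<int> \<and> of_nat n * y (l + 1) \<in> \<int>" if "l \<le> p" for l
    using that
  proof (induction l)
    case 0
    then show ?case using nt y_0 y_1 by simp
  next
    case (Suc l)
    have "of_nat n * y (l + 2) = of_nat n * y l + of_nat (ks ! l) * (of_nat n * y (l + 1))"
      using y_rec[of l] Suc.prems by (simp add: algebra_simps)
    then show ?case using Suc by simp
  qed
  from i show ?thesis
  proof (cases rule: value_cases)
    case (1 l j)
    have "of_nat n * x i = of_nat n * y l + of_nat n + of_nat j * (of_nat n * y (l + 1))"
    proof -
      have "x i = y l + 1 + of_nat j * y (l + 1)" using 1(4) y_def[of l] by simp
      then show ?thesis by (simp add: algebra_simps)
    qed
    then show ?thesis using ny[of l] 1(1) by simp
  next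
    case (2 j)
    have "of_nat n * x i = of_nat n * t + of_nat n * of_nat m - of_nat n * of_nat j"
    proof -
      have xi: "x i = t + of_nat m - of_nat j" using 2(2) t_plus_m by simp
      show ?thesis unfolding xi by (simp add: algebra_simps)
    qed
    then show ?thesis using nt by simp
  qed
qed

lemma root_value: "x ((dl_next e ^^ (beta ks + 1)) 0) = root_mult"
  unfolding root_position by (simp add: root_mult_def val_def)

lemma tip_value: "x 1 = t"
proof -
  have "1 < b" using b_eq m pos_less[of 0 p] p_pos by simp
  then show ?thesis by (simp add: t_def val_less)
qed

end

section \<open>Multiplicities and index\<close>

text \<open>\<open>P div gcd a P\<close> is the denominator of \<open>a / P\<close> in lowest terms.\<close>

lemma least_clearing_denominator:
  assumes "P > (0::nat)"
  shows "(LEAST n. n > 0 \<and> of_nat n * (of_nat a / of_nat P :: rat) \<in> \<int>) = P div gcd a P"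
proof -
  have iff: "of_nat n * (of_nat a / of_nat P :: rat) \<in> \<int> \<longleftrightarrow> P div gcd a P dvd n" for n
  proof -
    have "of_nat n * (of_nat a / of_nat P :: rat) = of_nat (n * a) / of_nat P" by simp
    moreover have "of_nat (n * a) / of_nat P \<in> (\<int> :: rat set) \<longleftrightarrow> P dvd n * a"
    proof
      assume "of_nat (n * a) / of_nat P \<in> (\<int> :: rat set)"
      then obtain z where "of_nat (n * a) / of_nat P = (of_int z :: rat)" by (elim Ints_cases)
      then have "of_nat (n * a) = (of_int z * of_nat P :: rat)" using assms by (simp add: field_simps)
      then have "(of_int (int (n * a)) :: rat) = of_int (z * int P)" by simp
      then have "int (n * a) = z * int P" by (simp only: of_int_eq_iff)
      then have "int P dvd int (n * a)" by simp
      then show "P dvd n * a" by (simp only: int_dvd_int_iff)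
    next
      assume "P dvd n * a"
      then obtain z where "n * a = P * z" by (elim dvdE)
      then have "of_nat (n * a) / of_nat P = (of_nat z :: rat)" using assms by simp
      then show "of_nat (n * a) / of_nat P \<in> (\<int> :: rat set)" by (metis Ints_of_nat)
    qed
    moreover have "P dvd n * a \<longleftrightarrow> P div gcd a P dvd n"
    proof -
      define h where "h = gcd a P"
      have h: "h > 0" using assms unfolding h_def by simp
      obtain a' P' where aP: "a = a' * h" "P = P' * h" "coprime a' P'"
        using gcd_coprime_exists[of a P] h unfolding h_def by auto
      from aP(3) have "coprime P' a'" by (simp add: coprime_commute)
      then have "P' dvd n * a' \<longleftrightarrow> P' dvd n" by (rule coprime_dvd_mult_left_iff)
      moreover have "P dvd n * a \<longleftrightarrow> P' dvd n * a'"
        unfolding aP(1,2) using h by (simp flip: mult.assoc)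
      moreover have "P div gcd a P = P'" unfolding h_def[symmetric] using aP(2) h by simp
      ultimately show ?thesis by simp
    qed
    ultimately show ?thesis by simp
  qed
  have pos: "P div gcd a P > 0" using assms by (simp add: div_greater_zero_iff gcd_le2_nat)
  show ?thesis unfolding iff
    by (rule Least_equality) (use pos in \<open>auto dest: dvd_imp_le\<close>)
qed

theorem theorem3p5:
  fixes S :: "'a surface" and ks :: "nat list" and m :: nat
    and D :: "nat \<Rightarrow> 'a set" and d :: "'a set \<Rightarrow> rat" and t r :: rat
  assumes "intermediate_kato_surface S"
    and "ks \<noteq> []" and "\<forall>k \<in> set ks. k \<ge> 1" and "m \<ge> 1"
    and "dloussky_sequence S (simple_sequence ks m) D"
    and "anticanonical_multiplicities S d"
    and "t = d (branch_curve (simple_sequence ks m) D 1)"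
    and "r = d (cycle_curve (simple_sequence ks m) D (beta ks + 1))"
  shows "r = (of_nat (P_poly ks) + 1) * t - of_nat (P_poly (tl ks))
    \<and> t + of_nat m = r
    \<and> t = (of_nat m + of_nat (P_poly (tl ks))) / of_nat (P_poly ks)
    \<and> t > 0
    \<and> ((\<forall>E \<in> rational_curves S. d E \<in> \<int> \<and> d E > 0) \<longleftrightarrow> t \<in> \<int> \<and> t > 0)
    \<and> of_nat (surface_index S) =
        (of_nat (P_poly ks) / of_nat (gcd (m + P_poly (tl ks)) (P_poly ks)) :: rat)"
proof -
  let ?e = "simple_sequence ks m" and ?a = "m + P_poly (tl ks)" and ?P = "P_poly ks"
  have S: "compact_complex_surface S"
    using assms(1) unfolding intermediate_kato_surface_def kato_surface_def by blast
  have sm: "simple_multiplicities ks m (\<lambda>i. d' (D i))" if "anticanonical_multiplicities S d'" for d'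
    by unfold_locales (use assms(2,3,4) dloussky_equation[OF S assms(5) that] in auto)
  have bij: "bij_betw D {..<length ?e} (rational_curves S)"
    using assms(5) unfolding dloussky_sequence_def by blast
  have t: "t = d (D 1)" using assms(7) by (simp add: branch_curve_def)
  have r: "r = d (D ((dl_next ?e ^^ (beta ks + 1)) 0))" using assms(8) by (simp add: cycle_curve_def)
  interpret M: simple_multiplicities ks m "\<lambda>i. d (D i)" by (rule sm[OF assms(6)])
  have tM: "M.t = t" and rM: "M.root_mult = r" using M.tip_value M.root_value t r by simp_all
  have tip: "D 1 \<in> rational_curves S"
  proof -
    have "1 < length ?e" using M.b_eq M.pos_less[of 0 "length ks"] M.p_pos assms(4) by simp
    then show ?thesis using bij by (auto simp: bij_betw_def)
  qed
  have pos: "d E > 0" if "E \<in> rational_curves S" for E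
  proof -
    obtain i where "i < length ?e" "E = D i" using \<open>E \<in> _\<close> bij by (auto simp: bij_betw_def)
    then show ?thesis using M.multiplicity_pos by simp
  qed
  have tP: "t = of_nat ?a / of_nat ?P" using M.t_formula tM by simp
  have index: "(\<exists>d'. anticanonical_multiplicities S d' \<and> (\<forall>E\<in>rational_curves S. of_nat n * d' E \<in> \<nat>))
      \<longleftrightarrow> of_nat n * t \<in> \<int>" for n
  proof
    assume "\<exists>d'. anticanonical_multiplicities S d' \<and> (\<forall>E\<in>rational_curves S. of_nat n * d' E \<in> \<nat>)"
    then obtain d' where d': "anticanonical_multiplicities S d'" "\<forall>E\<in>rational_curves S. of_nat n * d' E \<in> \<nat>" by blast
    (* all solutions have the same tip, so the index can be read off from d *)
    interpret M': simple_multiplicities ks m "\<lambda>i. d' (D i)" by (rule sm[OF d'(1)])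
    have "d' (D 1) = t" using M'.tip_value M'.t_formula M.t_formula tM by simp
    then have "of_nat n * t \<in> \<nat>" using d'(2) tip by metis
    then show "of_nat n * t \<in> \<int>" using Nats_subset_Ints by blast
  next
    assume n: "of_nat n * t \<in> \<int>"
    have "of_nat n * d E \<in> \<nat>" if E: "E \<in> rational_curves S" for E
    proof -
      obtain i where i: "i < length ?e" "E = D i" using E bij by (auto simp: bij_betw_def)
      have "of_nat n * d E \<in> \<int>" using M.multiplicity_integral[of n i] n tM i by simp
      moreover have "of_nat n * d E \<ge> 0" using pos[OF E] by simp
      ultimately show ?thesis by (metis Nats_altdef2 mem_Collect_eq)
    qed
    then show "\<exists>d'. anticanonical_multiplicities S d' \<and> (\<forall>E\<in>rational_curves S. of_nat n * d' E \<in> \<nat>)"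
      using assms(6) by blast
  qed
  have "surface_index S = (LEAST n. n > 0 \<and> of_nat n * t \<in> \<int>)"
    unfolding surface_index_def index ..
  also have "\<dots> = ?P div gcd ?a ?P"
    unfolding tP by (rule least_clearing_denominator[OF M.P_poly_pos])
  finally have si: "surface_index S = ?P div gcd ?a ?P" .
  have "of_nat (surface_index S) = (of_nat ?P / of_nat (gcd ?a ?P) :: rat)"
  proof -
    have "of_nat (?P div gcd ?a ?P) * of_nat (gcd ?a ?P) = (of_nat ?P :: rat)"
      by (simp flip: of_nat_mult)
    then show ?thesis unfolding si using M.P_poly_pos by (simp add: field_simps)
  qed
  moreover have "(\<forall>E \<in> rational_curves S. d E \<in> \<int> \<and> d E > 0) \<longleftrightarrow> t \<in> \<int> \<and> t > 0"
  proof
    assume "\<forall>E \<in> rational_curves S. d E \<in> \<int> \<and> d E > 0"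
    then show "t \<in> \<int> \<and> t > 0" using tip t by simp
  next
    assume "t \<in> \<int> \<and> t > 0"
    then have "d E \<in> \<int>" if E: "E \<in> rational_curves S" for E
    proof -
      obtain i where "i < length ?e" "E = D i" using E bij by (auto simp: bij_betw_def)
      then show ?thesis using M.multiplicity_integral[of 1 i] \<open>t \<in> \<int> \<and> t > 0\<close> tM by simp
    qed
    then show "\<forall>E \<in> rational_curves S. d E \<in> \<int> \<and> d E > 0" using pos by blast
  qed
  ultimately show ?thesis
    using M.root_multiplicity M.t_plus_m M.t_formula M.t_pos unfolding tM rM by blast
qed

end
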